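(* Let $\mathbf i=(1,\dots,r,\,\dots,\,1,\dots,r,\,1,\dots,i_n)$ ($m-1$ full cycles followed by the $m$-th cycle $1,\dots,i_n$), with $1\le m\le r$, $1\le i_n\le r$, $n=(m-1)r+i_n$. Let $k\in\{1,\dots,n\}$, suppose the $k$-th entry $i_k$ belongs to the $m'$-th cycle, and set $d:=i_k$. For $a=t^{\sum_i a_ih_i}\in H$ ($t\in\mathbb C^\times$) and $\mathbf Y\in(\mathbb C^\times)^n$, $$\Delta^G(k;\mathbf i)(a,\mathbf Y)=\begin{cases}t^{\,a_r-a_{m'}-a_{d-r+m'}}\,\Delta^L(k;\mathbf i)(\mathbf Y)&\text{if } m'+d>r,\\[2pt] t^{\,a_{m'+d}-a_{m'}}\,\Delta^L(k;\mathbf i)(\mathbf Y)&\text{if } m'+d\le r.\end{cases}$$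
   Context: **Group.** $G=Sp_{2r}(\mathbb C)$, of type $C_r$, with Chevalley generators $e_i,f_i,h_i$ ($1\le i\le r$) of its Lie algebra, Cartan matrix $a_{i,j}=\alpha_j(h_i)$ with $a_{i,i}=2$, $a_{i,j}=-1$ if $|i-j|=1$ and $(i,j)\ne(r-1,r)$, $a_{r-1,r}=-2$, and $a_{i,j}=0$ otherwise. $\Lambda_i$ are the fundamental weights, $\Lambda_i(h_j)=\delta_{i,j}$, $\Lambda_0=0$. The vector representation $V(\Lambda_1)=\mathbb C^{2r}$ has basis $v_i,v_{\overline i}$ ($1\le i\le r$) with weights $\mathrm{wt}(v_i)=\Lambda_i-\Lambda_{i-1}$, $\mathrm{wt}(v_{\overline i})=\Lambda_{i-1}-\Lambda_i$, and action $f_iv_i=v_{i+1}$, $f_iv_{\overline{i+1}}=v_{\overline i}$, $e_iv_{i+1}=v_i$, $e_iv_{\overline i}=v_{\overline{i+1}}$ ($1\le i<r$), $f_rv_r=v_{\overline r}$, $e_rv_{\overline r}=v_r$, all other actions of $e_i,f_i$ on basis vectors being zero. $B,B_-$ are the opposite Borel subgroups (generated by $H$ and the $x_i(t)$, resp. by $H$ and the $y_i(t)$ below), $N,N_-$ their unipotent radicals, $H=B\cap B_-$. $W=\langle s_1,\dots,s_r\rangle=\mathrm{Norm}_G(H)/H$. For $t\in\mathbb C$: $x_i(t)=\exp(te_i)$, $y_i(t)=\exp(tf_i)$. For $t\in\mathbb C^\times$: $\alpha_i^\vee(t)=t^{h_i}\in H$; for integers $a_1,\dots,a_r$, $t^{\sum_ia_ih_i}=\prod_i\alpha_i^\vee(t)^{a_i}$,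 which acts on a vector of weight $\mu$ by $t^{\sum_i a_i\mu(h_i)}$. Put $x_{-i}(t)=y_i(t)\alpha_i^\vee(t^{-1})$. Representatives: $\overline{s_i}=x_i(-1)y_i(1)x_i(-1)$ and $\overline w=\overline{s_{j_1}}\cdots\overline{s_{j_p}}$ for a reduced expression $w=s_{j_1}\cdots s_{j_p}$. **Generalized minors.** Let $G_0=N_-HN$; for $x\in G_0$ write $x=[x]_-[x]_0[x]_+$ with $[x]_-\in N_-$, $[x]_0\in H$, $[x]_+\in N$. For $w,w'\in W$, $\Delta_{w\Lambda_i,w'\Lambda_i}$ is the regular function on $G$ whose restriction to $\overline wG_0\overline{w'}^{-1}$ is $x\mapsto([\overline w^{-1}x\overline{w'}]_0)^{\Lambda_i}$. **The words.** $\mathbf i=(i_1,\dots,i_n)$ is a reduced word for $u=(s_1s_2\cdots s_r)^{m-1}s_1\cdots s_{i_n}$. For $k$ in the $m'$-th cycle, $u_{\le k}=s_{i_1}\cdots s_{i_k}=(s_1\cdots s_r)^{m'-1}s_1\cdots s_{i_k}$, and $\Delta(k;\mathbf i):=\Delta_{u_{\le k}\Lambda_{i_k},\Lambda_{i_k}}$. For $\mathbf Y=(Y_{1,1},\dots,Y_{1,r},\dots,Y_{m-1,r},Y_{m,1},\dots,Y_{m,i_n})\in(\mathbb C^\times)^n$ and $a\in H$ put $$x^L_{\mathbf i}(\mathbf Y)=\big(x_{-1}(Y_{1,1})\cdots x_{-r}(Y_{1,r})\big)\cdots\big(x_{-1}(Y_{m-1,1})\cdots x_{-r}(Y_{m-1,r})\big)\,x_{-1}(Y_{m,1})\cdots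 x_{-i_n}(Y_{m,i_n}),$$ $\overline x^G_{\mathbf i}(a;\mathbf Y)=a\,x^L_{\mathbf i}(\mathbf Y)$, $\Delta^L(k;\mathbf i)(\mathbf Y):=\Delta(k;\mathbf i)(x^L_{\mathbf i}(\mathbf Y))$ and $\Delta^G(k;\mathbf i)(a,\mathbf Y):=\Delta(k;\mathbf i)(\overline x^G_{\mathbf i}(a;\mathbf Y))$. *)

theory Defs
  imports
    Jordan_Normal_Form.Matrix
    "HOL-Algebra.Generated_Groups"
    "HOL-Algebra.Group_Action"
    "HOL-Analysis.Abstract_Topology"
begin

section \<open>The symplectic group and its Chevalley generators\<close>

text \<open>
  The basis of the vector representation is ordered as
  v_1, ..., v_r, v_{bar r}, ..., v_{bar 1} (positions 0, ..., 2r-1), so that the e_i are upper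
  triangular.
\<close>

definition pos :: "nat \<Rightarrow> nat" where
  "pos i = i - 1"

definition pos_bar :: "nat \<Rightarrow> nat \<Rightarrow> nat" where
  "pos_bar r i = 2 * r - i"

text \<open>The matrix sending the basis vector at position q to the one at position p.\<close>

definition matrix_unit :: "nat \<Rightarrow> nat \<Rightarrow> nat \<Rightarrow> complex mat" where
  "matrix_unit r p q = mat (2 * r) (2 * r) (\<lambda>(a, b). if a = p \<and> b = q then 1 else 0)"

definition chev_e :: "nat \<Rightarrow> nat \<Rightarrow> complex mat" where
  "chev_e r i =
     (if i < r then matrix_unit r (pos i) (pos (i + 1)) + matrix_unit r (pos_bar r (i + 1)) (pos_bar r i)
      else matrix_unit r (pos r) (pos_bar r r))"

definition chev_f :: "nat \<Rightarrow> nat \<Rightarrow> complex mat" where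
  "chev_f r i =
     (if i < r then matrix_unit r (pos (i + 1)) (pos i) + matrix_unit r (pos_bar r i) (pos_bar r (i + 1))
      else matrix_unit r (pos_bar r r) (pos r))"

text \<open>
  The alternating form with \<open>\<langle>v_i, v_{bar i}\<rangle> = (-1)^(i-1)\<close>, all other pairings of v_i with basis
  vectors being zero. Up to a scalar it is the only bilinear form that is invariant under all
  \<open>chev_e r i\<close> and \<open>chev_f r i\<close>.
\<close>

definition sp_form :: "nat \<Rightarrow> complex mat" where
  "sp_form r = mat (2 * r) (2 * r) (\<lambda>(a, b). if a + b + 1 = 2 * r then (- 1) ^ a else 0)"

definition Sp :: "nat \<Rightarrow> complex mat monoid" where
  "Sp r = \<lparr> carrier = {A \<in> carrier_mat (2 * r) (2 * r). transpose_mat A * sp_form r * A = sp_form r},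
            mult = (*), one = 1\<^sub>m (2 * r) \<rparr>"

definition list_mult :: "('a, 'b) monoid_scheme \<Rightarrow> 'a list \<Rightarrow> 'a" where
  "list_mult G xs = foldr (\<otimes>\<^bsub>G\<^esub>) xs \<one>\<^bsub>G\<^esub>"


section \<open>Weights and one-parameter subgroups\<close>

text \<open>A weight \<open>\<mu>\<close> is encoded by its values \<open>\<mu> j\<close> on the simple coroots h_j, for j from 1 to r.\<close>

definition fund_weight :: "nat \<Rightarrow> nat \<Rightarrow> int" where
  "fund_weight i j = (if i = j \<and> i \<noteq> 0 then 1 else 0)"

definition basis_weight :: "nat \<Rightarrow> nat \<Rightarrow> nat \<Rightarrow> int" where
  "basis_weight r p j =
     (if p < r then fund_weight (p + 1) j - fund_weight p j
      else fund_weight (2 * r - p - 1) j - fund_weight (2 * r - p) j)"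

definition mat_exp :: "complex mat \<Rightarrow> complex mat" where
  "mat_exp A = mat (dim_row A) (dim_row A) (\<lambda>(a, b). \<Sum>k. (A ^\<^sub>m k) $$ (a, b) / fact k)"

definition x_sub :: "nat \<Rightarrow> nat \<Rightarrow> complex \<Rightarrow> complex mat" where
  "x_sub r i t = mat_exp (t \<cdot>\<^sub>m chev_e r i)"

definition y_sub :: "nat \<Rightarrow> nat \<Rightarrow> complex \<Rightarrow> complex mat" where
  "y_sub r i t = mat_exp (t \<cdot>\<^sub>m chev_f r i)"

text \<open>The element \<open>t^{h_i}\<close> of the torus.\<close>

definition coroot :: "nat \<Rightarrow> nat \<Rightarrow> complex \<Rightarrow> complex mat" where
  "coroot r i t = mat (2 * r) (2 * r) (\<lambda>(a, b). if a = b then t powi (basis_weight r a i) else 0)"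

definition x_neg :: "nat \<Rightarrow> nat \<Rightarrow> complex \<Rightarrow> complex mat" where
  "x_neg r i t = y_sub r i t \<otimes>\<^bsub>Sp r\<^esub> coroot r i (inverse t)"

text \<open>The torus element \<open>t^{a_1 h_1 + ... + a_r h_r}\<close>.\<close>

definition torus_elt :: "nat \<Rightarrow> complex \<Rightarrow> (nat \<Rightarrow> int) \<Rightarrow> complex mat" where
  "torus_elt r t a = list_mult (Sp r) (map (\<lambda>i. coroot r i t [^]\<^bsub>Sp r\<^esub> a i) [1..<Suc r])"

text \<open>
  The maximal torus H. As the group is simply connected, H is generated by the images of the simple
  coroots; it is also the intersection of the two opposite Borel subgroups defined below.
\<close>

definition torus :: "nat \<Rightarrow> complex mat set" where
  "torus r = generate (Sp r) {coroot r i t | i t. i \<in> {1..r} \<and> t \<noteq> 0}"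

text \<open>
  The value at h of the character of the torus with weight \<open>\<mu>\<close>, determined by
  \<open>t^{h_j} \<mapsto> t^{\<mu>(h_j)}\<close>.
\<close>

definition torus_char :: "nat \<Rightarrow> (nat \<Rightarrow> int) \<Rightarrow> complex mat \<Rightarrow> complex" where
  "torus_char r \<mu> h =
     (THE c. \<exists>\<tau>. (\<forall>j\<in>{1..r}. \<tau> j \<noteq> 0) \<and>
                 h = list_mult (Sp r) (map (\<lambda>j. coroot r j (\<tau> j)) [1..<Suc r]) \<and>
                 c = (\<Prod>j\<in>{1..r}. \<tau> j powi \<mu> j))"


section \<open>Regular functions and the Zariski topology\<close>

inductive_set poly_fun :: "nat \<Rightarrow> (complex mat \<Rightarrow> complex) set" for n where
  const: "(\<lambda>_. c) \<in> poly_fun n"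
| entry: "i < n \<Longrightarrow> j < n \<Longrightarrow> (\<lambda>A. A $$ (i, j)) \<in> poly_fun n"
| add: "p \<in> poly_fun n \<Longrightarrow> q \<in> poly_fun n \<Longrightarrow> (\<lambda>A. p A + q A) \<in> poly_fun n"
| mult: "p \<in> poly_fun n \<Longrightarrow> q \<in> poly_fun n \<Longrightarrow> (\<lambda>A. p A * q A) \<in> poly_fun n"

text \<open>
  The group is Zariski closed in the affine space of all matrices, so its regular functions are
  the restrictions of polynomials in the matrix entries. They are made \<open>undefined\<close> outside the group.
\<close>

definition regular_functions :: "nat \<Rightarrow> (complex mat \<Rightarrow> complex) set" where
  "regular_functions r =
     {f \<in> extensional (carrier (Sp r)). \<exists>p\<in>poly_fun (2 * r). \<forall>x\<in>carrier (Sp r). f x = p x}"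

definition zariski :: "nat \<Rightarrow> complex mat topology" where
  "zariski n = topology_generated_by {{A \<in> carrier_mat n n. p A \<noteq> 0} | p. p \<in> poly_fun n}"


section \<open>Borel subgroups and Gauss decomposition\<close>

definition borel_pos :: "nat \<Rightarrow> complex mat set" where
  "borel_pos r = generate (Sp r) (torus r \<union> {x_sub r i t | i t. i \<in> {1..r}})"

definition borel_neg :: "nat \<Rightarrow> complex mat set" where
  "borel_neg r = generate (Sp r) (torus r \<union> {y_sub r i t | i t. i \<in> {1..r}})"

definition unipotent_mat :: "nat \<Rightarrow> complex mat \<Rightarrow> bool" where
  "unipotent_mat n A \<longleftrightarrow> (\<exists>k. (A - 1\<^sub>m n) ^\<^sub>m k = 0\<^sub>m n n)"

text \<open>
  The largest closed connected normal unipotent subgroup of a closed connected solvable subgroup K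
  (such as a Borel subgroup).
\<close>

definition unipotent_radical :: "nat \<Rightarrow> complex mat set \<Rightarrow> complex mat set" where
  "unipotent_radical r K =
     (GREATEST U. U \<lhd> (Sp r)\<lparr>carrier := K\<rparr> \<and>
                  closedin (subtopology (zariski (2 * r)) K) U \<and>
                  connectedin (zariski (2 * r)) U \<and>
                  (\<forall>u\<in>U. unipotent_mat (2 * r) u))"

definition N_pos :: "nat \<Rightarrow> complex mat set" where
  "N_pos r = unipotent_radical r (borel_pos r)"

definition N_neg :: "nat \<Rightarrow> complex mat set" where
  "N_neg r = unipotent_radical r (borel_neg r)"

definition G0 :: "nat \<Rightarrow> complex mat set" where
  "G0 r = (N_neg r <#>\<^bsub>Sp r\<^esub> torus r) <#>\<^bsub>Sp r\<^esub> N_pos r"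

definition gauss_torus :: "nat \<Rightarrow> complex mat \<Rightarrow> complex mat" where
  "gauss_torus r x =
     (THE h. h \<in> torus r \<and> (\<exists>y\<in>N_neg r. \<exists>z\<in>N_pos r. x = y \<otimes>\<^bsub>Sp r\<^esub> h \<otimes>\<^bsub>Sp r\<^esub> z))"


section \<open>The Weyl group\<close>

definition torus_normalizer :: "nat \<Rightarrow> complex mat monoid" where
  "torus_normalizer r = (Sp r)\<lparr>carrier := normalizer (Sp r) (torus r)\<rparr>"

definition weyl :: "nat \<Rightarrow> complex mat set monoid" where
  "weyl r = torus_normalizer r Mod torus r"

definition s_bar :: "nat \<Rightarrow> nat \<Rightarrow> complex mat" where
  "s_bar r i = x_sub r i (- 1) \<otimes>\<^bsub>Sp r\<^esub> y_sub r i 1 \<otimes>\<^bsub>Sp r\<^esub> x_sub r i (- 1)"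

definition simple_refl :: "nat \<Rightarrow> nat \<Rightarrow> complex mat set" where
  "simple_refl r i = torus r #>\<^bsub>torus_normalizer r\<^esub> s_bar r i"

definition word_elt :: "nat \<Rightarrow> nat list \<Rightarrow> complex mat set" where
  "word_elt r js = list_mult (weyl r) (map (simple_refl r) js)"

definition reduced_word :: "nat \<Rightarrow> complex mat set \<Rightarrow> nat list \<Rightarrow> bool" where
  "reduced_word r w = is_arg_min length (\<lambda>js. set js \<subseteq> {1..r} \<and> word_elt r js = w)"

text \<open>
  The product of the representatives \<open>s_bar\<close> does not depend on the reduced word of w; an arbitrary one
  is chosen.
\<close>

definition weyl_rep :: "nat \<Rightarrow> complex mat set \<Rightarrow> complex mat" where
  "weyl_rep r w = list_mult (Sp r) (map (s_bar r) (SOME js. reduced_word r w js))"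


section \<open>Generalized minors\<close>

text \<open>The minor \<open>\<Delta>_{w \<Lambda>_i, w' \<Lambda>_i}\<close>.\<close>

definition gen_minor ::
    "nat \<Rightarrow> complex mat set \<Rightarrow> complex mat set \<Rightarrow> nat \<Rightarrow> complex mat \<Rightarrow> complex" where
  "gen_minor r w w' i =
     (THE f. f \<in> regular_functions r \<and>
        (\<forall>x \<in> (weyl_rep r w <#\<^bsub>Sp r\<^esub> G0 r) #>\<^bsub>Sp r\<^esub> inv\<^bsub>Sp r\<^esub> weyl_rep r w'.
           f x = torus_char r (fund_weight i)
                   (gauss_torus r (inv\<^bsub>Sp r\<^esub> weyl_rep r w \<otimes>\<^bsub>Sp r\<^esub> x \<otimes>\<^bsub>Sp r\<^esub> weyl_rep r w'))))"


section \<open>The words and the cells\<close>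

text \<open>
  Position k of the word (counted from 1) carries the pair \<open>(m', d)\<close> of its cycle number m' and
  its letter d; l is the last letter of the word. These pairs also index the coordinates of \<open>Y\<close>.
\<close>

definition cell_index :: "nat \<Rightarrow> nat \<Rightarrow> nat \<Rightarrow> (nat \<times> nat) list" where
  "cell_index r m l =
     concat (map (\<lambda>s. map (Pair s) [1..<Suc r]) [1..<m]) @ map (Pair m) [1..<Suc l]"

definition cell_word :: "nat \<Rightarrow> nat \<Rightarrow> nat \<Rightarrow> nat list" where
  "cell_word r m l = map snd (cell_index r m l)"

definition xL :: "nat \<Rightarrow> nat \<Rightarrow> nat \<Rightarrow> (nat \<Rightarrow> nat \<Rightarrow> complex) \<Rightarrow> complex mat" where
  "xL r m l Y = list_mult (Sp r) (map (\<lambda>(s, j). x_neg r j (Y s j)) (cell_index r m l))"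

definition xG ::
    "nat \<Rightarrow> nat \<Rightarrow> nat \<Rightarrow> complex mat \<Rightarrow> (nat \<Rightarrow> nat \<Rightarrow> complex) \<Rightarrow> complex mat" where
  "xG r m l a Y = a \<otimes>\<^bsub>Sp r\<^esub> xL r m l Y"

text \<open>The minor \<open>\<Delta>(k; i)\<close> attached to the k-th position of a word \<open>is\<close>.\<close>

definition minor_at :: "nat \<Rightarrow> nat list \<Rightarrow> nat \<Rightarrow> complex mat \<Rightarrow> complex" where
  "minor_at r is k = gen_minor r (word_elt r (take k is)) \<one>\<^bsub>weyl r\<^esub> (is ! (k - 1))"

definition minor_L :: "nat \<Rightarrow> nat \<Rightarrow> nat \<Rightarrow> nat \<Rightarrow> (nat \<Rightarrow> nat \<Rightarrow> complex) \<Rightarrow> complex" where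
  "minor_L r m l k Y = minor_at r (cell_word r m l) k (xL r m l Y)"

definition minor_G ::
    "nat \<Rightarrow> nat \<Rightarrow> nat \<Rightarrow> nat \<Rightarrow> complex mat \<Rightarrow> (nat \<Rightarrow> nat \<Rightarrow> complex) \<Rightarrow> complex" where
  "minor_G r m l k a Y = minor_at r (cell_word r m l) k (xG r m l a Y)"

end

theory Submission
  imports Defs "Jordan_Normal_Form.Determinant"
begin

text \<open>
  On the symplectic group, \<open>\<Delta>_{w \<Lambda>_i, \<Lambda>_i}\<close> is the leading principal minor of size i of \<open>wbar^{-1} x\<close>,
  where \<open>wbar\<close> is the chosen representative of w. Conjugation by the monomial matrix \<open>wbar\<close> permutes the
  diagonal of a torus element a, so replacing x by a x multiplies this minor by the product of the
  first i diagonal entries of \<open>wbar^{-1} a wbar\<close>, which is the value of the weight \<open>w \<Lambda>_i\<close> at a.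

  That the minor is determined by its values on the translated big cell rests on the density of the
  big cell: its Zariski closure is stable under left multiplication by every root subgroup, and the
  root subgroups of the simple roots and their negatives generate the symplectic group.
\<close>

text \<open>The radicals, the torus part of a Gauss decomposition, the characters and the minors are
  specified by \<open>GREATEST\<close> or \<open>THE\<close>, so existence and uniqueness must be
  settled before anything can be computed; this shapes most of the proof. The representative of w is
  chosen by \<open>SOME\<close>: only its coset is known, but as torus elements are diagonal, all
  members of the coset have the same pattern of nonzero entries, which is the permutation of basis
  positions read off from any word. Stability of the closure is a one-variable argument: for B in
  the big cell, x_i(t) B stays there for small t, so a polynomial vanishing on the cell vanishes
  along the whole curve. The exponent arises because the prefix ending at letter d of cycle m'
  carries position q < d to entry q + m', counted from 0, of the list v_1, ..., v_r, v_{bar 1}, ...,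
  v_{bar r}. The weights of consecutive entries telescope; the case distinction records whether the
  d entries reach the barred half.\<close>

lemma mat_mult_index:
  assumes "A \<in> carrier_mat n n" "B \<in> carrier_mat n n" "i < n" "j < n"
  shows "(A * B) $$ (i, j) = (\<Sum>k<n. A $$ (i, k) * B $$ (k, j))"
  using assms by (auto simp: scalar_prod_def atLeast0LessThan)

lemmas mat_assoc_square = assoc_mult_mat[of _ n n _ n _ n] mult_carrier_mat[of _ n n _ n] for n

section \<open>The symplectic form and the group that preserves it\<close>

lemma Sp_simps [simp]: "x \<otimes>\<^bsub>Sp r\<^esub> y = x * y" "\<one>\<^bsub>Sp r\<^esub> = 1\<^sub>m (2 * r)"
  by (simp_all add: Sp_def)

lemma Sp_carrier_iff:
  "A \<in> carrier (Sp r) \<longleftrightarrow>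
     A \<in> carrier_mat (2 * r) (2 * r) \<and> transpose_mat A * sp_form r * A = sp_form r"
  by (simp add: Sp_def)

lemma Sp_carrier_mat: "A \<in> carrier (Sp r) \<Longrightarrow> A \<in> carrier_mat (2 * r) (2 * r)"
  by (simp add: Sp_carrier_iff)

lemma sp_form_carrier [simp]: "sp_form r \<in> carrier_mat (2 * r) (2 * r)"
  by (simp add: sp_form_def)

lemma sp_form_dim [simp]: "dim_row (sp_form r) = 2 * r" "dim_col (sp_form r) = 2 * r"
  by (simp_all add: sp_form_def)

lemma sp_form_mult_one [simp]: "1\<^sub>m (2 * r) * sp_form r = sp_form r" "sp_form r * 1\<^sub>m (2 * r) = sp_form r"
  using left_mult_one_mat[OF sp_form_carrier] right_mult_one_mat[OF sp_form_carrier] by auto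

lemma sp_form_index:
  "a < 2 * r \<Longrightarrow> b < 2 * r \<Longrightarrow> sp_form r $$ (a, b) = (if b = 2 * r - 1 - a then (- 1) ^ a else 0)"
  by (auto simp: sp_form_def)

lemma sp_form_mult_left:
  assumes "M \<in> carrier_mat (2 * r) (2 * r)" "a < 2 * r" "b < 2 * r"
  shows "(sp_form r * M) $$ (a, b) = (- 1) ^ a * M $$ (2 * r - 1 - a, b)"
proof -
  have "(sp_form r * M) $$ (a, b) =
      (\<Sum>k<2*r. if k = 2 * r - 1 - a then (- 1) ^ a * M $$ (k, b) else 0)"
    using assms unfolding mat_mult_index[OF sp_form_carrier assms]
    by (intro sum.cong) (auto simp: sp_form_index)
  then show ?thesis
    using assms by (simp add: sum.delta)
qed

lemma sp_form_mult_right: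
  assumes "M \<in> carrier_mat (2 * r) (2 * r)" "a < 2 * r" "b < 2 * r"
  shows "(M * sp_form r) $$ (a, b) = M $$ (a, 2 * r - 1 - b) * (- 1) ^ (b + 1)"
proof -
  have "(M * sp_form r) $$ (a, b) =
      (\<Sum>k<2*r. if k = 2 * r - 1 - b then M $$ (a, k) * (- 1) ^ k else 0)"
    using assms unfolding mat_mult_index[OF assms(1) sp_form_carrier assms(2,3)]
    by (intro sum.cong) (auto simp: sp_form_index)
  also have "\<dots> = M $$ (a, 2 * r - 1 - b) * (- 1) ^ (2 * r - 1 - b)"
    using assms by (simp add: sum.delta)
  also have "(- 1 :: complex) ^ (2 * r - 1 - b) = (- 1) ^ (b + 1)"
    using assms by (auto simp: minus_one_power_iff)
  finally show ?thesis .
qed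

text \<open>Positions a and 2r - 1 - a have opposite parity, so the two signs multiply to -1. Hence
  \<open>- sp_form r\<close> is the inverse of the form.\<close>

lemma sp_form_squared: "sp_form r * sp_form r = - 1\<^sub>m (2 * r)"
proof (rule eq_matI)
  fix a b assume "a < dim_row (- 1\<^sub>m (2 * r) :: complex mat)" "b < dim_col (- 1\<^sub>m (2 * r) :: complex mat)"
  then have ab: "a < 2 * r" "b < 2 * r" by auto
  show "(sp_form r * sp_form r) $$ (a, b) = (- 1\<^sub>m (2 * r)) $$ (a, b)"
    using ab by (subst sp_form_mult_left) (auto simp: sp_form_index minus_one_power_iff)
qed (auto simp: sp_form_def)

lemma group_Sp: "group (Sp r)"
proof (rule groupI)
  let ?n = "2 * r" and ?J = "sp_form r"
  fix x y assume x: "x \<in> carrier (Sp r)" and y: "y \<in> carrier (Sp r)"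
  note c = Sp_carrier_mat[OF x] Sp_carrier_mat[OF y]
  have "transpose_mat (x * y) * ?J * (x * y) = transpose_mat y * (transpose_mat x * ?J * x) * y"
    using c by (simp add: transpose_mult[of _ ?n ?n _ ?n] mat_assoc_square[where n = ?n])
  then show "x \<otimes>\<^bsub>Sp r\<^esub> y \<in> carrier (Sp r)"
    using x y mult_carrier_mat[OF c] by (simp add: Sp_carrier_iff)
next
  let ?n = "2 * r" and ?J = "sp_form r"
  show "\<one>\<^bsub>Sp r\<^esub> \<in> carrier (Sp r)"
    by (simp add: Sp_carrier_iff)
  fix x assume x: "x \<in> carrier (Sp r)"
  note c = Sp_carrier_mat[OF x]
  show "\<one>\<^bsub>Sp r\<^esub> \<otimes>\<^bsub>Sp r\<^esub> x = x" using c by simp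
  \<comment> \<open>Solving x^T J x = J for the inverse of x, with J^{-1} = -J, gives this
    candidate.\<close>
  define B where "B = - ?J * transpose_mat x * ?J"
  have B: "B \<in> carrier_mat ?n ?n" using c by (simp add: B_def mat_assoc_square[where n = ?n])
  have "B * x = - ?J * (transpose_mat x * ?J * x)"
    unfolding B_def using c by (simp add: mat_assoc_square[where n = ?n])
  also have "\<dots> = - (?J * ?J)"
    using x by (simp add: Sp_carrier_iff uminus_mult_left_mat[of "?J" ?J] carrier_matD[OF sp_form_carrier])
  also have "\<dots> = 1\<^sub>m ?n"
    by (simp add: sp_form_squared)
  finally have Bx: "B * x = 1\<^sub>m ?n" .
  have xB: "x * B = 1\<^sub>m ?n" by (rule mat_mult_left_right_inverse[OF B c Bx])
  have "transpose_mat B * ?J * B = transpose_mat B * (transpose_mat x * ?J * x) * B"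
    using x by (simp add: Sp_carrier_iff)
  also have "\<dots> = (transpose_mat B * transpose_mat x) * ?J * (x * B)"
    using c B by (simp add: mat_assoc_square[where n = ?n])
  also have "transpose_mat B * transpose_mat x = transpose_mat (x * B)"
    using c B by (simp add: transpose_mult[of _ ?n ?n _ ?n])
  finally have "transpose_mat B * ?J * B = ?J" by (simp add: xB)
  then show "\<exists>y\<in>carrier (Sp r). y \<otimes>\<^bsub>Sp r\<^esub> x = \<one>\<^bsub>Sp r\<^esub>"
    using B Bx by (intro bexI[of _ B]) (auto simp: Sp_carrier_iff)
next
  fix x y z assume "x \<in> carrier (Sp r)" "y \<in> carrier (Sp r)" "z \<in> carrier (Sp r)"
  then show "x \<otimes>\<^bsub>Sp r\<^esub> y \<otimes>\<^bsub>Sp r\<^esub> z = x \<otimes>\<^bsub>Sp r\<^esub> (y \<otimes>\<^bsub>Sp r\<^esub> z)"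
    by (auto dest!: Sp_carrier_mat)
qed

interpretation Sp: group "Sp r" for r
  by (rule group_Sp)

lemma Sp_mult_closed [intro]: "A \<in> carrier (Sp r) \<Longrightarrow> B \<in> carrier (Sp r) \<Longrightarrow> A * B \<in> carrier (Sp r)"
  using Sp.m_closed[of A r B] by simp

lemma Sp_inv_mult:
  assumes "A \<in> carrier (Sp r)"
  shows "inv\<^bsub>Sp r\<^esub> A * A = 1\<^sub>m (2 * r)" "A * inv\<^bsub>Sp r\<^esub> A = 1\<^sub>m (2 * r)"
  using Sp.l_inv[OF assms] Sp.r_inv[OF assms] by simp_all

lemma Sp_assoc:
  assumes "A \<in> carrier (Sp r)" "B \<in> carrier (Sp r)" "C \<in> carrier (Sp r)"
  shows "A * B * C = A * (B * C)"
  using assms by (auto dest!: Sp_carrier_mat)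

section \<open>Root subgroups\<close>

text \<open>For i = r the positions i - 1 and 2r - 1 - i coincide, so one formula covers short and
  long simple roots and later computations need no case distinction on i.\<close>

lemma chev_e_altdef:
  assumes "i \<in> {1..r}"
  shows "chev_e r i = mat (2 * r) (2 * r) (\<lambda>(a, b). if b = a + 1 \<and> (a = i - 1 \<or> a = 2 * r - 1 - i) then 1 else 0)"
    (is "_ = ?M")
proof (rule eq_matI)
  fix a b assume "a < dim_row ?M" "b < dim_col ?M"
  then have ab: "a < 2 * r" "b < 2 * r" by auto
  have *: "a = i - 1 \<and> b = i \<longleftrightarrow> b = a + 1 \<and> a = i - 1"
    "a = 2 * r - (i + 1) \<and> b = 2 * r - i \<longleftrightarrow> b = a + 1 \<and> a = 2 * r - 1 - i"
    using assms ab by auto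
  show "chev_e r i $$ (a, b) = ?M $$ (a, b)"
  proof (cases "i < r")
    case True
    have "chev_e r i $$ (a, b) = (if a = i - 1 \<and> b = i then 1 else 0) +
        (if a = 2 * r - (i + 1) \<and> b = 2 * r - i then 1 else 0)"
      using True ab by (simp add: chev_e_def matrix_unit_def pos_def pos_bar_def conj_commute)
    also have "\<dots> = ?M $$ (a, b)"
    proof -
      have "i - 1 \<noteq> 2 * r - 1 - i" using True by auto
      then have "\<not> (a = i - 1 \<and> a = 2 * r - 1 - i)" by blast
      then show ?thesis unfolding * index_mat(1)[OF ab] prod.case
        by (cases "b = a + 1"; cases "a = i - 1"; cases "a = 2 * r - 1 - i") (simp_all only: simp_thms if_True if_False add_0 add_0_right)
    qed
    finally show ?thesis .
  next
    case False
    then have "i = r" using assms by auto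
    then show ?thesis
      using ab assms by (auto simp: chev_e_def matrix_unit_def pos_def pos_bar_def)
  qed
qed (auto simp: chev_e_def matrix_unit_def)

lemma chev_f_altdef:
  assumes "i \<in> {1..r}"
  shows "chev_f r i = mat (2 * r) (2 * r) (\<lambda>(a, b). if a = b + 1 \<and> (b = i - 1 \<or> b = 2 * r - 1 - i) then 1 else 0)"
    (is "_ = ?M")
proof (rule eq_matI)
  fix a b assume "a < dim_row ?M" "b < dim_col ?M"
  then have ab: "a < 2 * r" "b < 2 * r" by auto
  have *: "b = i - 1 \<and> a = i \<longleftrightarrow> a = b + 1 \<and> b = i - 1"
    "b = 2 * r - (i + 1) \<and> a = 2 * r - i \<longleftrightarrow> a = b + 1 \<and> b = 2 * r - 1 - i"
    using assms ab by auto
  show "chev_f r i $$ (a, b) = ?M $$ (a, b)"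
  proof (cases "i < r")
    case True
    have "chev_f r i $$ (a, b) = (if b = i - 1 \<and> a = i then 1 else 0) +
        (if b = 2 * r - (i + 1) \<and> a = 2 * r - i then 1 else 0)"
      using True ab by (simp add: chev_f_def matrix_unit_def pos_def pos_bar_def conj_commute)
    also have "\<dots> = ?M $$ (a, b)"
    proof -
      have "i - 1 \<noteq> 2 * r - 1 - i" using True by auto
      then have "\<not> (b = i - 1 \<and> b = 2 * r - 1 - i)" by blast
      then show ?thesis unfolding * index_mat(1)[OF ab] prod.case
        by (cases "a = b + 1"; cases "b = i - 1"; cases "b = 2 * r - 1 - i") (simp_all only: simp_thms if_True if_False add_0 add_0_right)
    qed
    finally show ?thesis .
  next
    case False
    then have "i = r" using assms by auto
    then show ?thesis
      using ab assms by (auto simp: chev_f_def matrix_unit_def pos_def pos_bar_def)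
  qed
qed (auto simp: chev_f_def matrix_unit_def)

text \<open>Reduces facts about the negative root subgroups to the positive ones.\<close>

lemma chev_f_transpose: "i \<in> {1..r} \<Longrightarrow> chev_f r i = transpose_mat (chev_e r i)"
  unfolding chev_f_altdef chev_e_altdef by (intro eq_matI) simp_all

lemma chev_e_carrier: "i \<in> {1..r} \<Longrightarrow> chev_e r i \<in> carrier_mat (2 * r) (2 * r)"
  by (simp add: chev_e_altdef)

text \<open>Nonzero entries sit at (a, a + 1) with a = i - 1 or a = 2r - 1 - i. A nonzero product
  would need two consecutive such values, but they differ by the even number 2r - 2i.\<close>

lemma chev_e_squared:
  assumes "i \<in> {1..r}"
  shows "chev_e r i * chev_e r i = 0\<^sub>m (2 * r) (2 * r)"
proof (rule eq_matI)
  fix a b assume "a < dim_row (0\<^sub>m (2 * r) (2 * r) :: complex mat)" "b < dim_col (0\<^sub>m (2 * r) (2 * r) :: complex mat)"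
  then have ab: "a < 2 * r" "b < 2 * r" by auto
  have "chev_e r i $$ (a, k) * chev_e r i $$ (k, b) = 0" if "k < 2 * r" for k
    using ab that assms by (auto simp: chev_e_altdef) presburger+
  then show "(chev_e r i * chev_e r i) $$ (a, b) = 0\<^sub>m (2 * r) (2 * r) $$ (a, b)"
    using ab by (simp add: mat_mult_index[OF chev_e_carrier chev_e_carrier, OF assms assms] sum.neutral del: mult_eq_0_iff)
qed (auto simp: chev_e_altdef[OF assms])

text \<open>Infinitesimal invariance of the form: \<open>chev_e r i\<close> lies in the symplectic
  Lie algebra. Both sides live on the entries with a + b = 2r, where the signs at a and b
  agree.\<close>

lemma chev_e_sp_form:
  assumes "i \<in> {1..r}"
  shows "transpose_mat (chev_e r i) * sp_form r = - (sp_form r * chev_e r i)"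
proof (rule eq_matI)
  fix a b assume "a < dim_row (- (sp_form r * chev_e r i))" "b < dim_col (- (sp_form r * chev_e r i))"
  then have ab: "a < 2 * r" "b < 2 * r" by (auto simp: sp_form_def chev_e_altdef[OF assms])
  have c: "chev_e r i \<in> carrier_mat (2 * r) (2 * r)" by (rule chev_e_carrier[OF assms])
  have "(transpose_mat (chev_e r i) * sp_form r) $$ (a, b) = chev_e r i $$ (2 * r - 1 - b, a) * (- 1) ^ (b + 1)"
    using ab c by (subst sp_form_mult_right) auto
  also have "\<dots> = - ((- 1) ^ a * chev_e r i $$ (2 * r - 1 - a, b))"
  proof -
    have entry: "chev_e r i $$ (p, q) = (if q = p + 1 \<and> (q = i \<or> q = 2 * r - i) then 1 else 0)"
      if "p < 2 * r" "q < 2 * r" for p q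
      using that assms by (auto simp: chev_e_altdef)
    have "a = 2 * r - 1 - b + 1 \<longleftrightarrow> a + b = 2 * r" "b = 2 * r - 1 - a + 1 \<longleftrightarrow> a + b = 2 * r"
      using ab by arith+
    moreover have "b = i \<longleftrightarrow> a = 2 * r - i" "b = 2 * r - i \<longleftrightarrow> a = i" if "a + b = 2 * r"
      using that assms by auto
    moreover have "2 * r - 1 - b < 2 * r" "2 * r - 1 - a < 2 * r" using ab by auto
    moreover have "(- 1 :: complex) ^ (b + 1) = - ((- 1) ^ a)" if "a + b = 2 * r"
    proof -
      have "even a \<longleftrightarrow> even b" using that by presburger
      then show ?thesis by (simp add: minus_one_power_iff)
    qed
    ultimately show ?thesis
      using ab by (simp only: entry) (auto split: if_splits)
  qed
  also have "\<dots> = (- (sp_form r * chev_e r i)) $$ (a, b)"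
    using ab c by (subst index_uminus_mat) (auto simp: sp_form_mult_left carrier_matD[OF sp_form_carrier] simp del: index_mult_mat(1))
  finally show "(transpose_mat (chev_e r i) * sp_form r) $$ (a, b) = (- (sp_form r * chev_e r i)) $$ (a, b)" .
qed (use chev_e_carrier[OF assms] in \<open>auto simp: sp_form_def\<close>)

lemma mat_exp_square_zero:
  assumes A: "A \<in> carrier_mat n n" and sq: "A * A = 0\<^sub>m n n"
  shows "mat_exp A = 1\<^sub>m n + A"
proof (rule eq_matI)
  have pow0: "A ^\<^sub>m (k + 2) = 0\<^sub>m n n" for k
    using A by (simp add: numeral_2_eq_2 mat_assoc_square[where n = n] sq)
  fix a b assume "a < dim_row (1\<^sub>m n + A)" "b < dim_col (1\<^sub>m n + A)"
  then have ab: "a < n" "b < n" using A by auto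
  have "(\<Sum>k. (A ^\<^sub>m k) $$ (a, b) / fact k) = (\<Sum>k\<in>{0, 1}. (A ^\<^sub>m k) $$ (a, b) / fact k)"
  proof (rule suminf_finite)
    fix k :: nat assume "k \<notin> {0, 1}"
    then have "k = (k - 2) + 2" by auto
    then show "(A ^\<^sub>m k) $$ (a, b) / fact k = 0"
      using pow0[of "k - 2"] ab by (metis div_0 index_zero_mat(1))
  qed simp
  then show "mat_exp A $$ (a, b) = (1\<^sub>m n + A) $$ (a, b)"
    using ab A by (simp add: mat_exp_def)
qed (use A in \<open>auto simp: mat_exp_def\<close>)

lemma x_sub_eq:
  assumes "i \<in> {1..r}"
  shows "x_sub r i t = 1\<^sub>m (2 * r) + t \<cdot>\<^sub>m chev_e r i"
proof -
  note c = chev_e_carrier[OF assms]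
  have "t \<cdot>\<^sub>m chev_e r i * (t \<cdot>\<^sub>m chev_e r i) = (t * t) \<cdot>\<^sub>m (chev_e r i * chev_e r i)"
    using c by (auto simp: mult_smult_distrib[OF _ c] mult_smult_assoc_mat[OF c])
  then show ?thesis
    unfolding x_sub_def using c by (intro mat_exp_square_zero) (auto simp: chev_e_squared[OF assms])
qed

lemma y_sub_eq:
  assumes "i \<in> {1..r}"
  shows "y_sub r i t = transpose_mat (x_sub r i t)"
proof -
  note c = chev_e_carrier[OF assms]
  have sq: "chev_f r i * chev_f r i = 0\<^sub>m (2 * r) (2 * r)"
    using transpose_mult[OF c c] by (simp add: chev_f_transpose[OF assms] chev_e_squared[OF assms])
  have c': "chev_f r i \<in> carrier_mat (2 * r) (2 * r)"
    using c by (simp add: chev_f_transpose[OF assms])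
  have "t \<cdot>\<^sub>m chev_f r i * (t \<cdot>\<^sub>m chev_f r i) = (t * t) \<cdot>\<^sub>m (chev_f r i * chev_f r i)"
    using c' by (auto simp: mult_smult_distrib[OF _ c'] mult_smult_assoc_mat[OF c'])
  then have "y_sub r i t = 1\<^sub>m (2 * r) + t \<cdot>\<^sub>m chev_f r i"
    unfolding y_sub_def using c' by (intro mat_exp_square_zero) (auto simp: sq)
  then show ?thesis
    using c by (intro eq_matI) (auto simp: x_sub_eq[OF assms] chev_f_transpose[OF assms])
qed

lemma x_sub_index:
  assumes "i \<in> {1..r}" "a < 2 * r" "b < 2 * r"
  shows "x_sub r i t $$ (a, b) =
    (if a = b then 1 else if b = a + 1 \<and> (a = i - 1 \<or> a = 2 * r - 1 - i) then t else 0)"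
  using assms(2,3) by (auto simp: x_sub_eq[OF assms(1)] chev_e_altdef[OF assms(1)])

lemma x_sub_carrier_mat: "i \<in> {1..r} \<Longrightarrow> x_sub r i t \<in> carrier_mat (2 * r) (2 * r)"
  by (simp add: x_sub_eq chev_e_altdef)

lemma x_sub_dim [simp]: "i \<in> {1..r} \<Longrightarrow> dim_row (x_sub r i t) = 2 * r" "i \<in> {1..r} \<Longrightarrow> dim_col (x_sub r i t) = 2 * r"
  using x_sub_carrier_mat[of i r t] by auto

lemma y_sub_carrier_mat: "i \<in> {1..r} \<Longrightarrow> y_sub r i t \<in> carrier_mat (2 * r) (2 * r)"
  by (simp add: y_sub_eq x_sub_carrier_mat)

lemma y_sub_index:
  assumes "i \<in> {1..r}" "a < 2 * r" "b < 2 * r"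
  shows "y_sub r i t $$ (a, b) =
    (if a = b then 1 else if a = b + 1 \<and> (b = i - 1 \<or> b = 2 * r - 1 - i) then t else 0)"
proof -
  have "y_sub r i t $$ (a, b) = x_sub r i t $$ (b, a)"
    using assms x_sub_carrier_mat[OF assms(1), of t] by (simp add: y_sub_eq)
  then show ?thesis
    unfolding x_sub_index[OF assms(1,3,2)] by (simp add: eq_commute[of a b])
qed

text \<open>The defining equation says that -J A^T J is a left inverse of A. It is then a right
  inverse, and this is the defining equation of the transpose.\<close>

lemma transpose_in_Sp:
  assumes "A \<in> carrier (Sp r)"
  shows "transpose_mat A \<in> carrier (Sp r)"
proof -
  let ?n = "2 * r" and ?J = "sp_form r"
  note c = Sp_carrier_mat[OF assms]
  have "(- ?J * transpose_mat A * ?J) * A = - ?J * (transpose_mat A * ?J * A)"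
    using c by (simp add: mat_assoc_square[where n = ?n])
  also have "\<dots> = 1\<^sub>m ?n"
    using assms by (simp add: Sp_carrier_iff sp_form_squared)
  finally have "A * (- ?J * transpose_mat A * ?J) = 1\<^sub>m ?n"
    by (intro mat_mult_left_right_inverse[OF _ c]) (use c in auto)
  then have "A * (- ?J * transpose_mat A * ?J) * ?J = ?J" by simp
  moreover have "A * (- ?J * transpose_mat A * ?J) * ?J = - (A * ?J * transpose_mat A * (?J * ?J))"
    using c by (simp add: mat_assoc_square[where n = ?n])
  moreover have "\<dots> = A * ?J * transpose_mat A"
    using c by (simp add: sp_form_squared)
  ultimately show ?thesis
    using c by (simp add: Sp_carrier_iff)
qed

text \<open>Expanding (1 + E)^T J (1 + E), the linear terms cancel by invariance of the form and the
  quadratic term is -J E E = 0.\<close>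

lemma x_sub_in_Sp:
  assumes "i \<in> {1..r}"
  shows "x_sub r i t \<in> carrier (Sp r)"
proof -
  let ?n = "2 * r" and ?J = "sp_form r" and ?E = "t \<cdot>\<^sub>m chev_e r i"
  note c = chev_e_carrier[OF assms]
  have EJ: "transpose_mat ?E * ?J = - (?J * ?E)"
  proof -
    have "transpose_mat ?E = t \<cdot>\<^sub>m transpose_mat (chev_e r i)"
      by (intro eq_matI) auto
    then have "transpose_mat ?E * ?J = t \<cdot>\<^sub>m (transpose_mat (chev_e r i) * ?J)"
      using c by (subst mult_smult_assoc_mat[symmetric, of _ ?n ?n _ ?n]) auto
    also have "\<dots> = - (?J * ?E)"
      using c by (simp add: chev_e_sp_form[OF assms] mult_smult_distrib[OF _ c]) 
         (intro eq_matI, auto)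
    finally show ?thesis .
  qed
  have "?E * ?E = (t * t) \<cdot>\<^sub>m (chev_e r i * chev_e r i)"
    using c by (auto simp: mult_smult_distrib[OF _ c] mult_smult_assoc_mat[OF c])
  then have E2: "?E * ?E = 0\<^sub>m ?n ?n"
    by (simp add: chev_e_squared[OF assms])
  have EE: "transpose_mat ?E * ?J * ?E = 0\<^sub>m ?n ?n"
    using c by (simp add: EJ mat_assoc_square[where n = ?n] E2) auto
  have "transpose_mat (1\<^sub>m ?n + ?E) * ?J * (1\<^sub>m ?n + ?E)
      = (?J + transpose_mat ?E * ?J) * (1\<^sub>m ?n + ?E)"
    using c by (simp add: transpose_add[of _ ?n ?n] add_mult_distrib_mat[of _ ?n ?n _ _ ?n])
  also have "\<dots> = ?J + transpose_mat ?E * ?J + (?J * ?E + transpose_mat ?E * ?J * ?E)"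
    using c by (subst mult_add_distrib_mat[of _ ?n ?n _ ?n])
      (auto simp: add_mult_distrib_mat[of ?J ?n ?n "transpose_mat ?E * ?J" ?E ?n] mult_carrier_mat[of _ ?n ?n])
  also have "\<dots> = ?J"
    unfolding EE unfolding EJ using c by (intro eq_matI) (auto simp del: index_mult_mat(1))
  finally show ?thesis
    using c by (simp add: Sp_carrier_iff x_sub_eq[OF assms])
qed

lemma y_sub_in_Sp: "i \<in> {1..r} \<Longrightarrow> y_sub r i t \<in> carrier (Sp r)"
  by (simp add: y_sub_eq transpose_in_Sp x_sub_in_Sp)

text \<open>A row operation with a single extra term; it lets products with root elements be
  compared entry by entry without sums.\<close>

lemma x_sub_mult_index:
  assumes i: "i \<in> {1..r}" and M: "M \<in> carrier_mat (2 * r) (2 * r)" and a: "a < 2 * r" "b < 2 * r"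
  shows "(x_sub r i t * M) $$ (a, b) =
     M $$ (a, b) + (if a = i - 1 \<or> a = 2 * r - 1 - i then t * M $$ (a + 1, b) else 0)"
proof -
  define P where "P \<longleftrightarrow> a = i - 1 \<or> a = 2 * r - 1 - i"
  have P: "P \<Longrightarrow> a + 1 < 2 * r \<and> a + 1 \<noteq> a" using a i by (auto simp: P_def)
  have "x_sub r i t $$ (a, k) * M $$ (k, b) =
      (if k = a then M $$ (a, b) else 0) + (if k = a + 1 then (if P then t * M $$ (a + 1, b) else 0) else 0)"
    if k: "k < 2 * r" for k
  proof -
    have "x_sub r i t $$ (a, k) = (if k = a then 1 else 0) + (if k = a + 1 then (if P then t else 0) else 0)"
      using P unfolding x_sub_index[OF i a(1) k] P_def using i a k by auto
    then show ?thesis by (simp add: distrib_right)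
  qed
  then have "(x_sub r i t * M) $$ (a, b) = (\<Sum>k<2*r. (if k = a then M $$ (a, b) else 0) +
          (if k = a + 1 then (if P then t * M $$ (a + 1, b) else 0) else 0))"
    by (subst mat_mult_index[OF x_sub_carrier_mat[OF i] M a]) (intro sum.cong, auto)
  also have "\<dots> = M $$ (a, b) + (if P then t * M $$ (a + 1, b) else 0)"
    using P a by (simp add: sum.distrib sum.delta)
  finally show ?thesis by (simp only: P_def)
qed

lemma y_sub_mult_index:
  assumes i: "i \<in> {1..r}" and M: "M \<in> carrier_mat (2 * r) (2 * r)" and a: "a < 2 * r" "b < 2 * r"
  shows "(y_sub r i t * M) $$ (a, b) =
     M $$ (a, b) + (if a = i \<or> a = 2 * r - i then t * M $$ (a - 1, b) else 0)"
proof -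
  define P where "P \<longleftrightarrow> a = i \<or> a = 2 * r - i"
  have P: "P \<Longrightarrow> a - 1 < 2 * r \<and> a - 1 \<noteq> a" using a i by (auto simp: P_def)
  have "y_sub r i t $$ (a, k) * M $$ (k, b) =
      (if k = a then M $$ (a, b) else 0) + (if k = a - 1 then (if P then t * M $$ (a - 1, b) else 0) else 0)"
    if k: "k < 2 * r" for k
  proof -
    have "y_sub r i t $$ (a, k) = (if k = a then 1 else 0) + (if k = a - 1 then (if P then t else 0) else 0)"
    proof -
      have *: "a = k + 1 \<and> (k = i - 1 \<or> k = 2 * r - 1 - i) \<longleftrightarrow> k = a - 1 \<and> P"
      proof (cases a)
        case 0
        then show ?thesis using i by (auto simp: P_def)
      next
        case (Suc a')
        have "Suc a' = i \<longleftrightarrow> a' = i - 1" "Suc a' = 2 * r - i \<longleftrightarrow> a' = 2 * r - 1 - i"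
          using i by auto
        then show ?thesis unfolding P_def Suc by auto
      qed
      show ?thesis
        unfolding y_sub_index[OF i a(1) k] * using P by auto
    qed
    then show ?thesis by (simp add: distrib_right)
  qed
  then have "(y_sub r i t * M) $$ (a, b) = (\<Sum>k<2*r. (if k = a then M $$ (a, b) else 0) +
          (if k = a - 1 then (if P then t * M $$ (a - 1, b) else 0) else 0))"
    by (subst mat_mult_index[OF y_sub_carrier_mat[OF i] M a]) (intro sum.cong, auto)
  also have "\<dots> = M $$ (a, b) + (if P then t * M $$ (a - 1, b) else 0)"
    using P a by (simp add: sum.distrib sum.delta)
  finally show ?thesis by (simp only: P_def)
qed

lemma x_sub_add:
  assumes "i \<in> {1..r}"
  shows "x_sub r i s * x_sub r i t = x_sub r i (s + t)"
proof (rule eq_matI)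
  fix a b assume "a < dim_row (x_sub r i (s + t))" "b < dim_col (x_sub r i (s + t))"
  then have ab: "a < 2 * r" "b < 2 * r" using assms by auto
  define P where "P \<longleftrightarrow> a = i - 1 \<or> a = 2 * r - 1 - i"
  \<comment> \<open>The same parity argument as for the vanishing square: row a + 1 of the second
    factor is a row of the identity.\<close>
  have P: "P \<Longrightarrow> a + 1 < 2 * r \<and> \<not> (a + 1 = i - 1 \<or> a + 1 = 2 * r - 1 - i)"
    using assms[unfolded atLeastAtMost_iff] ab unfolding P_def by presburger
  show "(x_sub r i s * x_sub r i t) $$ (a, b) = x_sub r i (s + t) $$ (a, b)"
    unfolding x_sub_mult_index[OF assms x_sub_carrier_mat[OF assms] ab] x_sub_index[OF assms ab] P_def[symmetric]
    using P x_sub_index[OF assms _ ab(2), of "a + 1" t] by (cases P) simp_all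
qed (use assms in auto)

lemma x_sub_0: "i \<in> {1..r} \<Longrightarrow> x_sub r i 0 = 1\<^sub>m (2 * r)"
  by (intro eq_matI) (auto simp: x_sub_index)

lemma y_sub_add:
  assumes "i \<in> {1..r}"
  shows "y_sub r i s * y_sub r i t = y_sub r i (s + t)"
  using assms x_sub_add[OF assms, of t s] x_sub_carrier_mat[OF assms]
  by (simp add: y_sub_eq transpose_mult[symmetric, of _ "2*r" "2*r" _ "2*r"] add.commute)

lemma y_sub_0: "i \<in> {1..r} \<Longrightarrow> y_sub r i 0 = 1\<^sub>m (2 * r)"
  by (simp add: y_sub_eq x_sub_0)

section \<open>The torus\<close>

definition diag_elt :: "nat \<Rightarrow> (nat \<Rightarrow> complex) \<Rightarrow> complex mat" where
  "diag_elt r d = mat (2 * r) (2 * r) (\<lambda>(a, b). if a = b then d a else 0)"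

lemma diag_elt_carrier [simp]: "diag_elt r d \<in> carrier_mat (2 * r) (2 * r)"
  "dim_row (diag_elt r d) = 2 * r" "dim_col (diag_elt r d) = 2 * r"
  by (simp_all add: diag_elt_def)

lemma diag_elt_index [simp]:
  "a < 2 * r \<Longrightarrow> b < 2 * r \<Longrightarrow> diag_elt r d $$ (a, b) = (if a = b then d a else 0)"
  by (simp add: diag_elt_def)

lemma diag_elt_mult_left:
  assumes "M \<in> carrier_mat (2 * r) (2 * r)" "a < 2 * r" "b < 2 * r"
  shows "(diag_elt r d * M) $$ (a, b) = d a * M $$ (a, b)"
proof -
  have "(diag_elt r d * M) $$ (a, b) = (\<Sum>k<2*r. if k = a then d a * M $$ (a, b) else 0)"
    using assms unfolding mat_mult_index[OF diag_elt_carrier(1) assms]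
    by (intro sum.cong) auto
  then show ?thesis using assms by (simp add: sum.delta)
qed

lemma diag_elt_mult_right:
  assumes "M \<in> carrier_mat (2 * r) (2 * r)" "a < 2 * r" "b < 2 * r"
  shows "(M * diag_elt r d) $$ (a, b) = M $$ (a, b) * d b"
proof -
  have "(M * diag_elt r d) $$ (a, b) = (\<Sum>k<2*r. if k = b then M $$ (a, b) * d b else 0)"
    using assms unfolding mat_mult_index[OF assms(1) diag_elt_carrier(1) assms(2,3)]
    by (intro sum.cong) auto
  then show ?thesis using assms by (simp add: sum.delta)
qed

lemma diag_elt_mult: "diag_elt r d * diag_elt r e = diag_elt r (\<lambda>a. d a * e a)"
  by (intro eq_matI) (auto simp: diag_elt_mult_left simp del: index_mult_mat(1))

lemma diag_elt_eq_iff: "diag_elt r d = diag_elt r e \<longleftrightarrow> (\<forall>a<2*r. d a = e a)"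
proof
  assume "diag_elt r d = diag_elt r e"
  then have "diag_elt r d $$ (a, a) = diag_elt r e $$ (a, a)" for a by simp
  then show "\<forall>a<2*r. d a = e a" by (metis diag_elt_index)
qed (auto intro!: eq_matI)

lemma diag_elt_one: "diag_elt r (\<lambda>_. 1) = 1\<^sub>m (2 * r)"
  by (intro eq_matI) auto

text \<open>Positions a and 2r - 1 - a carry v_i and v_{bar i}, the only basis vectors that pair
  nontrivially, so this is the condition for a diagonal matrix to preserve the form.\<close>

definition symplectic_diag :: "nat \<Rightarrow> (nat \<Rightarrow> complex) \<Rightarrow> bool" where
  "symplectic_diag r d \<longleftrightarrow> (\<forall>a<2*r. d a * d (2 * r - 1 - a) = 1)"

lemma symplectic_diag_nonzero: "symplectic_diag r d \<Longrightarrow> a < 2 * r \<Longrightarrow> d a \<noteq> 0"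
  unfolding symplectic_diag_def by (metis mult_zero_left zero_neq_one)

lemma diag_elt_in_Sp:
  assumes "symplectic_diag r d"
  shows "diag_elt r d \<in> carrier (Sp r)"
proof -
  have tr: "transpose_mat (diag_elt r d) = diag_elt r d"
    by (intro eq_matI) auto
  have "diag_elt r d * sp_form r * diag_elt r d = sp_form r"
  proof (rule eq_matI)
    fix a b assume "a < dim_row (sp_form r)" "b < dim_col (sp_form r)"
    then have ab: "a < 2 * r" "b < 2 * r" by auto
    have "(diag_elt r d * sp_form r * diag_elt r d) $$ (a, b) = d a * sp_form r $$ (a, b) * d b"
      using ab by (subst diag_elt_mult_right) (auto simp: diag_elt_mult_left mult_carrier_mat[of _ "2*r" "2*r"] simp del: index_mult_mat(1))
    also have "\<dots> = sp_form r $$ (a, b)"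
      using ab assms by (auto simp: sp_form_index symplectic_diag_def algebra_simps)
    finally show "(diag_elt r d * sp_form r * diag_elt r d) $$ (a, b) = sp_form r $$ (a, b)" .
  qed auto
  then show ?thesis by (simp add: Sp_carrier_iff tr)
qed

lemma symplectic_diag_mult:
  "symplectic_diag r d \<Longrightarrow> symplectic_diag r e \<Longrightarrow> symplectic_diag r (\<lambda>a. d a * e a)"
  unfolding symplectic_diag_def by (metis (no_types, opaque_lifting) mult.assoc mult.commute mult.right_neutral)

lemma symplectic_diag_inverse:
  "symplectic_diag r d \<Longrightarrow> symplectic_diag r (\<lambda>a. inverse (d a))"
  unfolding symplectic_diag_def by (metis inverse_1 inverse_mult_distrib)

lemma diag_elt_inverse:
  assumes "symplectic_diag r d"
  shows "inv\<^bsub>Sp r\<^esub> (diag_elt r d) = diag_elt r (\<lambda>a. inverse (d a))"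
proof (rule Sp.inv_equality)
  have "\<forall>a<2*r. inverse (d a) * d a = 1"
    using symplectic_diag_nonzero[OF assms] by simp
  then have "diag_elt r (\<lambda>a. inverse (d a) * d a) = 1\<^sub>m (2 * r)"
    unfolding diag_elt_one[symmetric] diag_elt_eq_iff by simp
  then show "diag_elt r (\<lambda>a. inverse (d a)) \<otimes>\<^bsub>Sp r\<^esub> diag_elt r d = \<one>\<^bsub>Sp r\<^esub>"
    by (simp add: diag_elt_mult)
qed (auto intro!: diag_elt_in_Sp symplectic_diag_inverse assms)

lemma coroot_eq: "coroot r i t = diag_elt r (\<lambda>a. t powi basis_weight r a i)"
  by (simp add: coroot_def diag_elt_def)

lemma basis_weight_opposite: "a < 2 * r \<Longrightarrow> basis_weight r (2 * r - 1 - a) i = - basis_weight r a i"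
  by (auto simp: basis_weight_def Suc_diff_Suc)

lemma coroot_symplectic: "t \<noteq> 0 \<Longrightarrow> symplectic_diag r (\<lambda>a. t powi basis_weight r a i)"
  unfolding symplectic_diag_def by (auto simp only: basis_weight_opposite power_int_minus) simp

lemma coroot_in_Sp: "t \<noteq> 0 \<Longrightarrow> coroot r i t \<in> carrier (Sp r)"
  by (simp add: coroot_eq diag_elt_in_Sp coroot_symplectic)

lemma list_mult_diag:
  "list_mult (Sp r) (map (\<lambda>j. diag_elt r (f j)) js) = diag_elt r (\<lambda>a. \<Prod>j\<leftarrow>js. f j a)"
  by (induction js) (simp_all add: list_mult_def diag_elt_one diag_elt_mult)

lemma prod_powi_fund_weight:
  assumes "i \<le> r" "\<forall>j\<in>{1..r}. \<tau> j \<noteq> 0"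
  shows "(\<Prod>j\<in>{1..r}. \<tau> j powi fund_weight i j) = (if i = 0 then 1 else \<tau> i :: complex)"
proof -
  have "(\<Prod>j\<in>{1..r}. \<tau> j powi fund_weight i j) = (\<Prod>j\<in>{1..r}. if j = i then \<tau> j else 1)"
    by (intro prod.cong) (auto simp: fund_weight_def)
  then show ?thesis using assms by (auto simp: prod.delta)
qed

text \<open>The convention that \<sigma> is 1 at 0 reflects \<Lambda>_0 = 0; with it every basis
  weight is a difference of two fundamental weights, also for v_1 and v_{bar 1}.\<close>

lemma prod_powi_basis_weight:
  assumes "a < 2 * r" "\<forall>j\<in>{1..r}. \<tau> j \<noteq> 0"
  defines "\<sigma> \<equiv> \<lambda>j. if j = 0 then 1 else \<tau> j :: complex"
  shows "(\<Prod>j\<in>{1..r}. \<tau> j powi basis_weight r a j) =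
     (if a < r then \<sigma> (a + 1) / \<sigma> a else \<sigma> (2 * r - a - 1) / \<sigma> (2 * r - a))"
proof -
  have "(\<Prod>j\<in>{1..r}. \<tau> j powi (fund_weight p j - fund_weight q j)) = \<sigma> p / \<sigma> q" if "p \<le> r" "q \<le> r" for p q
  proof -
    have "(\<Prod>j\<in>{1..r}. \<tau> j powi (fund_weight p j - fund_weight q j)) =
        (\<Prod>j\<in>{1..r}. \<tau> j powi fund_weight p j) / (\<Prod>j\<in>{1..r}. \<tau> j powi fund_weight q j)"
      unfolding prod_dividef[symmetric] using assms by (intro prod.cong) (auto simp: power_int_diff)
    then show ?thesis
      using that assms(2) by (simp add: prod_powi_fund_weight \<sigma>_def del: One_nat_def)
  qed
  then show ?thesis using assms(1) by (auto simp: basis_weight_def)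
qed

lemma list_mult_coroot:
  assumes "\<forall>j\<in>{1..r}. \<tau> j \<noteq> 0"
  shows "list_mult (Sp r) (map (\<lambda>j. coroot r j (\<tau> j)) [1..<Suc r]) =
     diag_elt r (\<lambda>a. \<Prod>j\<in>{1..r}. \<tau> j powi basis_weight r a j)"
proof -
  have "prod_list (map f [1..<Suc r]) = prod f {1..r}" for f :: "nat \<Rightarrow> complex"
    using prod.distinct_set_conv_list[of "[1..<Suc r]" f]
    by (simp add: atLeastLessThanSuc_atLeastAtMost del: upt_Suc)
  then show ?thesis
    by (simp only: coroot_eq list_mult_diag)
qed

lemma coroot_product_exists:
  assumes d: "symplectic_diag r d"
  shows "\<exists>\<tau>. (\<forall>j\<in>{1..r}. \<tau> j \<noteq> 0) \<and>
     diag_elt r d = list_mult (Sp r) (map (\<lambda>j. coroot r j (\<tau> j)) [1..<Suc r])"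
proof (intro exI conjI)
  \<comment> \<open>The j-th coordinate has to be the value of \<Lambda>_j, and \<Lambda>_j is the
    sum of the weights of v_1, ..., v_j; hence the partial products of the diagonal.\<close>
  let ?t = "\<lambda>j. \<Prod>p<j. d p"
  show nz: "\<forall>j\<in>{1..r}. ?t j \<noteq> 0"
    using symplectic_diag_nonzero[OF d] by auto
  have "d a = (\<Prod>j\<in>{1..r}. ?t j powi basis_weight r a j)" if a: "a < 2 * r" for a
  proof -
    have *: "(if j = 0 then 1 else ?t j) = ?t j" for j by simp
    have nz': "(\<Prod>p<a. d p) \<noteq> 0" if "a < 2 * r" for a
      using symplectic_diag_nonzero[OF d] that by auto
    show ?thesis
    proof (cases "a < r")
      case True
      then show ?thesis
        unfolding prod_powi_basis_weight[OF a nz] * using nz'[OF a] by simp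
    next
      case False
      \<comment> \<open>The position opposite to a, so that d a is the inverse of d b and b falls in
        the unbarred half.\<close>
      define b where "b = 2 * r - a - 1"
      have b: "2 * r - a = Suc b" "b < 2 * r" "a = 2 * r - 1 - b" using a False by (auto simp: b_def)
      have "?t b / ?t (Suc b) = 1 / d b" using nz'[OF b(2)] by simp
      also have "\<dots> = d a"
        using d b(2,3) symplectic_diag_nonzero[OF d b(2)]
        unfolding symplectic_diag_def by (auto simp: field_simps)
      finally show ?thesis
        unfolding prod_powi_basis_weight[OF a nz] * b(1) b_def[symmetric] using False by simp
    qed
  qed
  then show "diag_elt r d = list_mult (Sp r) (map (\<lambda>j. coroot r j (?t j)) [1..<Suc r])"
    unfolding list_mult_coroot[OF nz] diag_elt_eq_iff by blast
qed

lemma subgroup_torus: "subgroup (torus r) (Sp r)"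
  unfolding torus_def by (intro Sp.generate_is_subgroup) (auto intro: coroot_in_Sp)

text \<open>That every diagonal symplectic matrix is a product of simple coroots is where simple
  connectedness enters; \<open>coroot_product_exists\<close> gives the coordinates
  explicitly.\<close>

lemma torus_eq: "torus r = {diag_elt r d | d. symplectic_diag r d}"
proof (intro equalityI subsetI)
  fix h assume "h \<in> torus r"
  then have "h \<in> generate (Sp r) {coroot r i t | i t. i \<in> {1..r} \<and> t \<noteq> 0}"
    by (simp add: torus_def)
  then show "h \<in> {diag_elt r d | d. symplectic_diag r d}"
  proof induction
    case one
    have "symplectic_diag r (\<lambda>_. 1)" by (simp add: symplectic_diag_def)
    then show ?case using diag_elt_one[of r] by (auto intro!: exI[of _ "\<lambda>_. 1"])
  next
    case (incl h)
    then show ?case using coroot_eq coroot_symplectic by blast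
  next
    case (inv h)
    then show ?case
      using diag_elt_inverse coroot_symplectic symplectic_diag_inverse unfolding coroot_eq by blast
  next
    case (eng h1 h2)
    then show ?case using symplectic_diag_mult by (auto simp: diag_elt_mult)
  qed
next
  fix h assume "h \<in> {diag_elt r d | d. symplectic_diag r d}"
  then obtain \<tau> where \<tau>: "\<forall>j\<in>{1..r}. \<tau> j \<noteq> 0"
      "h = list_mult (Sp r) (map (\<lambda>j. coroot r j (\<tau> j)) [1..<Suc r])"
    using coroot_product_exists by blast
  have "list_mult (Sp r) (map (\<lambda>j. coroot r j (\<tau> j)) js) \<in> torus r" if "set js \<subseteq> {1..r}" for js
    using that
  proof (induction js)
    case Nil
    then show ?case using subgroup.one_closed[OF subgroup_torus] by (simp add: list_mult_def)
  next
    case (Cons j js)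
    moreover have "coroot r j (\<tau> j) \<in> torus r"
      using Cons.prems \<tau>(1) unfolding torus_def by (intro generate.incl) force
    ultimately show ?case
      using subgroup.m_closed[OF subgroup_torus] by (auto simp: list_mult_def)
  qed
  from this[of "[1..<Suc r]"] show "h \<in> torus r"
    unfolding \<tau>(2) by (simp add: atLeastLessThanSuc_atLeastAtMost del: upt_Suc)
qed

text \<open>Any coordinates that express the diagonal matrix through coroots must be its partial
  products, since the basis weights telescope. So the value does not depend on the chosen
  coordinates and \<open>THE\<close> is well defined.\<close>

lemma torus_char_fund_weight:
  assumes d: "symplectic_diag r d" and i: "i \<in> {1..r}"
  shows "torus_char r (fund_weight i) (diag_elt r d) = (\<Prod>p<i. d p)"
  unfolding torus_char_def
proof (rule the_equality)
  have "c = (\<Prod>p<i. d p)" if \<tau>: "\<forall>j\<in>{1..r}. \<tau> j \<noteq> 0"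
      "diag_elt r d = list_mult (Sp r) (map (\<lambda>j. coroot r j (\<tau> j)) [1..<Suc r])"
      and c: "c = (\<Prod>j\<in>{1..r}. \<tau> j powi fund_weight i j)" for c \<tau>
  proof -
    have da: "d a = (\<Prod>j\<in>{1..r}. \<tau> j powi basis_weight r a j)" if "a < 2 * r" for a
      using \<tau>(2) that unfolding list_mult_coroot[OF \<tau>(1)] diag_elt_eq_iff by blast
    have "(\<Prod>p<j. d p) = (if j = 0 then 1 else \<tau> j)" if "j \<le> r" for j
      using that
    proof (induction j)
      case (Suc j)
      then show ?case using \<tau>(1) by (auto simp: da prod_powi_basis_weight[OF _ \<tau>(1)] simp del: One_nat_def) simp
    qed simp
    then show ?thesis using c \<tau>(1) i prod_powi_fund_weight[of i r \<tau>] by auto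
  qed
  then show "\<And>c. \<exists>\<tau>. (\<forall>j\<in>{1..r}. \<tau> j \<noteq> 0) \<and>
         diag_elt r d = list_mult (Sp r) (map (\<lambda>j. coroot r j (\<tau> j)) [1..<Suc r]) \<and>
         c = (\<Prod>j\<in>{1..r}. \<tau> j powi fund_weight i j) \<Longrightarrow> c = (\<Prod>p<i. d p)"
    by blast
  then show "\<exists>\<tau>. (\<forall>j\<in>{1..r}. \<tau> j \<noteq> 0) \<and>
         diag_elt r d = list_mult (Sp r) (map (\<lambda>j. coroot r j (\<tau> j)) [1..<Suc r]) \<and>
         (\<Prod>p<i. d p) = (\<Prod>j\<in>{1..r}. \<tau> j powi fund_weight i j)"
    using coroot_product_exists[OF d] by metis
qed

lemma coroot_int_pow:
  assumes "t \<noteq> 0"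
  shows "coroot r i t [^]\<^bsub>Sp r\<^esub> (k :: int) = coroot r i (t powi k)"
proof -
  have nat: "coroot r i t [^]\<^bsub>Sp r\<^esub> (n :: nat) = diag_elt r (\<lambda>a. (t powi basis_weight r a i) ^ n)" for n
    by (induction n) (simp_all add: coroot_eq diag_elt_one diag_elt_mult mult.commute)
  have pow: "(t powi w) ^ n = (t powi int n) powi w" for w n
    by (simp only: power_int_of_nat[symmetric] power_int_mult[symmetric] mult.commute[of w])
  show ?thesis
  proof (cases "k \<ge> 0")
    case True
    then obtain n where "k = int n" using nonneg_int_cases by auto
    then show ?thesis
      by (simp only: int_pow_int nat pow) (simp only: coroot_eq)
  next
    case False
    define n where "n = nat (- k)"
    have k: "k = - int n" using False by (simp add: n_def)
    have "symplectic_diag r (\<lambda>a. (t powi basis_weight r a i) ^ n)"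
      using coroot_symplectic[OF assms] by (simp add: symplectic_diag_def flip: power_mult_distrib)
    then have "coroot r i t [^]\<^bsub>Sp r\<^esub> k = diag_elt r (\<lambda>a. inverse ((t powi basis_weight r a i) ^ n))"
      unfolding k using coroot_in_Sp[OF assms] by (simp add: Sp.int_pow_neg_int nat diag_elt_inverse)
    moreover have "inverse ((t powi w) ^ n) = (t powi (- int n)) powi w" for w
    proof -
      have "inverse ((t powi w) ^ n) = (t powi w) powi (- int n)"
        by (simp add: power_int_minus)
      also have "\<dots> = (t powi (- int n)) powi w"
        by (simp only: power_int_mult[symmetric] mult.commute[of w])
      finally show ?thesis .
    qed
    ultimately show ?thesis by (simp add: coroot_eq k)
  qed
qed

lemma torus_elt_eq:
  assumes "t \<noteq> 0"
  shows "torus_elt r t a = diag_elt r (\<lambda>p. \<Prod>j\<in>{1..r}. (t powi a j) powi basis_weight r p j)"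
  using list_mult_coroot[of r "\<lambda>j. t powi a j"] assms
  by (simp add: torus_elt_def coroot_int_pow del: upt_Suc)

lemma torus_elt_in_torus:
  assumes "t \<noteq> 0"
  shows "torus_elt r t a \<in> torus r"
proof -
  have "symplectic_diag r (\<lambda>p. \<Prod>j\<in>{1..r}. (t powi a j) powi basis_weight r p j)"
    unfolding symplectic_diag_def
    using coroot_symplectic[of "t powi a j" r j for j] assms
    by (auto simp: symplectic_diag_def simp flip: prod.distrib intro!: prod.neutral)
  then show ?thesis using assms by (auto simp: torus_elt_eq torus_eq)
qed

section \<open>Polynomial functions and polynomial curves\<close>

text \<open>Images of the affine line. A polynomial function pulls back to a one-variable
  polynomial, which has finitely many roots unless it is zero; connectedness and density both rest
  on this.\<close>

definition poly_path :: "nat \<Rightarrow> (complex \<Rightarrow> complex mat) \<Rightarrow> bool" where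
  "poly_path n \<phi> \<longleftrightarrow> (\<forall>i<n. \<forall>j<n. \<exists>P. \<forall>s. \<phi> s $$ (i, j) = poly P s)"

lemma poly_pathD: "poly_path n \<phi> \<Longrightarrow> i < n \<Longrightarrow> j < n \<Longrightarrow> \<exists>P. \<forall>s. \<phi> s $$ (i, j) = poly P s"
  by (simp add: poly_path_def)

lemma poly_sum_exists:
  assumes "finite K" "\<And>k. k \<in> K \<Longrightarrow> \<exists>P. \<forall>s. f k s = poly P s"
  shows "\<exists>P. \<forall>s. (\<Sum>k\<in>K. f k s) = poly P s"
  using assms
proof (induction K rule: finite_induct)
  case empty
  then show ?case by (auto intro!: exI[of _ 0])
next
  case (insert k K)
  then obtain P Q where "\<forall>s. f k s = poly P s" "\<forall>s. (\<Sum>k\<in>K. f k s) = poly Q s"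
    by blast
  then show ?case using insert.hyps by (auto intro!: exI[of _ "P + Q"])
qed

lemma poly_path_mult:
  assumes "poly_path n \<phi>" "poly_path n \<psi>" "\<And>s. \<phi> s \<in> carrier_mat n n" "\<And>s. \<psi> s \<in> carrier_mat n n"
  shows "poly_path n (\<lambda>s. \<phi> s * \<psi> s)"
  unfolding poly_path_def
proof (intro allI impI)
  fix i j assume ij: "i < n" "j < n"
  have "\<exists>P. \<forall>s. \<phi> s $$ (i, k) * \<psi> s $$ (k, j) = poly P s" if k: "k \<in> {..<n}" for k
  proof -
    obtain P Q where "\<forall>s. \<phi> s $$ (i, k) = poly P s" "\<forall>s. \<psi> s $$ (k, j) = poly Q s"
      using poly_pathD[OF assms(1), of i k] poly_pathD[OF assms(2), of k j] ij k by auto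
    then show ?thesis by (auto intro!: exI[of _ "P * Q"])
  qed
  then have "\<exists>P. \<forall>s. (\<Sum>k<n. \<phi> s $$ (i, k) * \<psi> s $$ (k, j)) = poly P s"
    by (intro poly_sum_exists) auto
  then show "\<exists>P. \<forall>s. (\<phi> s * \<psi> s) $$ (i, j) = poly P s"
    by (simp add: mat_mult_index[OF assms(3,4) ij] del: index_mult_mat(1))
qed

lemma poly_path_compose:
  assumes "poly_path n \<phi>"
  shows "poly_path n (\<lambda>s. \<phi> (poly Q s))"
  unfolding poly_path_def
proof (intro allI impI)
  fix i j assume "i < n" "j < n"
  then obtain P where "\<forall>s. \<phi> s $$ (i, j) = poly P s"
    using poly_pathD[OF assms] by blast
  then show "\<exists>P. \<forall>s. \<phi> (poly Q s) $$ (i, j) = poly P s"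
    by (auto intro!: exI[of _ "pcompose P Q"] simp: poly_pcompose)
qed

lemma poly_path_const: "poly_path n (\<lambda>_. A)"
  unfolding poly_path_def by (auto intro!: exI[of _ "[:_:]"])

lemma poly_fun_path:
  assumes "p \<in> poly_fun n" "poly_path n \<phi>"
  shows "\<exists>P. \<forall>s. p (\<phi> s) = poly P s"
  using assms(1)
proof induction
  case (const c)
  then show ?case by (auto intro!: exI[of _ "[:c:]"])
next
  case (entry i j)
  then show ?case using assms(2) by (simp add: poly_path_def)
next
  case (add p q)
  then obtain P Q where "\<forall>s. p (\<phi> s) = poly P s" "\<forall>s. q (\<phi> s) = poly Q s" by blast
  then show ?case by (auto intro!: exI[of _ "P + Q"])
next
  case (mult p q)
  then obtain P Q where "\<forall>s. p (\<phi> s) = poly P s" "\<forall>s. q (\<phi> s) = poly Q s" by blast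
  then show ?case by (auto intro!: exI[of _ "P * Q"])
qed

text \<open>Products of polynomials turn finite intersections of non-vanishing sets into
  non-vanishing sets, so the generating family is a base of the topology.\<close>

lemma openin_zariski_basic:
  assumes "openin (zariski n) E" "A \<in> E"
  shows "\<exists>p\<in>poly_fun n. p A \<noteq> 0 \<and> {B \<in> carrier_mat n n. p B \<noteq> 0} \<subseteq> E"
proof -
  have "generate_topology_on {{A \<in> carrier_mat n n. p A \<noteq> 0} | p. p \<in> poly_fun n} E"
    using assms(1) unfolding zariski_def by (simp add: openin_topology_generated_by_iff)
  then show ?thesis using assms(2)
  proof (induction arbitrary: A)
    case Empty
    then show ?case by simp
  next
    case (Int a b)
    then obtain p q where "p \<in> poly_fun n" "p A \<noteq> 0" "{B \<in> carrier_mat n n. p B \<noteq> 0} \<subseteq> a"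
       "q \<in> poly_fun n" "q A \<noteq> 0" "{B \<in> carrier_mat n n. q B \<noteq> 0} \<subseteq> b" by blast
    then show ?case by (intro bexI[of _ "\<lambda>A. p A * q A"]) (auto intro: poly_fun.mult)
  next
    case (UN K)
    then show ?case by blast
  next
    case (Basis s)
    then show ?case by blast
  qed
qed

lemma openin_zariski_nonzero: "p \<in> poly_fun n \<Longrightarrow> openin (zariski n) {A \<in> carrier_mat n n. p A \<noteq> 0}"
  unfolding zariski_def by (rule topology_generated_by_Basis) (rule CollectI, rule exI[of _ p], simp)

lemma topspace_zariski [simp]: "topspace (zariski n) = carrier_mat n n"
proof
  show "topspace (zariski n) \<subseteq> carrier_mat n n"
    unfolding zariski_def topology_generated_by_topspace by (rule Union_least) auto
  have "openin (zariski n) {A \<in> carrier_mat n n. (1 :: complex) \<noteq> 0}"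
    by (rule openin_zariski_nonzero[OF poly_fun.const])
  then show "carrier_mat n n \<subseteq> topspace (zariski n)"
    by (intro openin_subset) simp
qed

text \<open>Two open sets separating A from B would yield nonzero one-variable polynomials along a
  curve joining them. Their product has finitely many roots, so some point of the curve lies in both
  open sets.\<close>

lemma connectedin_zariskiI:
  assumes "S \<subseteq> carrier_mat n n"
    and path: "\<And>A B. A \<in> S \<Longrightarrow> B \<in> S \<Longrightarrow> \<exists>\<phi>. poly_path n \<phi> \<and> range \<phi> \<subseteq> S \<and> \<phi> 0 = A \<and> \<phi> 1 = B"
  shows "connectedin (zariski n) S"
  unfolding connectedin
proof (intro conjI notI)
  show "S \<subseteq> topspace (zariski n)" using assms(1) by simp
  assume "\<exists>E1 E2. openin (zariski n) E1 \<and> openin (zariski n) E2 \<and> S \<subseteq> E1 \<union> E2 \<and>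
      E1 \<inter> E2 \<inter> S = {} \<and> E1 \<inter> S \<noteq> {} \<and> E2 \<inter> S \<noteq> {}"
  then obtain E1 E2 A B where E: "openin (zariski n) E1" "openin (zariski n) E2" "E1 \<inter> E2 \<inter> S = {}"
    and AB: "A \<in> E1" "A \<in> S" "B \<in> E2" "B \<in> S" by blast
  obtain \<phi> where \<phi>: "poly_path n \<phi>" "range \<phi> \<subseteq> S" "\<phi> 0 = A" "\<phi> 1 = B"
    using path AB by blast
  obtain p where p: "p \<in> poly_fun n" "p A \<noteq> 0" "{B \<in> carrier_mat n n. p B \<noteq> 0} \<subseteq> E1"
    using openin_zariski_basic[OF E(1) AB(1)] by (elim bexE conjE)
  obtain q where q: "q \<in> poly_fun n" "q B \<noteq> 0" "{B \<in> carrier_mat n n. q B \<noteq> 0} \<subseteq> E2"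
    using openin_zariski_basic[OF E(2) AB(3)] by (elim bexE conjE)
  obtain P where P: "\<forall>s. p (\<phi> s) = poly P s"
    using poly_fun_path[OF p(1) \<phi>(1)] by (elim exE)
  obtain Q where Q: "\<forall>s. q (\<phi> s) = poly Q s"
    using poly_fun_path[OF q(1) \<phi>(1)] by (elim exE)
  note PQ = P Q
  have "P \<noteq> 0" "Q \<noteq> 0" using PQ \<phi>(3,4) p(2) q(2) by auto
  then have "finite {s. poly (P * Q) s = 0}" by (intro poly_roots_finite) simp
  then obtain s where "poly (P * Q) s \<noteq> 0"
    by (metis (mono_tags, lifting) UNIV_eq_I infinite_UNIV_char_0 mem_Collect_eq)
  then have "p (\<phi> s) \<noteq> 0" "q (\<phi> s) \<noteq> 0" using PQ by auto
  moreover have "\<phi> s \<in> S" using \<phi>(2) by blast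
  ultimately show False using p(3) q(3) E(3) assms(1) by blast
qed

section \<open>Triangular matrices\<close>

text \<open>The flag \<open>b\<close> selects upper (true) or lower (false) triangular matrices.\<close>

definition tri :: "bool \<Rightarrow> nat \<Rightarrow> complex mat \<Rightarrow> bool" where
  "tri b n A \<longleftrightarrow> (\<forall>p<n. \<forall>q<n. (if b then q < p else p < q) \<longrightarrow> A $$ (p, q) = 0)"

lemma tri_mult:
  assumes "A \<in> carrier_mat n n" "B \<in> carrier_mat n n" "tri b n A" "tri b n B"
  shows "tri b n (A * B)"
  unfolding tri_def
proof (intro allI impI)
  fix p q assume pq: "p < n" "q < n" "if b then q < p else p < q"
  have "A $$ (p, k) * B $$ (k, q) = 0" if "k < n" for k
  proof -
    have "A $$ (p, k) = 0 \<or> B $$ (k, q) = 0"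
      using assms(3,4) pq that unfolding tri_def by (metis leI le_less_trans)
    then show ?thesis by auto
  qed
  then show "(A * B) $$ (p, q) = 0"
    using assms pq by (simp add: mat_mult_index sum.neutral del: index_mult_mat(1) mult_eq_0_iff)
qed

lemma tri_mult_diag:
  assumes "A \<in> carrier_mat n n" "B \<in> carrier_mat n n" "tri b n A" "tri b n B" "p < n"
  shows "(A * B) $$ (p, p) = A $$ (p, p) * B $$ (p, p)"
proof -
  have "A $$ (p, k) * B $$ (k, p) = 0" if "k < n" "k \<noteq> p" for k
  proof -
    have "A $$ (p, k) = 0 \<or> B $$ (k, p) = 0"
      using assms(3-5) that unfolding tri_def by (metis linorder_neqE_nat)
    then show ?thesis by auto
  qed
  then have "(\<Sum>k<n. A $$ (p, k) * B $$ (k, p)) = (\<Sum>k<n. if k = p then A $$ (p, p) * B $$ (p, p) else 0)"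
    by (intro sum.cong) auto
  then show ?thesis
    using assms by (simp add: mat_mult_index del: index_mult_mat(1))
qed

lemma tri_pow:
  assumes "A \<in> carrier_mat n n" "tri b n A"
  shows "tri b n (A ^\<^sub>m k) \<and> (\<forall>p<n. (A ^\<^sub>m k) $$ (p, p) = A $$ (p, p) ^ k)"
proof (induction k)
  case 0
  then show ?case using assms by (auto simp: tri_def)
next
  case (Suc k)
  then show ?case
    using assms tri_mult_diag[OF pow_carrier_mat[OF assms(1), of k] assms(1) _ assms(2)]
    by (auto simp: tri_mult[of _ n] pow_carrier_mat mult.commute simp del: index_mult_mat(1))
qed

lemma strictly_tri_nilpotent:
  assumes A: "A \<in> carrier_mat n n" and tri: "tri b n A" and diag: "\<forall>p<n. A $$ (p, p) = 0"
  shows "A ^\<^sub>m n = 0\<^sub>m n n"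
proof -
  \<comment> \<open>Each multiplication pushes the nonzero entries one diagonal further away from
    the main one; after n steps no diagonal is left.\<close>
  have "(if b then q < p + k else p < q + k) \<longrightarrow> (A ^\<^sub>m k) $$ (p, q) = 0" if "p < n" "q < n" for p q k
    using that
  proof (induction k arbitrary: p q)
    case 0
    then show ?case using A by auto
  next
    case (Suc k)
    show ?case
    proof
      assume *: "if b then q < p + Suc k else p < q + Suc k"
      have "(A ^\<^sub>m k) $$ (p, l) * A $$ (l, q) = 0" if l: "l < n" for l
      proof -
        have "(A ^\<^sub>m k) $$ (p, l) = 0 \<or> A $$ (l, q) = 0"
        proof (cases "if b then l < p + k else p < l + k")
          case True
          then show ?thesis using Suc l by blast
        next
          case False
          then have "l = q \<or> (if b then q < l else l < q)"
            using * by (auto split: if_splits)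
          then show ?thesis using tri diag Suc.prems l unfolding tri_def by blast
        qed
        then show ?thesis by auto
      qed
      then show "(A ^\<^sub>m Suc k) $$ (p, q) = 0"
        using mat_mult_index[OF pow_carrier_mat[OF A, of k] A Suc.prems]
        by (simp add: sum.neutral del: index_mult_mat(1) mult_eq_0_iff)
    qed
  qed
  then show ?thesis
    using A by (intro eq_matI) auto
qed

lemma tri_unipotent_iff:
  assumes "A \<in> carrier_mat n n" "tri b n A"
  shows "unipotent_mat n A \<longleftrightarrow> (\<forall>p<n. A $$ (p, p) = 1)"
proof
  have c: "A - 1\<^sub>m n \<in> carrier_mat n n" using assms(1) by auto
  have t: "tri b n (A - 1\<^sub>m n)" using assms by (auto simp: tri_def)
  show "\<forall>p<n. A $$ (p, p) = 1" if unip: "unipotent_mat n A"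
  proof (intro allI impI)
    fix p assume p: "p < n"
    obtain k where "(A - 1\<^sub>m n) ^\<^sub>m k = 0\<^sub>m n n" using unip unfolding unipotent_mat_def by blast
    then have "(A - 1\<^sub>m n) $$ (p, p) ^ k = 0"
      using tri_pow[OF c t, of k] p by simp
    then show "A $$ (p, p) = 1" using p assms(1) by simp
  qed
  show "unipotent_mat n A" if "\<forall>p<n. A $$ (p, p) = 1"
    unfolding unipotent_mat_def
    using strictly_tri_nilpotent[OF c t] that assms(1) by (intro exI[of _ n]) auto
qed

section \<open>Borel subgroups\<close>

text \<open>The flag treats the two opposite Borel subgroups at once, in the same convention as
  \<open>tri\<close>.\<close>

definition root_sub :: "nat \<Rightarrow> bool \<Rightarrow> nat \<Rightarrow> complex \<Rightarrow> complex mat" where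
  "root_sub r b i t = (if b then x_sub r i t else y_sub r i t)"

definition borel :: "nat \<Rightarrow> bool \<Rightarrow> complex mat set" where
  "borel r b = generate (Sp r) (torus r \<union> {root_sub r b i t | i t. i \<in> {1..r}})"

lemma borel_pos_eq: "borel_pos r = borel r True" and borel_neg_eq: "borel_neg r = borel r False"
  by (simp_all add: borel_def root_sub_def borel_pos_def borel_neg_def)

lemma root_sub_in_Sp: "i \<in> {1..r} \<Longrightarrow> root_sub r b i t \<in> carrier (Sp r)"
  by (simp add: root_sub_def x_sub_in_Sp y_sub_in_Sp)

lemma root_sub_add: "i \<in> {1..r} \<Longrightarrow> root_sub r b i s * root_sub r b i t = root_sub r b i (s + t)"
  by (simp add: root_sub_def x_sub_add y_sub_add)

lemma root_sub_0: "i \<in> {1..r} \<Longrightarrow> root_sub r b i 0 = 1\<^sub>m (2 * r)"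
  by (simp add: root_sub_def x_sub_0 y_sub_0)

lemma root_sub_inverse:
  assumes "i \<in> {1..r}"
  shows "inv\<^bsub>Sp r\<^esub> root_sub r b i t = root_sub r b i (- t)"
  by (rule Sp.inv_equality) (use assms in \<open>auto simp: root_sub_add root_sub_0 root_sub_in_Sp\<close>)

lemma torus_subset_Sp: "torus r \<subseteq> carrier (Sp r)"
  using subgroup.subset[OF subgroup_torus] .

lemma subgroup_borel: "subgroup (borel r b) (Sp r)"
  unfolding borel_def using torus_subset_Sp
  by (intro Sp.generate_is_subgroup) (auto simp: root_sub_in_Sp)

lemma borel_in_Sp: "A \<in> borel r b \<Longrightarrow> A \<in> carrier (Sp r)"
  using subgroup.subset[OF subgroup_borel] by blast

lemma borel_mult: "A \<in> borel r b \<Longrightarrow> B \<in> borel r b \<Longrightarrow> A * B \<in> borel r b"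
  using subgroup.m_closed[OF subgroup_borel] by fastforce

lemma torus_subset_borel: "torus r \<subseteq> borel r b"
  unfolding borel_def by (auto intro: generate.incl)

lemma root_sub_in_borel: "i \<in> {1..r} \<Longrightarrow> root_sub r b i t \<in> borel r b"
  unfolding borel_def by (intro generate.incl) blast

text \<open>Inverses of generators need no case of their own: the torus and each root subgroup are
  closed under inversion.\<close>

lemma borel_induct [consumes 1, case_names torus root mult]:
  assumes "A \<in> borel r b"
    and "\<And>h. h \<in> torus r \<Longrightarrow> P h"
    and "\<And>i t. i \<in> {1..r} \<Longrightarrow> P (root_sub r b i t)"
    and "\<And>A B. A \<in> borel r b \<Longrightarrow> P A \<Longrightarrow> B \<in> borel r b \<Longrightarrow> P B \<Longrightarrow> P (A * B)"
  shows "P A"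
  using assms(1) unfolding borel_def
proof induction
  case one
  then show ?case using assms(2) subgroup.one_closed[OF subgroup_torus] by blast
next
  case (incl h)
  then show ?case using assms(2,3) by blast
next
  case (inv h)
  then show ?case using assms(2,3) subgroup.m_inv_closed[OF subgroup_torus] root_sub_inverse by auto
next
  case (eng h1 h2)
  then show ?case using assms(4) unfolding borel_def by simp
qed

lemma root_sub_tri: "i \<in> {1..r} \<Longrightarrow> tri b (2 * r) (root_sub r b i t)"
  and root_sub_diag: "i \<in> {1..r} \<Longrightarrow> p < 2 * r \<Longrightarrow> root_sub r b i t $$ (p, p) = 1"
  by (auto simp: tri_def root_sub_def x_sub_index y_sub_index)

lemma borel_tri: "A \<in> borel r b \<Longrightarrow> tri b (2 * r) A"
proof (induction rule: borel_induct)
  case (torus h)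
  then show ?case by (auto simp: torus_eq tri_def)
next
  case (root i t)
  then show ?case by (rule root_sub_tri)
next
  case (mult A B)
  then show ?case by (auto intro!: tri_mult Sp_carrier_mat borel_in_Sp)
qed

lemma borel_mult_diag:
  "A \<in> borel r b \<Longrightarrow> B \<in> borel r b \<Longrightarrow> p < 2 * r \<Longrightarrow> (A * B) $$ (p, p) = A $$ (p, p) * B $$ (p, p)"
  by (intro tri_mult_diag[where b = b]) (auto intro!: borel_tri Sp_carrier_mat borel_in_Sp)

text \<open>On triangular matrices taking the diagonal is multiplicative. This is the projection of
  a Borel subgroup onto its torus.\<close>

lemma borel_diag: "A \<in> borel r b \<Longrightarrow> diag_elt r (\<lambda>p. A $$ (p, p)) \<in> torus r"
proof -
  assume "A \<in> borel r b"
  then have "symplectic_diag r (\<lambda>p. A $$ (p, p))"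
  proof (induction rule: borel_induct)
    case (torus h)
    then show ?case by (auto simp: torus_eq symplectic_diag_def)
  next
    case (root i t)
    then show ?case by (auto simp: symplectic_diag_def root_sub_diag)
  next
    case (mult A B)
    have "symplectic_diag r (\<lambda>p. A $$ (p, p) * B $$ (p, p))"
      using mult by (intro symplectic_diag_mult) auto
    then show ?case using mult.hyps by (simp add: symplectic_diag_def borel_mult_diag del: index_mult_mat(1))
  qed
  then show ?thesis unfolding torus_eq by blast
qed

lemma root_sub_path:
  assumes "i \<in> {1..r}"
  shows "poly_path (2 * r) (\<lambda>s. root_sub r b i (s * t))"
  unfolding poly_path_def
proof (intro allI impI)
  fix p q assume "p < 2 * r" "q < 2 * r"
  then have "root_sub r b i (s * t) $$ (p, q) = 1\<^sub>m (2 * r) $$ (p, q) + s * (root_sub r b i t $$ (p, q) - 1\<^sub>m (2 * r) $$ (p, q))" for s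
    using assms by (auto simp: root_sub_def x_sub_index y_sub_index)
  then show "\<exists>P. \<forall>s. root_sub r b i (s * t) $$ (p, q) = poly P s"
    by (intro exI[of _ "[:1\<^sub>m (2 * r) $$ (p, q), root_sub r b i t $$ (p, q) - 1\<^sub>m (2 * r) $$ (p, q):]"]) auto
qed

text \<open>Scaling the parameters of all root factors by s contracts A onto its torus part at s = 0
  while the diagonal stays constant, so the curve of a unit-diagonal A remains in the unit-diagonal
  subgroup.\<close>

lemma borel_path:
  assumes "A \<in> borel r b"
  shows "\<exists>\<phi>. poly_path (2 * r) \<phi> \<and> range \<phi> \<subseteq> borel r b \<and> (\<forall>s. \<forall>p<2*r. \<phi> s $$ (p, p) = A $$ (p, p)) \<and>
     \<phi> 0 = diag_elt r (\<lambda>p. A $$ (p, p)) \<and> \<phi> 1 = A"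
  using assms
proof (induction rule: borel_induct)
  case (torus h)
  then obtain d where "h = diag_elt r d" by (auto simp: torus_eq)
  moreover have "diag_elt r (\<lambda>p. diag_elt r d $$ (p, p)) = diag_elt r d"
    by (intro eq_matI) auto
  ultimately show ?case
    using torus torus_subset_borel by (intro exI[of _ "\<lambda>_. h"]) (auto intro: poly_path_const)
next
  case (root i t)
  have "diag_elt r (\<lambda>p. root_sub r b i t $$ (p, p)) = 1\<^sub>m (2 * r)"
    unfolding diag_elt_one[symmetric] diag_elt_eq_iff using root by (simp add: root_sub_diag)
  then show ?case
    using root root_sub_path[OF root, of b t]
    by (intro exI[of _ "\<lambda>s. root_sub r b i (s * t)"]) (auto simp: root_sub_in_borel root_sub_diag root_sub_0)
next
  case (mult A B)
  from mult.IH(1) obtain \<phi> where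
    \<phi>: "poly_path (2 * r) \<phi>" "range \<phi> \<subseteq> borel r b" "\<forall>s. \<forall>p<2*r. \<phi> s $$ (p, p) = A $$ (p, p)"
       "\<phi> 0 = diag_elt r (\<lambda>p. A $$ (p, p))" "\<phi> 1 = A" by (elim exE conjE)
  from mult.IH(2) obtain \<psi> where
    \<psi>: "poly_path (2 * r) \<psi>" "range \<psi> \<subseteq> borel r b" "\<forall>s. \<forall>p<2*r. \<psi> s $$ (p, p) = B $$ (p, p)"
       "\<psi> 0 = diag_elt r (\<lambda>p. B $$ (p, p))" "\<psi> 1 = B" by (elim exE conjE)
  have in_borel: "\<phi> s \<in> borel r b" "\<psi> s \<in> borel r b" for s using \<phi>(2) \<psi>(2) by auto
  have "diag_elt r (\<lambda>p. A $$ (p, p)) * diag_elt r (\<lambda>p. B $$ (p, p)) = diag_elt r (\<lambda>p. (A * B) $$ (p, p))"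
    unfolding diag_elt_mult diag_elt_eq_iff using mult.hyps by (simp add: borel_mult_diag del: index_mult_mat(1))
  moreover have "poly_path (2 * r) (\<lambda>s. \<phi> s * \<psi> s)"
    using in_borel by (intro poly_path_mult[OF \<phi>(1) \<psi>(1)] Sp_carrier_mat borel_in_Sp)
  moreover have "range (\<lambda>s. \<phi> s * \<psi> s) \<subseteq> borel r b"
    using in_borel by (intro image_subsetI borel_mult)
  moreover have "(\<phi> s * \<psi> s) $$ (p, p) = (A * B) $$ (p, p)" if p: "p < 2 * r" for s p
    unfolding borel_mult_diag[OF in_borel p] borel_mult_diag[OF mult.hyps p]
    using \<phi>(3) \<psi>(3) p by simp
  ultimately show ?case
    by (intro exI[of _ "\<lambda>s. \<phi> s * \<psi> s"]) (simp add: \<phi>(4,5) \<psi>(4,5) del: index_mult_mat(1))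
qed

section \<open>Unipotent radicals\<close>

text \<open>The kernel of the projection to the torus, and the candidate for the unipotent
  radical.\<close>

definition unip :: "nat \<Rightarrow> bool \<Rightarrow> complex mat set" where
  "unip r b = {A \<in> borel r b. \<forall>p<2*r. A $$ (p, p) = 1}"

lemma borel_inv: "A \<in> borel r b \<Longrightarrow> inv\<^bsub>Sp r\<^esub> A \<in> borel r b"
  using subgroup.m_inv_closed[OF subgroup_borel] .

lemma borel_inv_diag:
  assumes "A \<in> borel r b" "p < 2 * r"
  shows "A $$ (p, p) * (inv\<^bsub>Sp r\<^esub> A) $$ (p, p) = 1"
  using borel_mult_diag[OF assms(1) borel_inv[OF assms(1)] assms(2)]
    Sp_inv_mult(2)[OF borel_in_Sp[OF assms(1)]] assms(2) by simp

text \<open>Both orders occur: a lower factor is split with its torus part on the right and an upper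
  factor with it on the left, so that the two torus parts meet in the middle of a Gauss
  decomposition.\<close>

lemma unip_decompose:
  assumes "A \<in> borel r b"
  shows "\<exists>u\<in>unip r b. A = u * diag_elt r (\<lambda>p. A $$ (p, p))"
    and "\<exists>u\<in>unip r b. A = diag_elt r (\<lambda>p. A $$ (p, p)) * u"
proof -
  define h where "h = diag_elt r (\<lambda>p. A $$ (p, p))"
  have h: "h \<in> borel r b" using borel_diag[OF assms] torus_subset_borel by (auto simp: h_def)
  note c = assms[THEN borel_in_Sp] h[THEN borel_in_Sp] h[THEN borel_inv, THEN borel_in_Sp]
  have hd: "h $$ (p, p) = A $$ (p, p)" if "p < 2 * r" for p using that by (simp add: h_def)
  have "A * inv\<^bsub>Sp r\<^esub> h \<in> unip r b" "inv\<^bsub>Sp r\<^esub> h * A \<in> unip r b"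
    using borel_inv_diag[OF h] borel_mult_diag[OF assms borel_inv[OF h]] borel_mult_diag[OF borel_inv[OF h] assms]
      borel_mult[OF assms borel_inv[OF h]] borel_mult[OF borel_inv[OF h] assms]
    by (auto simp: unip_def hd mult.commute simp del: index_mult_mat(1))
  moreover have "A = A * inv\<^bsub>Sp r\<^esub> h * h" "A = h * (inv\<^bsub>Sp r\<^esub> h * A)"
    using c Sp_carrier_mat[OF c(1)] by (simp_all add: Sp_assoc Sp_inv_mult flip: Sp_assoc[OF c(2,3,1)])
  ultimately show "\<exists>u\<in>unip r b. A = u * diag_elt r (\<lambda>p. A $$ (p, p))"
    "\<exists>u\<in>unip r b. A = diag_elt r (\<lambda>p. A $$ (p, p)) * u"
    unfolding h_def by blast+
qed

lemma one_in_unip: "1\<^sub>m (2 * r) \<in> unip r b"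
  using subgroup.one_closed[OF subgroup_borel] by (auto simp: unip_def)

lemma unip_mult: "A \<in> unip r b \<Longrightarrow> B \<in> unip r b \<Longrightarrow> A * B \<in> unip r b"
  by (auto simp: unip_def borel_mult borel_mult_diag simp del: index_mult_mat(1))

lemma unip_inv: "A \<in> unip r b \<Longrightarrow> inv\<^bsub>Sp r\<^esub> A \<in> unip r b"
  using borel_inv_diag[of A r b] by (auto simp: unip_def borel_inv)

lemma unip_normal: "unip r b \<lhd> (Sp r)\<lparr>carrier := borel r b\<rparr>"
proof -
  interpret B: group "(Sp r)\<lparr>carrier := borel r b\<rparr>"
    using subgroup.subgroup_is_group[OF subgroup_borel group_Sp] .
  have inv: "inv\<^bsub>(Sp r)\<lparr>carrier := borel r b\<rparr>\<^esub> x = inv\<^bsub>Sp r\<^esub> x" if "x \<in> borel r b" for x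
    using Sp.m_inv_consistent[OF subgroup_borel that] .
  have "subgroup (unip r b) ((Sp r)\<lparr>carrier := borel r b\<rparr>)"
  proof
    show "unip r b \<subseteq> carrier ((Sp r)\<lparr>carrier := borel r b\<rparr>)" by (auto simp: unip_def)
    show "\<one>\<^bsub>(Sp r)\<lparr>carrier := borel r b\<rparr>\<^esub> \<in> unip r b" by (simp add: one_in_unip)
    show "x \<otimes>\<^bsub>(Sp r)\<lparr>carrier := borel r b\<rparr>\<^esub> y \<in> unip r b" if "x \<in> unip r b" "y \<in> unip r b" for x y
      using that by (simp add: unip_mult)
    show "inv\<^bsub>(Sp r)\<lparr>carrier := borel r b\<rparr>\<^esub> x \<in> unip r b" if "x \<in> unip r b" for x
    proof -
      have "x \<in> borel r b" using that by (simp add: unip_def)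
      then show ?thesis using inv unip_inv[OF that] by simp
    qed
  qed
  moreover have "x * u * inv\<^bsub>Sp r\<^esub> x \<in> unip r b" if x: "x \<in> borel r b" and u: "u \<in> unip r b" for x u
  proof -
    have u': "u \<in> borel r b" "\<forall>p<2*r. u $$ (p, p) = 1" using u by (auto simp: unip_def)
    have "(x * u * inv\<^bsub>Sp r\<^esub> x) $$ (p, p) = 1" if "p < 2 * r" for p
      using that borel_mult_diag[OF borel_mult[OF x u'(1)] borel_inv[OF x] that] borel_mult_diag[OF x u'(1) that]
        borel_inv_diag[OF x that] u'(2) by (simp del: index_mult_mat(1))
    then show ?thesis using x u' by (auto simp: unip_def intro!: borel_mult borel_inv)
  qed
  ultimately show ?thesis
    by (subst B.normal_inv_iff) (auto simp: inv)
qed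

lemma unip_closed: "closedin (subtopology (zariski (2 * r)) (borel r b)) (unip r b)"
proof -
  let ?n = "2 * r" and ?T = "{A \<in> carrier_mat (2 * r) (2 * r). \<forall>p<2*r. A $$ (p, p) = 1}"
  have "openin (zariski ?n) {A \<in> carrier_mat ?n ?n. A $$ (p, p) + (- 1) \<noteq> 0}" if "p < ?n" for p
    using that by (intro openin_zariski_nonzero poly_fun.intros) auto
  then have "openin (zariski ?n) (\<Union>p\<in>{..<?n}. {A \<in> carrier_mat ?n ?n. A $$ (p, p) + (- 1) \<noteq> 0})"
    by auto
  also have "(\<Union>p\<in>{..<?n}. {A \<in> carrier_mat ?n ?n. A $$ (p, p) + (- 1) \<noteq> 0}) = topspace (zariski ?n) - ?T"
    by auto
  finally have "closedin (zariski ?n) ?T" unfolding closedin_def by auto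
  moreover have "unip r b = ?T \<inter> borel r b"
    by (auto simp: unip_def dest: Sp_carrier_mat[OF borel_in_Sp])
  ultimately show ?thesis unfolding closedin_subtopology by blast
qed

lemma unip_connected: "connectedin (zariski (2 * r)) (unip r b)"
proof (rule connectedin_zariskiI)
  show "unip r b \<subseteq> carrier_mat (2 * r) (2 * r)"
    by (auto simp: unip_def dest: Sp_carrier_mat[OF borel_in_Sp])
  have path: "\<exists>\<phi>. poly_path (2 * r) \<phi> \<and> range \<phi> \<subseteq> unip r b \<and> \<phi> 0 = 1\<^sub>m (2 * r) \<and> \<phi> 1 = A"
    if "A \<in> unip r b" for A
  proof -
    have A: "A \<in> borel r b" "\<forall>p<2*r. A $$ (p, p) = 1" using that by (auto simp: unip_def)
    have "diag_elt r (\<lambda>p. A $$ (p, p)) = 1\<^sub>m (2 * r)"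
      unfolding diag_elt_one[symmetric] diag_elt_eq_iff using A(2) by simp
    then show ?thesis
      using borel_path[OF A(1)] A(2) by (auto simp: unip_def image_subset_iff)
  qed
  fix A B assume AB: "A \<in> unip r b" "B \<in> unip r b"
  obtain \<phi> where
    \<phi>: "poly_path (2 * r) \<phi>" "range \<phi> \<subseteq> unip r b" "\<phi> 0 = 1\<^sub>m (2 * r)" "\<phi> 1 = A"
    using path[OF AB(1)] by (elim exE conjE)
  obtain \<psi> where
    \<psi>: "poly_path (2 * r) \<psi>" "range \<psi> \<subseteq> unip r b" "\<psi> 0 = 1\<^sub>m (2 * r)" "\<psi> 1 = B"
    using path[OF AB(2)] by (elim exE conjE)
  have in_unip: "\<phi> s \<in> unip r b" "\<psi> s \<in> unip r b" for s using \<phi>(2) \<psi>(2) by auto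
  have c: "X \<in> carrier_mat (2 * r) (2 * r)" if "X \<in> unip r b" for X
    using that by (auto simp: unip_def dest: Sp_carrier_mat[OF borel_in_Sp])
  \<comment> \<open>Curves cannot be concatenated within polynomials. Multiplying the reversed curve
    from A to 1 by the curve from 1 to B gives a single polynomial curve from A to B.\<close>
  have "poly_path (2 * r) (\<lambda>s. \<phi> (1 - s))"
    using poly_path_compose[OF \<phi>(1), of "[:1, - 1:]"] by simp
  then have "poly_path (2 * r) (\<lambda>s. \<phi> (1 - s) * \<psi> s)"
    using \<psi>(1) in_unip c by (intro poly_path_mult) auto
  moreover have "\<phi> (1 - 0) * \<psi> 0 = A" "\<phi> (1 - 1) * \<psi> 1 = B"
    using \<phi> \<psi> c[OF in_unip(1)[of 1]] c[OF in_unip(2)[of 1]] by auto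
  ultimately show "\<exists>\<phi>. poly_path (2 * r) \<phi> \<and> range \<phi> \<subseteq> unip r b \<and> \<phi> 0 = A \<and> \<phi> 1 = B"
    using in_unip by (intro exI[of _ "\<lambda>s. \<phi> (1 - s) * \<psi> s"]) (auto intro: unip_mult)
qed

text \<open>Inside a Borel subgroup the matrices are triangular, and a triangular matrix is
  unipotent exactly if its diagonal is 1; so every competitor in \<open>GREATEST\<close> is
  contained in \<open>unip r b\<close>.\<close>

lemma unipotent_radical_borel: "unipotent_radical r (borel r b) = unip r b"
  unfolding unipotent_radical_def
proof (rule Greatest_equality)
  have iff: "unipotent_mat (2 * r) u \<longleftrightarrow> (\<forall>p<2*r. u $$ (p, p) = 1)" if "u \<in> borel r b" for u
    using tri_unipotent_iff[OF Sp_carrier_mat[OF borel_in_Sp[OF that]] borel_tri[OF that]] .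
  show "unip r b \<lhd> (Sp r)\<lparr>carrier := borel r b\<rparr> \<and>
     closedin (subtopology (zariski (2 * r)) (borel r b)) (unip r b) \<and>
     connectedin (zariski (2 * r)) (unip r b) \<and> (\<forall>u\<in>unip r b. unipotent_mat (2 * r) u)"
    using unip_normal unip_closed unip_connected iff by (auto simp: unip_def)
  fix U assume U: "U \<lhd> (Sp r)\<lparr>carrier := borel r b\<rparr> \<and>
     closedin (subtopology (zariski (2 * r)) (borel r b)) U \<and>
     connectedin (zariski (2 * r)) U \<and> (\<forall>u\<in>U. unipotent_mat (2 * r) u)"
  then have "U \<subseteq> borel r b"
    using normal_imp_subgroup subgroup.subset by fastforce
  then show "U \<subseteq> unip r b" using U iff by (auto simp: unip_def)
qed

lemma N_pos_eq: "N_pos r = unip r True" and N_neg_eq: "N_neg r = unip r False"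
  by (simp_all add: N_pos_def N_neg_def borel_pos_eq borel_neg_eq unipotent_radical_borel)

text \<open>Absorbing the torus into both factors gives B_- B, a shape visibly stable under left
  multiplication by B_-.\<close>

lemma G0_eq: "G0 r = {A * B | A B. A \<in> borel r False \<and> B \<in> borel r True}"
proof (intro equalityI subsetI)
  fix x assume "x \<in> G0 r"
  then obtain y h z where "y \<in> unip r False" "h \<in> torus r" "z \<in> unip r True" "x = y * h * z"
    by (auto simp: G0_def N_pos_eq N_neg_eq set_mult_def)
  moreover from this have "y * h \<in> borel r False"
    using torus_subset_borel[of r False] by (intro borel_mult) (auto simp: unip_def)
  ultimately show "x \<in> {A * B | A B. A \<in> borel r False \<and> B \<in> borel r True}"
    by (auto simp: unip_def)
next
  fix x assume "x \<in> {A * B | A B. A \<in> borel r False \<and> B \<in> borel r True}"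
  then obtain A B where AB: "x = A * B" "A \<in> borel r False" "B \<in> borel r True" by blast
  obtain y where y: "y \<in> unip r False" "A = y * diag_elt r (\<lambda>p. A $$ (p, p))"
    using unip_decompose(1)[OF AB(2)] by blast
  obtain z where z: "z \<in> unip r True" "B = diag_elt r (\<lambda>p. B $$ (p, p)) * z"
    using unip_decompose(2)[OF AB(3)] by blast
  define h where "h = diag_elt r (\<lambda>p. A $$ (p, p))"
  define k where "k = diag_elt r (\<lambda>p. B $$ (p, p))"
  have hk: "h \<in> torus r" "k \<in> torus r" unfolding h_def k_def using borel_diag AB by blast+
  then have hk': "h * k \<in> torus r" using subgroup.m_closed[OF subgroup_torus] by fastforce
  have c: "y \<in> carrier (Sp r)" "h \<in> carrier (Sp r)" "k \<in> carrier (Sp r)" "z \<in> carrier (Sp r)"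
    using hk torus_subset_Sp y z borel_in_Sp by (auto simp: unip_def)
  have "x = (y * h) * (k * z)" using AB(1) y(2) z(2) unfolding h_def k_def by metis
  also have "\<dots> = y * (h * k) * z" using c by (simp add: Sp_assoc Sp_mult_closed)
  finally show "x \<in> G0 r"
    using y(1) z(1) hk' unfolding G0_def N_pos_eq N_neg_eq set_mult_def by fastforce
qed

text \<open>Two decompositions give y'^{-1} y h = h' z' z^{-1}. The factors next to h and h' have
  unit diagonal, so comparing diagonals yields h = h'.\<close>

lemma gauss_torus_eq:
  assumes y: "y \<in> unip r False" and h: "h \<in> torus r" and z: "z \<in> unip r True"
  shows "gauss_torus r (y * h * z) = h"
  unfolding gauss_torus_def
proof (rule the_equality)
  show "h \<in> torus r \<and> (\<exists>y'\<in>N_neg r. \<exists>z'\<in>N_pos r. y * h * z = y' \<otimes>\<^bsub>Sp r\<^esub> h \<otimes>\<^bsub>Sp r\<^esub> z')"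
    using assms by (auto simp: N_neg_eq N_pos_eq)
  fix h' assume "h' \<in> torus r \<and> (\<exists>y'\<in>N_neg r. \<exists>z'\<in>N_pos r. y * h * z = y' \<otimes>\<^bsub>Sp r\<^esub> h' \<otimes>\<^bsub>Sp r\<^esub> z')"
  then obtain y' z' where h': "h' \<in> torus r" and y': "y' \<in> unip r False" and z': "z' \<in> unip r True"
    and eq: "y * h * z = y' * h' * z'"
    by (auto simp: N_neg_eq N_pos_eq)
  let ?i = "\<lambda>x. inv\<^bsub>Sp r\<^esub> x"
  have iy: "?i y' \<in> unip r False" and iz: "?i z \<in> unip r True" using y' z by (auto intro: unip_inv)
  have c: "y \<in> carrier (Sp r)" "h \<in> carrier (Sp r)" "z \<in> carrier (Sp r)" "y' \<in> carrier (Sp r)"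
    "h' \<in> carrier (Sp r)" "z' \<in> carrier (Sp r)" "?i y' \<in> carrier (Sp r)" "?i z \<in> carrier (Sp r)"
    using y h z y' h' z' torus_subset_Sp iy iz borel_in_Sp by (auto simp: unip_def)
  note c' = c[THEN Sp_carrier_mat]
  have "?i y' * (y * h * z) * ?i z = ?i y' * y * h * (z * ?i z)"
    using c' by (simp add: mat_assoc_square[where n = "2 * r"])
  moreover have "?i y' * (y' * h' * z') * ?i z = (?i y' * y') * h' * (z' * ?i z)"
    using c' by (simp add: mat_assoc_square[where n = "2 * r"])
  ultimately have *: "?i y' * y * h = h' * (z' * ?i z)"
    using c c[THEN Sp_carrier_mat] by (simp add: eq Sp_inv_mult mult_carrier_mat[of _ "2*r" "2*r"])
  have L: "?i y' * y \<in> unip r False" and U: "z' * ?i z \<in> unip r True" using unip_mult iy y z' iz by auto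
  obtain d d' where d: "h = diag_elt r d" "h' = diag_elt r d'" using h h' by (auto simp: torus_eq)
  have "d p = d' p" if p: "p < 2 * r" for p
  proof -
    have "(?i y' * y * h) $$ (p, p) = (h' * (z' * ?i z)) $$ (p, p)" using * by simp
    then have "(?i y' * y) $$ (p, p) * d p = d' p * (z' * ?i z) $$ (p, p)"
      unfolding d using p c by (simp add: diag_elt_mult_left diag_elt_mult_right Sp_carrier_mat Sp_mult_closed del: index_mult_mat(1))
    then show ?thesis using L U p by (simp add: unip_def del: index_mult_mat(1))
  qed
  then show "h' = h" by (auto simp: d diag_elt_eq_iff)
qed

section \<open>Generation of the symplectic group by root subgroups\<close>

lemma mult_mat_vec_index:
  assumes "A \<in> carrier_mat n n" "v \<in> carrier_vec n" "i < n"
  shows "(A *\<^sub>v v) $ i = (\<Sum>k<n. A $$ (i, k) * v $ k)"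
  using assms by (auto simp: scalar_prod_def atLeast0LessThan)

text \<open>Repeating the vector in every column makes the row formulas for matrix products
  available for vectors.\<close>

lemma mult_mat_vec_as_mat:
  assumes "A \<in> carrier_mat n n" "v \<in> carrier_vec n" "i < n"
  shows "(A *\<^sub>v v) $ i = (A * mat n n (\<lambda>(a, b). v $ a)) $$ (i, i)"
  unfolding mult_mat_vec_index[OF assms] mat_mult_index[OF assms(1) mat_carrier assms(3,3)]
  using assms by (intro sum.cong) auto

lemma x_sub_mult_vec:
  assumes i: "i \<in> {1..r}" and v: "v \<in> carrier_vec (2 * r)" and p: "p < 2 * r"
  shows "(x_sub r i t *\<^sub>v v) $ p = v $ p + (if p = i - 1 \<or> p = 2 * r - 1 - i then t * v $ (p + 1) else 0)"
proof -
  have "p + 1 < 2 * r" if "p = i - 1 \<or> p = 2 * r - 1 - i" using that i by auto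
  then show ?thesis
    unfolding mult_mat_vec_as_mat[OF x_sub_carrier_mat[OF i] v p] x_sub_mult_index[OF i mat_carrier p p]
    using p by (cases "p = i - 1 \<or> p = 2 * r - 1 - i") simp_all
qed

lemma y_sub_mult_vec:
  assumes i: "i \<in> {1..r}" and v: "v \<in> carrier_vec (2 * r)" and p: "p < 2 * r"
  shows "(y_sub r i t *\<^sub>v v) $ p = v $ p + (if p = i \<or> p = 2 * r - i then t * v $ (p - 1) else 0)"
  unfolding mult_mat_vec_as_mat[OF y_sub_carrier_mat[OF i] v p] y_sub_mult_index[OF i mat_carrier p p]
  using p by (cases "p = i \<or> p = 2 * r - i") simp_all

text \<open>The subgroup of the simple roots with index above k, a subsystem of type C_{r-k}; it
  mixes only positions k, ..., 2r - 1 - k. For k = 0 all root subgroups are allowed.\<close>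

definition level_group :: "nat \<Rightarrow> nat \<Rightarrow> complex mat set" where
  "level_group r k = generate (Sp r) {root_sub r b i t | b i t. k < i \<and> i \<le> r}"

lemma subgroup_level_group: "subgroup (level_group r k) (Sp r)"
  unfolding level_group_def by (intro Sp.generate_is_subgroup) (auto simp: root_sub_in_Sp)

lemma level_group_in_Sp: "A \<in> level_group r k \<Longrightarrow> A \<in> carrier (Sp r)"
  using subgroup.subset[OF subgroup_level_group] by blast

lemma level_group_carrier_mat: "A \<in> level_group r k \<Longrightarrow> A \<in> carrier_mat (2 * r) (2 * r)"
  by (intro Sp_carrier_mat level_group_in_Sp)

lemma level_group_mult: "A \<in> level_group r k \<Longrightarrow> B \<in> level_group r k \<Longrightarrow> A * B \<in> level_group r k"
  using subgroup.m_closed[OF subgroup_level_group] by fastforce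

lemma level_group_one: "1\<^sub>m (2 * r) \<in> level_group r k"
  using subgroup.one_closed[OF subgroup_level_group] by simp

lemma level_group_inv: "A \<in> level_group r k \<Longrightarrow> inv\<^bsub>Sp r\<^esub> A \<in> level_group r k"
  using subgroup.m_inv_closed[OF subgroup_level_group] .

lemma level_group_mono: "k \<le> l \<Longrightarrow> level_group r l \<subseteq> level_group r k"
  unfolding level_group_def by (intro Sp.mono_generate subsetI) (elim CollectE exE conjE, intro CollectI exI conjI, auto)

lemma root_sub_in_level_group: "k < i \<Longrightarrow> i \<le> r \<Longrightarrow> root_sub r b i t \<in> level_group r k"
  unfolding level_group_def by (intro generate.incl CollectI exI conjI) auto

lemma level_group_induct [consumes 1, case_names one root mult]:
  assumes "A \<in> level_group r k"
    and "P (1\<^sub>m (2 * r))"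
    and "\<And>b i t. k < i \<Longrightarrow> i \<le> r \<Longrightarrow> P (root_sub r b i t)"
    and "\<And>A B. A \<in> level_group r k \<Longrightarrow> P A \<Longrightarrow> B \<in> level_group r k \<Longrightarrow> P B \<Longrightarrow> P (A * B)"
  shows "P A"
  using assms(1) unfolding level_group_def
proof induction
  case one
  then show ?case using assms(2) by simp
next
  case (incl h)
  then show ?case using assms(3) by blast
next
  case (inv h)
  then obtain b i t where "h = root_sub r b i t" "k < i" "i \<le> r" by blast
  then show ?case using assms(3) root_sub_inverse[of i r b t] by simp
next
  case (eng h1 h2)
  then show ?case using assms(4) unfolding level_group_def by simp
qed

text \<open>A root element of index i > k changes a vector only by multiples of its coordinates at i
  - 1, i, 2r - 1 - i and 2r - i, and all of these lie in the range where v vanishes.\<close>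

lemma level_group_fix:
  assumes "g \<in> level_group r k" "v \<in> carrier_vec (2 * r)" "\<And>p. k \<le> p \<Longrightarrow> p < 2 * r - k \<Longrightarrow> v $ p = 0"
  shows "g *\<^sub>v v = v"
  using assms(1)
proof (induction rule: level_group_induct)
  case one
  then show ?case using assms(2) by simp
next
  case (root b i t)
  then have i: "i \<in> {1..r}" by auto
  show ?case
  proof (rule eq_vecI)
    fix p assume "p < dim_vec v"
    then have p: "p < 2 * r" using assms(2) by simp
    have x: "v $ (p + 1) = 0" if "p = i - 1 \<or> p = 2 * r - 1 - i"
      using that root by (intro assms(3)) auto
    have y: "v $ (p - 1) = 0" if "p = i \<or> p = 2 * r - i"
      using that root by (intro assms(3)) auto
    show "(root_sub r b i t *\<^sub>v v) $ p = v $ p"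
      using x y unfolding root_sub_def
      by (cases b) (simp_all only: if_True if_False x_sub_mult_vec[OF i assms(2) p] y_sub_mult_vec[OF i assms(2) p] split: if_splits, simp_all)
  qed (use i assms(2) Sp_carrier_mat[OF root_sub_in_Sp[OF i, of b t]] in auto)
next
  case (mult A B)
  then show ?case
    using level_group_carrier_mat[OF mult.hyps(1)] level_group_carrier_mat[OF mult.hyps(2)] assms(2) by simp
qed

section \<open>Transitivity on nonzero vectors\<close>

definition reach :: "nat \<Rightarrow> nat \<Rightarrow> complex vec \<Rightarrow> complex vec \<Rightarrow> bool" where
  "reach r k v w \<longleftrightarrow> v \<in> carrier_vec (2 * r) \<and> (\<exists>g\<in>level_group r k. g *\<^sub>v v = w)"

lemma reach_trans [trans]:
  assumes "reach r k u v" "reach r k v w"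
  shows "reach r k u w"
proof -
  obtain g where g: "g \<in> level_group r k" "g *\<^sub>v u = v" using assms(1) unfolding reach_def by blast
  obtain h where h: "h \<in> level_group r k" "h *\<^sub>v v = w" using assms(2) unfolding reach_def by blast
  have u: "u \<in> carrier_vec (2 * r)" using assms(1) by (simp add: reach_def)
  have "(h * g) *\<^sub>v u = w"
    using g(2) h(2) assoc_mult_mat_vec[OF level_group_carrier_mat[OF h(1)] level_group_carrier_mat[OF g(1)] u] by simp
  then show ?thesis using u level_group_mult[OF h(1) g(1)] unfolding reach_def by blast
qed

lemma reach_sym:
  assumes "reach r k v w"
  shows "reach r k w v"
proof -
  have v: "v \<in> carrier_vec (2 * r)" using assms by (simp add: reach_def)
  obtain g where g: "g \<in> level_group r k" "g *\<^sub>v v = w" using assms unfolding reach_def by blast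
  have w: "w \<in> carrier_vec (2 * r)"
    using g(2) mult_mat_vec_carrier[OF level_group_carrier_mat[OF g(1)] v] by simp
  have "inv\<^bsub>Sp r\<^esub> g *\<^sub>v w = (inv\<^bsub>Sp r\<^esub> g * g) *\<^sub>v v"
    using assoc_mult_mat_vec[OF level_group_carrier_mat[OF level_group_inv[OF g(1)]] level_group_carrier_mat[OF g(1)] v] g(2) by simp
  also have "\<dots> = v" using v by (simp add: Sp_inv_mult(1)[OF level_group_in_Sp[OF g(1)]])
  finally show ?thesis using w level_group_inv[OF g(1)] unfolding reach_def by blast
qed

definition supported :: "nat \<Rightarrow> nat \<Rightarrow> complex vec \<Rightarrow> bool" where
  "supported r k v \<longleftrightarrow> v \<in> carrier_vec (2 * r) \<and> (\<forall>p<2*r. p < k \<or> 2 * r - k \<le> p \<longrightarrow> v $ p = 0)"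

text \<open>The group one level further in does not see the outer coordinates, so moves of the inner
  part can be carried out with an outer part attached.\<close>

lemma reach_add_fixed:
  assumes "reach r (Suc k) v w" "u \<in> carrier_vec (2 * r)"
    "\<And>p. Suc k \<le> p \<Longrightarrow> p < 2 * r - Suc k \<Longrightarrow> u $ p = 0"
  shows "reach r k (v + u) (w + u)"
proof -
  have v: "v \<in> carrier_vec (2 * r)" using assms(1) by (simp add: reach_def)
  obtain g where g: "g \<in> level_group r (Suc k)" "g *\<^sub>v v = w" using assms(1) unfolding reach_def by blast
  have "g *\<^sub>v (v + u) = w + u"
    using mult_add_distrib_mat_vec[OF level_group_carrier_mat[OF g(1)] v assms(2)] g(2) level_group_fix[OF g(1) assms(2,3)] by simp
  moreover have "g \<in> level_group r k" using g(1) level_group_mono[of k "Suc k" r] by auto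
  moreover have "v + u \<in> carrier_vec (2 * r)" using v assms(2) by simp
  ultimately show ?thesis unfolding reach_def by blast
qed

text \<open>Attaches the hyperbolic pair v_{k+1}, v_{bar (k+1)}, located at positions k and 2r - 1 -
  k, to an inner vector.\<close>

definition extend :: "nat \<Rightarrow> nat \<Rightarrow> complex \<Rightarrow> complex vec \<Rightarrow> complex \<Rightarrow> complex vec" where
  "extend r k a v b = v + (a \<cdot>\<^sub>v unit_vec (2 * r) k + b \<cdot>\<^sub>v unit_vec (2 * r) (2 * r - 1 - k))"

lemma extend_carrier: "v \<in> carrier_vec (2 * r) \<Longrightarrow> extend r k a v b \<in> carrier_vec (2 * r)"
  by (simp add: extend_def)

lemma extend_index:
  assumes "supported r (Suc k) v" "k < r" "p < 2 * r"
  shows "extend r k a v b $ p = (if p = k then a else if p = 2 * r - 1 - k then b else v $ p)"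
proof -
  have v: "v \<in> carrier_vec (2 * r)" "p < Suc k \<or> 2 * r - Suc k \<le> p \<Longrightarrow> v $ p = 0"
    using assms by (auto simp: supported_def)
  have "extend r k a v b $ p = v $ p + (a * (if p = k then 1 else 0) + b * (if p = 2 * r - 1 - k then 1 else 0))"
    using v(1) assms(2,3) by (simp add: extend_def)
  then show ?thesis using v(2) assms(2) by auto
qed

lemma supported_unit: "k \<le> q \<Longrightarrow> q < 2 * r - k \<Longrightarrow> supported r k (unit_vec (2 * r) q)"
  by (auto simp: supported_def)

lemma supported_add_smult:
  "supported r k v \<Longrightarrow> supported r k w \<Longrightarrow> supported r k (v + c \<cdot>\<^sub>v w)"
  by (auto simp: supported_def)

lemma supported_zero: "supported r k (0\<^sub>v (2 * r))"
  by (auto simp: supported_def)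

lemma reach_extend:
  assumes "reach r (Suc k) v w" "k < r"
  shows "reach r k (extend r k a v b) (extend r k a w b)"
  unfolding extend_def
proof (rule reach_add_fixed[OF assms(1)])
  fix p assume "Suc k \<le> p" "p < 2 * r - Suc k"
  then show "(a \<cdot>\<^sub>v unit_vec (2 * r) k + b \<cdot>\<^sub>v unit_vec (2 * r) (2 * r - 1 - k)) $ p = 0"
    using assms(2) by auto
qed simp

text \<open>Among the roots of level k only index k + 1 links the outer pair with the inner part: an
  inner coordinate flows into a, and b flows into the inner part.\<close>

lemma reach_extend_x:
  assumes k: "Suc k < r" and v: "supported r (Suc k) v"
  shows "reach r k (extend r k a v b)
     (extend r k (a + t * v $ Suc k) (v + (t * b) \<cdot>\<^sub>v unit_vec (2 * r) (2 * r - 2 - k)) b)"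
proof -
  have i: "Suc k \<in> {1..r}" and kr: "k < r" using k by auto
  have v': "v \<in> carrier_vec (2 * r)" using v by (simp add: supported_def)
  note c = extend_carrier[OF v', of k a b]
  have s: "supported r (Suc k) (v + (t * b) \<cdot>\<^sub>v unit_vec (2 * r) (2 * r - 2 - k))"
    by (intro supported_add_smult v supported_unit) (use k in auto)
  have "x_sub r (Suc k) t *\<^sub>v extend r k a v b =
      extend r k (a + t * v $ Suc k) (v + (t * b) \<cdot>\<^sub>v unit_vec (2 * r) (2 * r - 2 - k)) b" (is "_ = ?w")
  proof (rule eq_vecI)
    fix p assume "p < dim_vec ?w"
    then have p: "p < 2 * r" using v' by (simp add: extend_def)
    have 1: "extend r k a v b $ (p + 1) = v $ Suc k" if "p = k"
      using that k p extend_index[OF v kr, of "p + 1" a b] by auto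
    have 2: "extend r k a v b $ (p + 1) = b" if "p = 2 * r - 2 - k"
      using that k p extend_index[OF v kr, of "p + 1" a b] by auto
    have 3: "2 * r - 1 - Suc k = 2 * r - 2 - k" "Suc k - 1 = k" by auto
    have 4: "k \<noteq> 2 * r - 2 - k" "k \<noteq> 2 * r - 1 - k" "2 * r - 2 - k \<noteq> 2 * r - 1 - k" using k by auto
    have 5: "(v + (t * b) \<cdot>\<^sub>v unit_vec (2 * r) (2 * r - 2 - k)) $ p = v $ p + (if p = 2 * r - 2 - k then t * b else 0)"
      using p v' k by simp
    show "(x_sub r (Suc k) t *\<^sub>v extend r k a v b) $ p = ?w $ p"
      unfolding x_sub_mult_vec[OF i c p] extend_index[OF s kr p] extend_index[OF v kr p] 3 5
      using 1 2 4 by (cases "p = k"; cases "p = 2 * r - 2 - k"; cases "p = 2 * r - 1 - k") simp_all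
  qed (use v' i in \<open>auto simp: extend_def\<close>)
  moreover have "x_sub r (Suc k) t \<in> level_group r k"
    using root_sub_in_level_group[of k "Suc k" r True t] k by (simp add: root_sub_def)
  ultimately show ?thesis using c unfolding reach_def by blast
qed

lemma reach_extend_y:
  assumes k: "Suc k < r" and v: "supported r (Suc k) v"
  shows "reach r k (extend r k a v b)
     (extend r k a (v + (t * a) \<cdot>\<^sub>v unit_vec (2 * r) (Suc k)) (b + t * v $ (2 * r - 2 - k)))"
proof -
  have i: "Suc k \<in> {1..r}" and kr: "k < r" using k by auto
  have v': "v \<in> carrier_vec (2 * r)" using v by (simp add: supported_def)
  note c = extend_carrier[OF v', of k a b]
  have s: "supported r (Suc k) (v + (t * a) \<cdot>\<^sub>v unit_vec (2 * r) (Suc k))"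
    by (intro supported_add_smult v supported_unit) (use k in auto)
  have "y_sub r (Suc k) t *\<^sub>v extend r k a v b =
      extend r k a (v + (t * a) \<cdot>\<^sub>v unit_vec (2 * r) (Suc k)) (b + t * v $ (2 * r - 2 - k))" (is "_ = ?w")
  proof (rule eq_vecI)
    fix p assume "p < dim_vec ?w"
    then have p: "p < 2 * r" using v' by (simp add: extend_def)
    have 1: "extend r k a v b $ (p - 1) = a" if "p = Suc k"
      using that k p extend_index[OF v kr, of "p - 1" a b] by auto
    have 2: "extend r k a v b $ (p - 1) = v $ (2 * r - 2 - k)" if "p = 2 * r - 1 - k"
    proof -
      have "p - 1 = 2 * r - 2 - k" "2 * r - 2 - k < 2 * r" "2 * r - 2 - k \<noteq> k" "2 * r - 2 - k \<noteq> 2 * r - 1 - k"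
        using that k by auto
      then show ?thesis using extend_index[OF v kr, of "p - 1" a b] by simp
    qed
    have 3: "2 * r - Suc k = 2 * r - 1 - k" by auto
    have 4: "k \<noteq> Suc k" "k \<noteq> 2 * r - 1 - k" "Suc k \<noteq> 2 * r - 1 - k" using k by auto
    have 5: "(v + (t * a) \<cdot>\<^sub>v unit_vec (2 * r) (Suc k)) $ p = v $ p + (if p = Suc k then t * a else 0)"
      using p v' k by simp
    show "(y_sub r (Suc k) t *\<^sub>v extend r k a v b) $ p = ?w $ p"
      unfolding y_sub_mult_vec[OF i c p] extend_index[OF s kr p] extend_index[OF v kr p] 3 5
      using 1 2 4 by (cases "p = k"; cases "p = Suc k"; cases "p = 2 * r - 1 - k") simp_all
  qed (use v' i carrier_matD(1)[OF y_sub_carrier_mat[OF i]] in \<open>auto simp: extend_def\<close>)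
  moreover have "y_sub r (Suc k) t \<in> level_group r k"
    using root_sub_in_level_group[of k "Suc k" r False t] k by (simp add: root_sub_def)
  ultimately show ?thesis using c unfolding reach_def by blast
qed

text \<open>On the innermost pair, at positions r - 1 and r, the long root acts as the elementary
  matrices of SL_2.\<close>

lemma reach_last_x:
  assumes "0 < r"
  shows "reach r (r - 1) (extend r (r - 1) a (0\<^sub>v (2 * r)) b) (extend r (r - 1) (a + t * b) (0\<^sub>v (2 * r)) b)"
    and "reach r (r - 1) (extend r (r - 1) a (0\<^sub>v (2 * r)) b) (extend r (r - 1) a (0\<^sub>v (2 * r)) (b + t * a))"
proof -
  let ?e = "\<lambda>a b. extend r (r - 1) a (0\<^sub>v (2 * r)) b"
  have i: "r \<in> {1..r}" and k: "r - 1 < r" using assms by auto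
  have c: "?e a b \<in> carrier_vec (2 * r)" by (simp add: extend_carrier)
  have idx: "?e a b $ p = (if p = r - 1 then a else if p = r then b else 0)" if "p < 2 * r" for p a b
  proof -
    have "2 * r - 1 - (r - 1) = r" using assms by auto
    then show ?thesis
      using extend_index[OF supported_zero k that, of a b] that by (auto split: if_splits)
  qed
  have r: "r - 1 + 1 = r" "2 * r - 1 - r = r - 1" "2 * r - r = r" "r - 1 \<noteq> r" "r < 2 * r" "r - 1 < 2 * r" using assms by auto
  have x: "x_sub r r t *\<^sub>v ?e a b = ?e (a + t * b) b"
  proof (rule eq_vecI)
    fix p assume "p < dim_vec (?e (a + t * b) b)"
    then have p: "p < 2 * r" by (simp add: extend_def)
    show "(x_sub r r t *\<^sub>v ?e a b) $ p = ?e (a + t * b) b $ p"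
      unfolding x_sub_mult_vec[OF i c p] idx[OF p] using r idx[OF r(5)] by auto
  qed (use i in \<open>auto simp: extend_def\<close>)
  have y: "y_sub r r t *\<^sub>v ?e a b = ?e a (b + t * a)"
  proof (rule eq_vecI)
    fix p assume "p < dim_vec (?e a (b + t * a))"
    then have p: "p < 2 * r" by (simp add: extend_def)
    show "(y_sub r r t *\<^sub>v ?e a b) $ p = ?e a (b + t * a) $ p"
      unfolding y_sub_mult_vec[OF i c p] idx[OF p] using r idx[OF r(6)] by auto
  qed (use carrier_matD(1)[OF y_sub_carrier_mat[OF i]] in \<open>auto simp: extend_def\<close>)
  have "x_sub r r t \<in> level_group r (r - 1)" "y_sub r r t \<in> level_group r (r - 1)"
    using root_sub_in_level_group[of "r - 1" r r True t] root_sub_in_level_group[of "r - 1" r r False t] assms by (auto simp: root_sub_def)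
  then show "reach r (r - 1) (?e a b) (?e (a + t * b) b)" "reach r (r - 1) (?e a b) (?e a (b + t * a))"
    using c x y unfolding reach_def by blast+
qed

lemma supported_decompose:
  assumes "supported r k v" "k < r"
  shows "\<exists>w. supported r (Suc k) w \<and> v = extend r k (v $ k) w (v $ (2 * r - 1 - k))"
proof -
  let ?w = "vec (2 * r) (\<lambda>p. if p = k \<or> p = 2 * r - 1 - k then 0 else v $ p)"
  have w: "supported r (Suc k) ?w"
    using assms by (auto simp: supported_def less_Suc_eq)
  have "v = extend r k (v $ k) ?w (v $ (2 * r - 1 - k))"
  proof (rule eq_vecI)
    fix p assume "p < dim_vec (extend r k (v $ k) ?w (v $ (2 * r - 1 - k)))"
    then have p: "p < 2 * r" by (simp add: extend_def)
    show "v $ p = extend r k (v $ k) ?w (v $ (2 * r - 1 - k)) $ p"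
      unfolding extend_index[OF w assms(2) p] using p by auto
  qed (use assms in \<open>auto simp: extend_def supported_def\<close>)
  then show ?thesis using w by blast
qed

lemma extend_unit: "k < r \<Longrightarrow> extend r k 1 (0\<^sub>v (2 * r)) 0 = unit_vec (2 * r) k"
  by (intro eq_vecI) (auto simp: extend_def)

lemma extend_zero: "extend r k 0 (0\<^sub>v (2 * r)) 0 = 0\<^sub>v (2 * r)"
  by (intro eq_vecI) (auto simp: extend_def)

text \<open>Only the inner part can be moved freely, by the induction hypothesis. It therefore
  serves as a probe: it is placed where a root element can use it to correct a, then b, and after
  each correction the damage done to it is undone. Finally a = 1 is used to erase it.\<close>

lemma reach_step:
  assumes k: "Suc k < r" and IH: "\<And>v. supported r (Suc k) v \<Longrightarrow> v \<noteq> 0\<^sub>v (2 * r) \<Longrightarrow> reach r (Suc k) v (unit_vec (2 * r) (Suc k))"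
    and v: "supported r (Suc k) v" "v \<noteq> 0\<^sub>v (2 * r)"
  shows "reach r k (extend r k a v b) (unit_vec (2 * r) k)"
proof -
  let ?e = "unit_vec (2 * r) :: nat \<Rightarrow> complex vec" and ?N = "2 * r - 2 - k"
  have kr: "k < r" using k by simp
  have N: "?N < 2 * r" "Suc k < 2 * r" "Suc k \<noteq> ?N" using k by auto
  have s: "supported r (Suc k) (?e (Suc k))" "supported r (Suc k) (?e ?N)"
    using k by (auto intro!: supported_unit)
  have nz: "w \<noteq> 0\<^sub>v (2 * r)" if "w $ q \<noteq> 0" "q < 2 * r" for w :: "complex vec" and q
    using that by auto
  have "reach r k (extend r k a v b) (extend r k a (?e (Suc k)) b)"
    by (rule reach_extend[OF IH[OF v] kr])
  \<comment> \<open>The inner entry is 1, so the parameter 1 - a turns the outer entry a into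
    1.\<close>
  also have "reach r k (extend r k a (?e (Suc k)) b)
      (extend r k (a + (1 - a) * ?e (Suc k) $ Suc k) (?e (Suc k) + ((1 - a) * b) \<cdot>\<^sub>v ?e ?N) b)"
    by (rule reach_extend_x[OF k s(1)])
  also have "a + (1 - a) * ?e (Suc k) $ Suc k = 1" using N by simp
  also have "reach r k (extend r k 1 (?e (Suc k) + ((1 - a) * b) \<cdot>\<^sub>v ?e ?N) b) (extend r k 1 (?e (Suc k)) b)"
    using N by (intro reach_extend[OF IH kr] supported_add_smult s nz[of _ "Suc k"]) auto
  \<comment> \<open>Position \<open>?N\<close> is the inner coordinate that the negative root
    element adds to b.\<close>
  also have "reach r k (extend r k 1 (?e (Suc k)) b) (extend r k 1 (?e ?N) b)"
    using N by (intro reach_sym[OF reach_extend[OF IH kr]] s nz[of _ "?N"]) auto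
  also have "reach r k (extend r k 1 (?e ?N) b)
      (extend r k 1 (?e ?N + (- b * 1) \<cdot>\<^sub>v ?e (Suc k)) (b + - b * ?e ?N $ ?N))"
    by (rule reach_extend_y[OF k s(2)])
  also have "b + - b * ?e ?N $ ?N = 0" using N by simp
  also have "reach r k (extend r k 1 (?e ?N + (- b * 1) \<cdot>\<^sub>v ?e (Suc k)) 0) (extend r k 1 (?e (Suc k)) 0)"
    using N by (intro reach_extend[OF IH kr] supported_add_smult s nz[of _ "?N"]) auto
  \<comment> \<open>With a = 1, parameter -1 cancels the inner entry; b stays 0 because the inner
    part vanishes at \<open>?N\<close>.\<close>
  also have "reach r k (extend r k 1 (?e (Suc k)) 0)
      (extend r k 1 (?e (Suc k) + (- 1 * 1) \<cdot>\<^sub>v ?e (Suc k)) (0 + - 1 * ?e (Suc k) $ ?N))"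
    by (rule reach_extend_y[OF k s(1)])
  also have "?e (Suc k) + (- 1 * 1) \<cdot>\<^sub>v ?e (Suc k) = 0\<^sub>v (2 * r)" by (intro eq_vecI) auto
  also have "0 + - 1 * ?e (Suc k) $ ?N = 0" using N by simp
  also have "extend r k 1 (0\<^sub>v (2 * r)) 0 = ?e k" by (rule extend_unit[OF kr])
  finally show ?thesis .
qed

text \<open>Downward induction from the innermost pair. A nonzero inner part is handled by
  \<open>reach_step\<close>; if it is zero, a root element of index k + 1 first copies a nonzero
  outer entry into it.\<close>

lemma reach_unit:
  assumes "k < r" "supported r k v" "v \<noteq> 0\<^sub>v (2 * r)"
  shows "reach r k v (unit_vec (2 * r) k)"
proof -
  have "k \<le> r - 1" using assms(1) by auto
  then show ?thesis using assms(2,3)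
  proof (induction k arbitrary: v rule: inc_induct)
    case base
    let ?e = "\<lambda>a b. extend r (r - 1) a (0\<^sub>v (2 * r)) b"
    have r: "0 < r" "r - 1 < r" "Suc (r - 1) = r" using assms(1) by auto
    obtain w where w: "supported r r w" "v = extend r (r - 1) (v $ (r - 1)) w (v $ (2 * r - 1 - (r - 1)))"
      using supported_decompose[OF base(1) r(2)] r(3) by auto
    have "w = 0\<^sub>v (2 * r)" using w(1) by (intro eq_vecI) (auto simp: supported_def)
    then obtain a b where v: "v = ?e a b" using w(2) by blast
    \<comment> \<open>A nonzero b is used to make the first entry 1, and that entry then clears
      b.\<close>
    have main: "reach r (r - 1) (?e a b) (?e 1 0)" if b: "b \<noteq> 0" for a b
    proof -
      have "reach r (r - 1) (?e a b) (?e (a + (1 - a) / b * b) b)"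
        by (rule reach_last_x(1)[OF r(1)])
      also have "a + (1 - a) / b * b = 1" using b by simp
      also have "reach r (r - 1) (?e 1 b) (?e 1 (b + - b * 1))"
        by (rule reach_last_x(2)[OF r(1)])
      also have "b + - b * 1 = 0" by simp
      finally show ?thesis .
    qed
    have "reach r (r - 1) (?e a b) (?e 1 0)"
    proof (cases "b = 0")
      case True
      have "a \<noteq> 0" using base(2) v True extend_zero by metis
      have "reach r (r - 1) (?e a b) (?e a (b + 1 * a))"
        by (rule reach_last_x(2)[OF r(1)])
      also have "reach r (r - 1) (?e a (b + 1 * a)) (?e 1 0)"
        by (rule main) (use True \<open>a \<noteq> 0\<close> in simp)
      finally show ?thesis .
    qed (rule main)
    then show ?case using extend_unit[OF r(2)] v by simp
  next
    case (step k)
    have k: "Suc k < r" "k < r" using step by auto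
    let ?N = "2 * r - 2 - k"
    obtain w where w: "supported r (Suc k) w" "v = extend r k (v $ k) w (v $ (2 * r - 1 - k))"
      using supported_decompose[OF step.prems(1) k(2)] by blast
    then obtain a b where v: "v = extend r k a w b" by blast
    have main: "reach r k (extend r k a w b) (unit_vec (2 * r) k)"
      if "supported r (Suc k) w" "w \<noteq> 0\<^sub>v (2 * r)" for a b w
      using that by (intro reach_step[OF k(1)] step.IH)
    have nz: "w \<noteq> 0\<^sub>v (2 * r)" if "w $ q \<noteq> 0" "q < 2 * r" for w :: "complex vec" and q
      using that by auto
    show ?case
    proof (cases "w = 0\<^sub>v (2 * r)")
      case False
      then show ?thesis using main[OF w(1)] v by simp
    next
      case True
      show ?thesis
      proof (cases "a = 0")
        case False
        have "reach r k (extend r k a w b)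
          (extend r k a (w + (1 * a) \<cdot>\<^sub>v unit_vec (2 * r) (Suc k)) (b + 1 * w $ ?N))"
          by (rule reach_extend_y[OF k(1) w(1)])
        also have "reach r k \<dots> (unit_vec (2 * r) k)"
          using False True k by (intro main supported_add_smult w(1) supported_unit nz[of _ "Suc k"]) auto
        finally show ?thesis using v by simp
      next
        case a: True
        have "b \<noteq> 0" using step.prems(2) v True a extend_zero by metis
        have "reach r k (extend r k a w b)
          (extend r k (a + 1 * w $ Suc k) (w + (1 * b) \<cdot>\<^sub>v unit_vec (2 * r) ?N) b)"
          by (rule reach_extend_x[OF k(1) w(1)])
        also have "reach r k \<dots> (unit_vec (2 * r) k)"
          using \<open>b \<noteq> 0\<close> True k by (intro main supported_add_smult w(1) supported_unit nz[of _ "?N"]) auto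
        finally show ?thesis using v by simp
      qed
    qed
  qed
qed

subsection \<open>Transvections\<close>

definition omega :: "nat \<Rightarrow> complex vec \<Rightarrow> complex vec \<Rightarrow> complex" where
  "omega r v u = v \<bullet> (sp_form r *\<^sub>v u)"

lemma omega_Sp:
  assumes "g \<in> carrier (Sp r)" "v \<in> carrier_vec (2 * r)" "u \<in> carrier_vec (2 * r)"
  shows "omega r (g *\<^sub>v v) (g *\<^sub>v u) = omega r v u"
proof -
  let ?n = "2 * r" and ?J = "sp_form r"
  note g = Sp_carrier_mat[OF assms(1)]
  have "omega r (g *\<^sub>v v) (g *\<^sub>v u) = (?J *\<^sub>v (g *\<^sub>v u)) \<bullet> (g *\<^sub>v v)"
    unfolding omega_def using g assms by (intro comm_scalar_prod[of _ ?n]) (auto intro!: mult_mat_vec_carrier[of _ _ ?n])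
  also have "\<dots> = (transpose_mat g *\<^sub>v (?J *\<^sub>v (g *\<^sub>v u))) \<bullet> v"
    using g assms by (intro transpose_vec_mult_scalar[symmetric]) (auto intro!: mult_mat_vec_carrier[of _ _ ?n])
  also have "transpose_mat g *\<^sub>v (?J *\<^sub>v (g *\<^sub>v u)) = (transpose_mat g * ?J * g) *\<^sub>v u"
    using g assms by (simp add: assoc_mult_mat_vec[of _ ?n ?n _ ?n] mult_mat_vec_carrier[of _ ?n ?n] mult_carrier_mat[of _ ?n ?n])
  also have "\<dots> = ?J *\<^sub>v u" using assms(1) by (simp add: Sp_carrier_iff)
  also have "(?J *\<^sub>v u) \<bullet> v = omega r v u"
    unfolding omega_def using assms by (intro comm_scalar_prod[of _ ?n]) (auto intro!: mult_mat_vec_carrier[of _ _ ?n])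
  finally show ?thesis .
qed

lemma sp_form_mult_vec:
  assumes "u \<in> carrier_vec (2 * r)" "a < 2 * r"
  shows "(sp_form r *\<^sub>v u) $ a = (- 1) ^ a * u $ (2 * r - 1 - a)"
  unfolding mult_mat_vec_as_mat[OF sp_form_carrier assms] using assms
  by (subst sp_form_mult_left) auto

lemma omega_eq:
  assumes "u \<in> carrier_vec (2 * r)" "v \<in> carrier_vec (2 * r)"
  shows "omega r v u = (\<Sum>a<2*r. (- 1) ^ a * v $ a * u $ (2 * r - 1 - a))"
proof -
  have "sp_form r *\<^sub>v u \<in> carrier_vec (2 * r)"
    using sp_form_carrier assms(1) by (rule mult_mat_vec_carrier)
  then have "omega r v u = (\<Sum>a<2*r. v $ a * (sp_form r *\<^sub>v u) $ a)"
    unfolding omega_def scalar_prod_def by (simp add: atLeast0LessThan del: index_mult_mat_vec)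
  also have "\<dots> = (\<Sum>a<2*r. (- 1) ^ a * v $ a * u $ (2 * r - 1 - a))"
    using assms by (intro sum.cong) (auto simp: sp_form_mult_vec simp del: index_mult_mat_vec)
  finally show ?thesis .
qed

text \<open>Reversing the summation order replaces a by 2r - 1 - a, which has the opposite
  parity.\<close>

lemma omega_skew:
  assumes "u \<in> carrier_vec (2 * r)" "v \<in> carrier_vec (2 * r)"
  shows "omega r u v = - omega r v u"
proof -
  have "omega r u v = (\<Sum>a<2*r. (- 1) ^ a * u $ a * v $ (2 * r - 1 - a))"
    by (rule omega_eq[OF assms(2,1)])
  also have "\<dots> = (\<Sum>a<2*r. (- 1) ^ (2 * r - 1 - a) * u $ (2 * r - 1 - a) * v $ (2 * r - 1 - (2 * r - 1 - a)))"
    by (subst sum.nat_diff_reindex[symmetric]) simp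
  also have "\<dots> = (\<Sum>a<2*r. - ((- 1) ^ a * v $ a * u $ (2 * r - 1 - a)))"
  proof (intro sum.cong refl)
    fix a assume "a \<in> {..<2 * r}"
    then have "2 * r - 1 - (2 * r - 1 - a) = a" "even (2 * r - 1 - a) \<longleftrightarrow> odd a" by auto
    then show "(- 1) ^ (2 * r - 1 - a) * u $ (2 * r - 1 - a) * v $ (2 * r - 1 - (2 * r - 1 - a)) =
        - ((- 1) ^ a * v $ a * u $ (2 * r - 1 - a))"
      by (simp add: minus_one_power_iff)
  qed
  also have "\<dots> = - omega r v u" by (simp add: sum_negf omega_eq[OF assms])
  finally show ?thesis .
qed

lemma omega_self: "v \<in> carrier_vec (2 * r) \<Longrightarrow> omega r v v = 0"
  using omega_skew[of v r v] by simp

lemma omega_diff_left: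
  "\<lbrakk>u \<in> carrier_vec (2 * r); v \<in> carrier_vec (2 * r); w \<in> carrier_vec (2 * r)\<rbrakk> \<Longrightarrow>
     omega r (v - w) u = omega r v u - omega r w u"
  unfolding omega_eq by (simp add: omega_eq sum_subtractf[symmetric] algebra_simps)

lemma omega_add_left:
  "\<lbrakk>u \<in> carrier_vec (2 * r); v \<in> carrier_vec (2 * r); w \<in> carrier_vec (2 * r)\<rbrakk> \<Longrightarrow>
     omega r (v + w) u = omega r v u + omega r w u"
  by (simp add: omega_eq sum.distrib[symmetric] algebra_simps)

lemma omega_unit_left:
  assumes "v \<in> carrier_vec (2 * r)" "q < 2 * r"
  shows "omega r (unit_vec (2 * r) q) v = (- 1) ^ q * v $ (2 * r - 1 - q)"
proof -
  have "omega r (unit_vec (2 * r) q) v = (\<Sum>a<2*r. if a = q then (- 1) ^ q * v $ (2 * r - 1 - q) else 0)"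
    unfolding omega_eq[OF assms(1) unit_vec_carrier] using assms(2) by (intro sum.cong) auto
  then show ?thesis using assms(2) by simp
qed

lemma omega_unit_right:
  assumes "v \<in> carrier_vec (2 * r)" "q < 2 * r"
  shows "omega r v (unit_vec (2 * r) q) = - ((- 1) ^ q * v $ (2 * r - 1 - q))"
  using omega_skew[OF assms(1) unit_vec_carrier] omega_unit_left[OF assms] by simp

text \<open>The matrix of the symplectic transvection u -> u + c \<omega>(v, u) v, written column by
  column.\<close>

definition transv :: "nat \<Rightarrow> complex vec \<Rightarrow> complex \<Rightarrow> complex mat" where
  "transv r v c = mat (2 * r) (2 * r)
     (\<lambda>(p, q). (if p = q then 1 else 0) + c * v $ p * omega r v (unit_vec (2 * r) q))"

lemma transv_carrier: "transv r v c \<in> carrier_mat (2 * r) (2 * r)"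
  by (simp add: transv_def)

lemma transv_mult_vec:
  assumes v: "v \<in> carrier_vec (2 * r)" and u: "u \<in> carrier_vec (2 * r)"
  shows "transv r v c *\<^sub>v u = u + (c * omega r v u) \<cdot>\<^sub>v v"
proof (rule eq_vecI)
  fix p assume "p < dim_vec (u + (c * omega r v u) \<cdot>\<^sub>v v)"
  then have p: "p < 2 * r" using v by simp
  have "(\<Sum>q<2*r. omega r v (unit_vec (2 * r) q) * u $ q) = (\<Sum>q<2*r. - ((- 1) ^ q * u $ q * v $ (2 * r - 1 - q)))"
    using v by (intro sum.cong) (auto simp: omega_unit_right)
  also have "\<dots> = omega r v u"
    using omega_skew[OF v u] omega_eq[OF v u] by (simp add: sum_negf)
  finally have *: "(\<Sum>q<2*r. omega r v (unit_vec (2 * r) q) * u $ q) = omega r v u" .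
  have "(transv r v c *\<^sub>v u) $ p =
      (\<Sum>q<2*r. (if q = p then u $ p else 0) + c * v $ p * (omega r v (unit_vec (2 * r) q) * u $ q))"
    unfolding mult_mat_vec_index[OF transv_carrier u p] using p
    by (intro sum.cong) (auto simp: transv_def algebra_simps)
  also have "\<dots> = u $ p + c * v $ p * omega r v u"
    using p unfolding sum.distrib sum_distrib_left[symmetric] * by simp
  also have "\<dots> = (u + (c * omega r v u) \<cdot>\<^sub>v v) $ p" using p u v by simp
  finally show "(transv r v c *\<^sub>v u) $ p = (u + (c * omega r v u) \<cdot>\<^sub>v v) $ p" .
qed (use v in \<open>auto simp: transv_def\<close>)

lemma mat_eq_on_vecI:
  fixes A B :: "complex mat"
  assumes A: "A \<in> carrier_mat n n" and B: "B \<in> carrier_mat n n"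
    and eq: "\<And>q. q < n \<Longrightarrow> A *\<^sub>v unit_vec n q = B *\<^sub>v unit_vec n q"
  shows "A = B"
proof (rule eq_matI)
  fix p q assume "p < dim_row B" "q < dim_col B"
  then have pq: "p < n" "q < n" using B by auto
  have "(A *\<^sub>v unit_vec n q) $ p = (B *\<^sub>v unit_vec n q) $ p" using eq pq by simp
  then show "A $$ (p, q) = B $$ (p, q)" using A B pq by simp
qed (use A B in auto)

text \<open>Conjugating by g moves the direction v to g v, because g preserves the form; stated
  without inverses.\<close>

lemma transv_conj:
  assumes g: "g \<in> carrier (Sp r)" and v: "v \<in> carrier_vec (2 * r)"
  shows "transv r (g *\<^sub>v v) c * g = g * transv r v c"
proof (rule mat_eq_on_vecI)
  let ?n = "2 * r"
  note gc = Sp_carrier_mat[OF g]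
  show "transv r (g *\<^sub>v v) c * g \<in> carrier_mat ?n ?n" "g * transv r v c \<in> carrier_mat ?n ?n"
    using gc transv_carrier by (auto intro: mult_carrier_mat)
  fix q assume "q < ?n"
  let ?u = "unit_vec ?n q :: complex vec"
  have u: "?u \<in> carrier_vec ?n" by simp
  have gv: "g *\<^sub>v v \<in> carrier_vec ?n" "g *\<^sub>v ?u \<in> carrier_vec ?n" using gc v by auto
  have "(transv r (g *\<^sub>v v) c * g) *\<^sub>v ?u = transv r (g *\<^sub>v v) c *\<^sub>v (g *\<^sub>v ?u)"
    by (rule assoc_mult_mat_vec[OF transv_carrier gc u])
  also have "\<dots> = g *\<^sub>v ?u + (c * omega r v ?u) \<cdot>\<^sub>v (g *\<^sub>v v)"
    by (simp only: transv_mult_vec[OF gv] omega_Sp[OF g v u])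
  also have "\<dots> = g *\<^sub>v (?u + (c * omega r v ?u) \<cdot>\<^sub>v v)"
    using gc u v by (simp add: mult_add_distrib_mat_vec[OF gc u] mult_mat_vec[OF gc v])
  also have "\<dots> = (g * transv r v c) *\<^sub>v ?u"
    by (simp only: transv_mult_vec[OF v u] assoc_mult_mat_vec[OF gc transv_carrier u])
  finally show "(transv r (g *\<^sub>v v) c * g) *\<^sub>v ?u = (g * transv r v c) *\<^sub>v ?u" .
qed

lemma supported_0: "v \<in> carrier_vec (2 * r) \<Longrightarrow> supported r 0 v"
  by (auto simp: supported_def)

text \<open>The transvections along v_r form the long simple root subgroup. By transitivity every
  nonzero v is the image of v_r under a product of root elements, and conjugation transports
  membership.\<close>

lemma transv_in_level_group:
  assumes v: "v \<in> carrier_vec (2 * r)" and r: "0 < r"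
  shows "transv r v c \<in> level_group r 0"
proof (cases "v = 0\<^sub>v (2 * r)")
  case True
  have "transv r v c = 1\<^sub>m (2 * r)"
    unfolding True by (intro eq_matI) (auto simp: transv_def)
  then show ?thesis by (simp add: level_group_one)
next
  case False
  let ?e = "unit_vec (2 * r) (r - 1) :: complex vec"
  have r': "r - 1 < 2 * r" "r \<in> {1..r}" using r by auto
  have e: "?e \<in> carrier_vec (2 * r)" "?e \<noteq> 0\<^sub>v (2 * r)"
  proof -
    have "?e $ (r - 1) \<noteq> 0\<^sub>v (2 * r) $ (r - 1)" using r' by simp
    then show "?e \<noteq> 0\<^sub>v (2 * r)" by metis
  qed simp
  have "reach r 0 ?e v"
    using reach_trans[OF reach_unit[OF r supported_0[OF e(1)] e(2)] reach_sym[OF reach_unit[OF r supported_0[OF v] False]]] .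
  then obtain g where g: "g \<in> level_group r 0" "g *\<^sub>v ?e = v" unfolding reach_def by blast
  \<comment> \<open>The sign is the pairing of v_r with v_{bar r}, namely (-1)^{r-1}.\<close>
  have "transv r ?e c = x_sub r r (c * (- 1) ^ (r + 1))"
  proof (rule eq_matI)
    fix p q assume "p < dim_row (x_sub r r (c * (- 1) ^ (r + 1)))" "q < dim_col (x_sub r r (c * (- 1) ^ (r + 1)))"
    then have pq: "p < 2 * r" "q < 2 * r" using r' by auto
    have om: "omega r ?e (unit_vec (2 * r) q) = (if q = r then (- 1) ^ (r + 1) else 0)"
    proof -
      have "2 * r - 1 - (r - 1) = r" "even (r - 1) \<longleftrightarrow> odd r" using r by auto
      moreover have "(unit_vec (2 * r) q :: complex vec) $ r = (if q = r then 1 else 0)" using r pq by simp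
      ultimately show ?thesis
        unfolding omega_unit_left[OF unit_vec_carrier r'(1)] by (auto simp: minus_one_power_iff)
    qed
    have 1: "q = p + 1 \<and> (p = r - 1 \<or> p = 2 * r - 1 - r) \<longleftrightarrow> p = r - 1 \<and> q = r" using r by auto
    show "transv r ?e c $$ (p, q) = x_sub r r (c * (- 1) ^ (r + 1)) $$ (p, q)"
      unfolding x_sub_index[OF r'(2) pq] 1 using pq om r by (auto simp: transv_def)
  qed (use r' in \<open>auto simp: transv_def\<close>)
  then have "transv r ?e c \<in> level_group r 0"
    using root_sub_in_level_group[of 0 r r True] r by (simp add: root_sub_def)
  then have *: "g * transv r ?e c * inv\<^bsub>Sp r\<^esub> g \<in> level_group r 0"
    using g(1) by (intro level_group_mult level_group_inv)
  have "g * transv r ?e c * inv\<^bsub>Sp r\<^esub> g = transv r v c * g * inv\<^bsub>Sp r\<^esub> g"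
    using transv_conj[OF level_group_in_Sp[OF g(1)] e(1), of c] g(2) by simp
  also have "\<dots> = transv r v c * (g * inv\<^bsub>Sp r\<^esub> g)"
    by (rule assoc_mult_mat[OF transv_carrier level_group_carrier_mat[OF g(1)] level_group_carrier_mat[OF level_group_inv[OF g(1)]]])
  also have "\<dots> = transv r v c"
    using Sp_inv_mult(2)[OF level_group_in_Sp[OF g(1)]] transv_carrier[of r v c] by simp
  finally show ?thesis using * by simp
qed

text \<open>Records progress in straightening g: the hyperbolic pairs with index at most k are
  already in place. At k = r the matrix is the identity.\<close>

definition fixes_pairs :: "nat \<Rightarrow> nat \<Rightarrow> complex mat \<Rightarrow> bool" where
  "fixes_pairs r k g \<longleftrightarrow> (\<forall>p<2*r. p < k \<or> 2 * r - k \<le> p \<longrightarrow> g *\<^sub>v unit_vec (2 * r) p = unit_vec (2 * r) p)"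

lemma fixes_pairsD:
  "fixes_pairs r k g \<Longrightarrow> p < 2 * r \<Longrightarrow> p < k \<or> 2 * r - k \<le> p \<Longrightarrow> g *\<^sub>v unit_vec (2 * r) p = unit_vec (2 * r) p"
  unfolding fixes_pairs_def by blast

lemma fixes_pairs_Suc:
  assumes "fixes_pairs r k g" "k < r"
    "g *\<^sub>v unit_vec (2 * r) k = unit_vec (2 * r) k"
    "g *\<^sub>v unit_vec (2 * r) (2 * r - 1 - k) = unit_vec (2 * r) (2 * r - 1 - k)"
  shows "fixes_pairs r (Suc k) g"
  unfolding fixes_pairs_def
proof (intro allI impI)
  fix p assume p: "p < 2 * r" "p < Suc k \<or> 2 * r - Suc k \<le> p"
  then consider "p = k" | "p = 2 * r - 1 - k" | "p < k \<or> 2 * r - k \<le> p"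
    by linarith
  then show "g *\<^sub>v unit_vec (2 * r) p = unit_vec (2 * r) p"
    using assms fixes_pairsD[OF assms(1) p(1)] by cases auto
qed

lemma omega_unit_unit:
  assumes "p < 2 * r" "q < 2 * r"
  shows "omega r (unit_vec (2 * r) p) (unit_vec (2 * r) q) = (if p + q + 1 = 2 * r then (- 1) ^ p else 0)"
  using assms by (subst omega_unit_left) auto

lemma level_group_cancel_left:
  assumes h: "h \<in> level_group r 0" and g: "g \<in> carrier (Sp r)" and hg: "h * g \<in> level_group r 0"
  shows "g \<in> level_group r 0"
proof -
  have "inv\<^bsub>Sp r\<^esub> h * (h * g) = inv\<^bsub>Sp r\<^esub> h * h * g"
    using Sp_assoc[OF level_group_in_Sp[OF level_group_inv[OF h]] level_group_in_Sp[OF h] g] by simp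
  also have "\<dots> = g"
    using Sp_inv_mult(1)[OF level_group_in_Sp[OF h]] Sp_carrier_mat[OF g] by simp
  finally show ?thesis using level_group_mult[OF level_group_inv[OF h] hg] by simp
qed

text \<open>
  The transvection along \<open>w - f\<close> that carries w to f fixes every vector with the same pairings with w and f,
  so the hyperbolic pairs of the standard basis can be straightened one after the other.
\<close>

lemma Sp_generated:
  assumes "0 < r" "g \<in> carrier (Sp r)"
  shows "g \<in> level_group r 0"
proof -
  let ?n = "2 * r" and ?e = "unit_vec (2 * r) :: nat \<Rightarrow> complex vec"
  have assoc: "(A * B) *\<^sub>v v = A *\<^sub>v (B *\<^sub>v v)"
    if "A \<in> carrier (Sp r)" "B \<in> carrier (Sp r)" "v \<in> carrier_vec ?n" for A B v
    using that by (auto dest!: Sp_carrier_mat)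
  have ec: "?e p \<in> carrier_vec ?n" for p by simp
  have vc: "A *\<^sub>v v \<in> carrier_vec ?n" if "A \<in> carrier (Sp r)" "v \<in> carrier_vec ?n" for A v
    using that by (auto dest!: Sp_carrier_mat)
  have tSp: "transv r v c \<in> carrier (Sp r)" if "v \<in> carrier_vec ?n" for v c
    using transv_in_level_group[OF that assms(1)] level_group_in_Sp by blast
  have tfix: "transv r v c *\<^sub>v u = u"
    if "v \<in> carrier_vec ?n" "u \<in> carrier_vec ?n" "omega r v u = 0" for v u c
    using that by (auto simp: transv_mult_vec)
  have main: "g \<in> level_group r 0" if "k \<le> r" "fixes_pairs r k g" "g \<in> carrier (Sp r)" for k g
    using that
  proof (induction k arbitrary: g rule: inc_induct)
    case base
    have "g = 1\<^sub>m ?n"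
      using Sp_carrier_mat[OF base.prems(2)] fixes_pairsD[OF base.prems(1)] by (intro mat_eq_on_vecI) (auto simp: linorder_class.not_less disj_imp)
    then show ?case by (simp add: level_group_one)
  next
    case (step k)
    have k: "k < r" "k < ?n" using step.hyps by auto
    let ?N = "2 * r - 1 - k"
    have N: "?N < ?n" "k + ?N + 1 = ?n" using k by auto
    \<comment> \<open>Here e_k is already fixed, and the image of its partner pairs nontrivially
      with that partner, so one transvection suffices.\<close>
    have nondeg: "g \<in> level_group r 0"
      if g: "g \<in> carrier (Sp r)" and fix_g: "fixes_pairs r k g" and gk: "g *\<^sub>v ?e k = ?e k"
        and nz: "omega r (g *\<^sub>v ?e ?N) (?e ?N) \<noteq> 0" for g
    proof -
      define w where "w = g *\<^sub>v ?e ?N"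
      \<comment> \<open>With f the partner \<open>?e ?N\<close>, \<omega>(w - f, w) = \<omega>(w,
        f), so this c makes the transvection subtract exactly w - f from w.\<close>
      define c where "c = - 1 / omega r w (?e ?N)"
      define T where "T = transv r (w - ?e ?N) c"
      have w: "w \<in> carrier_vec ?n" "w - ?e ?N \<in> carrier_vec ?n" using vc[OF g ec] by (auto simp: w_def)
      have T: "T \<in> level_group r 0" "T \<in> carrier (Sp r)"
        unfolding T_def using transv_in_level_group[OF w(2) assms(1)] tSp[OF w(2)] by auto
      have fix_T: "(T * g) *\<^sub>v ?e p = ?e p" if "g *\<^sub>v ?e p = ?e p" for p
      proof -
        have "omega r (w - ?e ?N) (?e p) = omega r w (?e p) - omega r (?e ?N) (?e p)"
          by (rule omega_diff_left[OF ec w(1) ec])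
        also have "omega r w (?e p) = omega r (?e ?N) (?e p)"
          using omega_Sp[OF g ec[of ?N] ec[of p]] by (simp only: w_def that)
        finally have "omega r (w - ?e ?N) (?e p) = 0" by simp
        then show ?thesis
          unfolding assoc[OF T(2) g ec] that unfolding T_def by (rule tfix[OF w(2) ec])
      qed
      have "omega r (w - ?e ?N) w = omega r w w - omega r (?e ?N) w"
        by (rule omega_diff_left[OF w(1) w(1) ec])
      also have "\<dots> = omega r w (?e ?N)"
        using omega_self[OF w(1)] omega_skew[OF ec w(1), of ?N] by simp
      finally have "c * omega r (w - ?e ?N) w = - 1"
        using nz by (simp add: c_def w_def)
      then have "T *\<^sub>v w = w + (- 1) \<cdot>\<^sub>v (w - ?e ?N)"
        unfolding T_def transv_mult_vec[OF w(2) w(1)] by (simp only:)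
      also have "\<dots> = ?e ?N" using w(1) by (intro eq_vecI) auto
      finally have "(T * g) *\<^sub>v ?e ?N = ?e ?N"
        unfolding assoc[OF T(2) g ec] w_def[symmetric] .
      moreover have "fixes_pairs r k (T * g)"
        unfolding fixes_pairs_def using fix_T fixes_pairsD[OF fix_g] by blast
      ultimately have "fixes_pairs r (Suc k) (T * g)"
        using fix_T[OF gk] k(1) by (intro fixes_pairs_Suc)
      then have "T * g \<in> level_group r 0" by (rule step.IH[OF _ Sp_mult_closed[OF T(2) g]])
      then show ?thesis by (rule level_group_cancel_left[OF T(1) g])
    qed
    have fixed: "g \<in> level_group r 0"
      if g: "g \<in> carrier (Sp r)" and fix_g: "fixes_pairs r k g" and gk: "g *\<^sub>v ?e k = ?e k" for g
    proof (cases "omega r (g *\<^sub>v ?e ?N) (?e ?N) = 0")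
      case True
      define w where "w = g *\<^sub>v ?e ?N"
      have w: "w \<in> carrier_vec ?n" using vc[OF g ec] by (simp add: w_def)
      \<comment> \<open>If w and the partner are orthogonal, adding e_k to w makes their pairing
        equal to s. The transvection along e_k with factor 1 / s does this and fixes e_k and the
        earlier pairs.\<close>
      define s where "s = omega r (?e k) (?e ?N)"
      have s: "s \<noteq> 0" using omega_unit_unit[OF k(2) N(1)] N(2) by (simp add: s_def)
      define T where "T = transv r (?e k) (1 / s)"
      have T: "T \<in> level_group r 0" "T \<in> carrier (Sp r)"
        unfolding T_def using transv_in_level_group[OF ec assms(1)] tSp[OF ec] by auto
      have fix_T: "(T * g) *\<^sub>v ?e p = ?e p" if "g *\<^sub>v ?e p = ?e p" "p < ?n" "p \<noteq> ?N" for p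
      proof -
        have "k + p + 1 \<noteq> ?n" using that(3) by auto
        then have "omega r (?e k) (?e p) = 0" using omega_unit_unit[OF k(2) that(2)] by simp
        then show ?thesis
          unfolding assoc[OF T(2) g ec] that(1) unfolding T_def by (rule tfix[OF ec ec])
      qed
      have "omega r (?e k) w = s"
        using omega_Sp[OF g ec[of k] ec[of ?N]] by (simp only: w_def gk s_def)
      then have "T *\<^sub>v w = w + (1 / s * s) \<cdot>\<^sub>v ?e k"
        unfolding T_def transv_mult_vec[OF ec w] by (simp only:)
      also have "\<dots> = w + ?e k" using s by simp
      finally have Tg: "(T * g) *\<^sub>v ?e ?N = w + ?e k"
        unfolding assoc[OF T(2) g ec] w_def[symmetric] .
      have "omega r (w + ?e k) (?e ?N) = omega r w (?e ?N) + s"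
        unfolding s_def by (rule omega_add_left[OF ec w ec])
      also have "\<dots> \<noteq> 0" using True s by (simp add: w_def)
      finally have nz: "omega r ((T * g) *\<^sub>v ?e ?N) (?e ?N) \<noteq> 0" unfolding Tg .
      have "fixes_pairs r k (T * g)"
        unfolding fixes_pairs_def
      proof (intro allI impI)
        fix p assume p: "p < ?n" "p < k \<or> ?n - k \<le> p"
        then have "p \<noteq> ?N" using k by auto
        then show "(T * g) *\<^sub>v ?e p = ?e p" by (intro fix_T fixes_pairsD[OF fix_g] p)
      qed
      moreover have "k \<noteq> ?N" using k by auto
      ultimately have "T * g \<in> level_group r 0"
        using nz by (intro nondeg Sp_mult_closed[OF T(2) g] fix_T[OF gk k(2)])
      then show ?thesis by (rule level_group_cancel_left[OF T(1) g])
    qed (use nondeg[OF g fix_g gk] in simp)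
    \<comment> \<open>General case: v is orthogonal to the pairs already fixed, hence supported at
      level k, and transitivity of \<open>level_group r k\<close> moves it back to e_k without
      disturbing those pairs.\<close>
    define v where "v = g *\<^sub>v ?e k"
    note g = step.prems(2) and fix_g = step.prems(1)
    have v: "v \<in> carrier_vec ?n" using vc[OF g ec] by (simp add: v_def)
    have "supported r k v"
      unfolding supported_def
    proof (intro conjI v allI impI)
      fix p assume p: "p < ?n" "p < k \<or> ?n - k \<le> p"
      \<comment> \<open>The pairing with the basis vector at the opposite position q reads off
        coordinate p of v up to sign.\<close>
      define q where "q = ?n - 1 - p"
      have q: "q < ?n" "q < k \<or> ?n - k \<le> q" "?n - 1 - q = p" "q + k + 1 \<noteq> ?n" using p k by (auto simp: q_def)
      have "(- 1) ^ q * v $ p = omega r (?e q) v"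
        using omega_unit_left[OF v q(1)] q(3) by simp
      also have "\<dots> = omega r (g *\<^sub>v ?e q) (g *\<^sub>v ?e k)"
        by (simp only: v_def fixes_pairsD[OF fix_g q(1,2)])
      also have "\<dots> = 0"
        unfolding omega_Sp[OF g ec ec] omega_unit_unit[OF q(1) k(2)] using q(4) by simp
      finally show "v $ p = 0" by simp
    qed
    moreover have "v \<noteq> 0\<^sub>v ?n"
    proof
      assume v0: "v = 0\<^sub>v ?n"
      have "?e k = (inv\<^bsub>Sp r\<^esub> g * g) *\<^sub>v ?e k"
        unfolding Sp_inv_mult(1)[OF g] by simp
      also have "\<dots> = inv\<^bsub>Sp r\<^esub> g *\<^sub>v 0\<^sub>v ?n"
        using assoc[OF Sp.inv_closed[OF g] g ec, of k] v0 by (simp add: v_def)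
      also have "\<dots> = 0\<^sub>v ?n"
        using Sp_carrier_mat[OF Sp.inv_closed[OF g]] by (intro eq_vecI) auto
      finally have "?e k $ k = 0\<^sub>v ?n $ k" by (rule arg_cong)
      then show False using k by simp
    qed
    ultimately obtain h where h: "h \<in> level_group r k" "h *\<^sub>v v = ?e k"
      using reach_unit[OF k(1)] unfolding reach_def by blast
    have h0: "h \<in> level_group r 0" using h(1) level_group_mono[of 0 k r] by auto
    note hS = level_group_in_Sp[OF h0]
    have "fixes_pairs r k (h * g)"
      unfolding fixes_pairs_def
    proof (intro allI impI)
      fix p assume p: "p < ?n" "p < k \<or> ?n - k \<le> p"
      have "h *\<^sub>v ?e p = ?e p" using p by (intro level_group_fix[OF h(1) ec]) auto
      then show "(h * g) *\<^sub>v ?e p = ?e p"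
        unfolding assoc[OF hS g ec] fixes_pairsD[OF fix_g p] .
    qed
    moreover have "(h * g) *\<^sub>v ?e k = ?e k"
      unfolding assoc[OF hS g ec] using h(2) by (simp only: v_def)
    ultimately have "h * g \<in> level_group r 0" by (intro fixed Sp_mult_closed[OF hS g])
    then show ?case by (rule level_group_cancel_left[OF h0 g])
  qed
  have "fixes_pairs r 0 g" by (simp add: fixes_pairs_def)
  then show ?thesis using main[of 0 g] assms(2) by simp
qed

section \<open>Density of the big cell\<close>

text \<open>The factor is the inverse of the simple root \<alpha>_i evaluated at the torus element.
  The second pair of positions gives the same factor, since opposite diagonal entries are inverse to
  each other.\<close>

lemma x_sub_torus_commute:
  assumes i: "i \<in> {1..r}" and d: "symplectic_diag r d"
  shows "x_sub r i t * diag_elt r d = diag_elt r d * x_sub r i (t * (d i / d (i - 1)))"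
proof (rule eq_matI)
  fix p q assume "p < dim_row (diag_elt r d * x_sub r i (t * (d i / d (i - 1))))"
    "q < dim_col (diag_elt r d * x_sub r i (t * (d i / d (i - 1))))"
  then have pq: "p < 2 * r" "q < 2 * r" using i by auto
  note c = x_sub_carrier_mat[OF i]
  have i': "i < 2 * r" "i - 1 < 2 * r" "2 * r - 1 - (i - 1) = 2 * r - i" "2 * r - 1 - i + 1 = 2 * r - i" "i - 1 + 1 = i"
    using i by auto
  have nz: "d i \<noteq> 0" "d (i - 1) \<noteq> 0" using symplectic_diag_nonzero[OF d] i' by auto
  have "d (i - 1) * d (2 * r - i) = 1" "d i * d (2 * r - 1 - i) = 1"
    using d i' unfolding symplectic_diag_def by metis+
  then have opp: "d (2 * r - i) = 1 / d (i - 1)" "d (2 * r - 1 - i) = 1 / d i"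
    using nz by (auto simp: field_simps)
  define P where "P \<longleftrightarrow> p = i - 1 \<or> p = 2 * r - 1 - i"
  define e where "e = t * (d i / d (i - 1))"
  have "t * d (p + 1) = d p * (t * (d i / d (i - 1)))" if "p = i - 1 \<or> p = 2 * r - 1 - i"
    using that
  proof
    assume "p = i - 1"
    then show ?thesis using i' nz by simp
  next
    assume p: "p = 2 * r - 1 - i"
    show ?thesis unfolding p i'(4) opp using nz by simp
  qed
  then have P: "t * d (p + 1) = d p * e" if P using that unfolding P_def e_def .
  show "(x_sub r i t * diag_elt r d) $$ (p, q) = (diag_elt r d * x_sub r i (t * (d i / d (i - 1)))) $$ (p, q)"
    unfolding diag_elt_mult_left[OF c pq] diag_elt_mult_right[OF c pq] x_sub_index[OF i pq] P_def[symmetric] e_def[symmetric]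
    using P by auto
qed (use i in auto)

text \<open>Distinct simple roots act on disjoint sets of adjacent position pairs in the sense of
  \<open>disj\<close>; this is the relation [e_i, f_j] = 0.\<close>

lemma x_sub_y_sub_commute:
  assumes i: "i \<in> {1..r}" and j: "j \<in> {1..r}" and ij: "i \<noteq> j"
  shows "x_sub r i t * y_sub r j s = y_sub r j s * x_sub r i t"
proof (rule eq_matI)
  note cx = x_sub_carrier_mat[OF i] and cy = y_sub_carrier_mat[OF j]
  fix p q assume "p < dim_row (y_sub r j s * x_sub r i t)" "q < dim_col (y_sub r j s * x_sub r i t)"
  then have pq: "p < 2 * r" "q < 2 * r" using i cy[of s] by auto
  define S where "S i p \<longleftrightarrow> p = i - 1 \<or> p = 2 * r - 1 - i" for i p
  have disj: "\<not> (S i p \<and> S j p)" for p using i j ij by (auto simp: S_def)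
  have lt: "p + 1 < 2 * r" if "S i p" using that i by (auto simp: S_def)
  have Sj: "p = j \<or> p = 2 * r - j \<longleftrightarrow> 0 < p \<and> S j (p - 1)"
  proof (cases p)
    case 0
    then show ?thesis using j by auto
  next
    case (Suc p')
    have "Suc p' = j \<longleftrightarrow> p' = j - 1" "Suc p' = 2 * r - j \<longleftrightarrow> p' = 2 * r - 1 - j" using j by auto
    then show ?thesis using Suc by (simp add: S_def)
  qed
  have x: "x_sub r i t $$ (a, b) = (if a = b then 1 else if b = a + 1 \<and> S i a then t else 0)"
    if "a < 2 * r" "b < 2 * r" for a b
    using x_sub_index[OF i that] by (simp only: S_def)
  have y: "y_sub r j s $$ (a, b) = (if a = b then 1 else if a = b + 1 \<and> S j b then s else 0)"
    if "a < 2 * r" "b < 2 * r" for a b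
    using y_sub_index[OF j that] by (simp only: S_def)
  have "y_sub r j s $$ (p, q) + (if S i p then t * y_sub r j s $$ (p + 1, q) else 0) =
      (if p = q then 1 else 0) + (if p = q + 1 \<and> S j q then s else 0) + (if q = p + 1 \<and> S i p then t else 0)"
    using y[OF pq] y[OF lt pq(2)] disj[of p] by (cases "S i p") (auto split: if_splits)
  moreover have "x_sub r i t $$ (p, q) + (if 0 < p \<and> S j (p - 1) then s * x_sub r i t $$ (p - 1, q) else 0) =
      (if p = q then 1 else 0) + (if p = q + 1 \<and> S j q then s else 0) + (if q = p + 1 \<and> S i p then t else 0)"
  proof (cases p)
    case 0
    then show ?thesis using x[OF pq] by simp
  next
    case (Suc p')
    then have "p' < 2 * r" using pq by simp
    then show ?thesis using x[OF pq] x[of p' q] pq Suc disj[of p'] by (auto split: if_splits)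
  qed
  ultimately show "(x_sub r i t * y_sub r j s) $$ (p, q) = (y_sub r j s * x_sub r i t) $$ (p, q)"
    unfolding x_sub_mult_index[OF i cy pq] y_sub_mult_index[OF j cx pq] Sj S_def[symmetric] by simp
qed (use i carrier_matD[OF y_sub_carrier_mat[OF j]] in auto)

text \<open>The Gauss decomposition in the rank one subgroup of index \<open>i\<close>.\<close>

lemma x_sub_y_sub_gauss:
  assumes i: "i \<in> {1..r}" and u: "1 + t * s \<noteq> 0"
  shows "\<exists>h\<in>torus r. x_sub r i t * y_sub r i s = y_sub r i (s / (1 + t * s)) * (h * x_sub r i (t / (1 + t * s)))"
proof
  define u where "u = 1 + t * s"
  have unz: "u \<noteq> 0" using u by (simp add: u_def)
  define S where "S p \<longleftrightarrow> p = i - 1 \<or> p = 2 * r - 1 - i" for p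
  define S' where "S' p \<longleftrightarrow> p = i \<or> p = 2 * r - i" for p
  \<comment> \<open>On each pair of positions p, p + 1 with \<open>S p\<close> the product is the 2
    by 2 matrix with rows (1 + ts, t) and (s, 1), whose diagonal Gauss factor is u, 1 / u.\<close>
  define d where "d p = (if S p then u else if S' p then 1 / u else 1)" for p
  have SS: "\<not> (S p \<and> S' p)" for p
    using i[unfolded atLeastAtMost_iff] unfolding S_def S'_def by presburger
  have "d p * d (2 * r - 1 - p) = 1" if p: "p < 2 * r" for p
  proof -
    have "2 * r - 1 - p = i - 1 \<longleftrightarrow> p = 2 * r - i" "2 * r - 1 - p = 2 * r - 1 - i \<longleftrightarrow> p = i"
      "2 * r - 1 - p = i \<longleftrightarrow> p = 2 * r - 1 - i" "2 * r - 1 - p = 2 * r - i \<longleftrightarrow> p = i - 1"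
      using i p by auto
    then have "S (2 * r - 1 - p) \<longleftrightarrow> S' p" "S' (2 * r - 1 - p) \<longleftrightarrow> S p"
      unfolding S_def S'_def by blast+
    then show ?thesis unfolding d_def using SS[of p] unz by auto
  qed
  then have h: "diag_elt r d \<in> torus r" unfolding torus_eq symplectic_diag_def by blast
  have "x_sub r i t * y_sub r i s = y_sub r i (s / u) * (diag_elt r d * x_sub r i (t / u))"
  proof (rule eq_matI)
    note cx = x_sub_carrier_mat[OF i] and cy = y_sub_carrier_mat[OF i]
    let ?M = "diag_elt r d * x_sub r i (t / u)"
    have cM: "?M \<in> carrier_mat (2 * r) (2 * r)" using cx by (intro mult_carrier_mat[of _ _ "2 * r"]) auto
    fix p q assume "p < dim_row (y_sub r i (s / u) * ?M)" "q < dim_col (y_sub r i (s / u) * ?M)"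
    then have pq: "p < 2 * r" "q < 2 * r" using i cy[of "s / u"] by auto
    have lt: "p + 1 < 2 * r" if "S p" using that i by (auto simp: S_def)
    have S': "S' (p + 1) \<longleftrightarrow> S p" "\<not> S' 0" for p using i by (auto simp: S_def S'_def)
    have x: "x_sub r i t' $$ (a, b) = (if a = b then 1 else if b = a + 1 \<and> S a then t' else 0)"
      if "a < 2 * r" "b < 2 * r" for a b t'
      using x_sub_index[OF i that] by (simp only: S_def)
    have y: "y_sub r i s $$ (a, b) = (if a = b then 1 else if a = b + 1 \<and> S b then s else 0)"
      if "a < 2 * r" "b < 2 * r" for a b
      using y_sub_index[OF i that] by (simp only: S_def)
    have M: "?M $$ (a, b) = d a * (if a = b then 1 else if b = a + 1 \<and> S a then t / u else 0)"
      if "a < 2 * r" "b < 2 * r" for a b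
      using diag_elt_mult_left[OF cx that] x[OF that] by simp
    have ust: "1 / u + s / u * t = 1" using unz by (simp add: field_simps) (simp add: u_def)
    have "y_sub r i s $$ (p, q) + (if S p then t * y_sub r i s $$ (p + 1, q) else 0) =
       ?M $$ (p, q) + (if S' p then s / u * ?M $$ (p - 1, q) else 0)"
    proof (cases "S p")
      case True
      have np: "\<not> S' p" using SS True by blast
      then have nq: "\<not> (p = q + 1 \<and> S q)" using S'(1)[of q] by auto
      have ut: "1 + t * s = u" "u * (t / u) = t" using unz by (simp_all add: u_def)
      consider "q = p" | "q = p + 1" | "q \<noteq> p" "q \<noteq> p + 1" by blast
      then show ?thesis
        unfolding y[OF pq] M[OF pq] y[OF lt[OF True] pq(2)] d_def
        by cases (use True np nq ut in auto)
    next
      case nS: False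
      show ?thesis
      proof (cases "S' p")
        case True
        then obtain p' where p': "p = Suc p'" using S'(2) by (cases p) auto
        then have Sp': "S p'" "p' < 2 * r" using True S'(1)[of p'] pq by auto
        have np': "\<not> S' p'" using SS Sp'(1) by blast
        have Mp: "?M $$ (p - 1, q) = u * (if p' = q then 1 else if q = p then t / u else 0)"
          using M[OF Sp'(2) pq(2)] p' Sp'(1) by (simp add: d_def)
        have us: "s / u * u = s" "s / u * (u * (t / u)) = s / u * t" using unz by simp_all
        have yq: "p = q + 1 \<and> S q \<longleftrightarrow> q = p'" using p' Sp' by auto
        have pp': "p \<noteq> p'" using p' by simp
        consider "q = p" | "q = p'" | "q \<noteq> p" "q \<noteq> p'" by blast
        then show ?thesis
          unfolding y[OF pq] M[OF pq] Mp yq d_def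
          by cases (use True nS us ust pp' in auto)
      next
        case False
        then have "\<not> (p = q + 1 \<and> S q)" using S'(1)[of q] by auto
        then show ?thesis
          unfolding y[OF pq] M[OF pq] d_def using nS False by auto
      qed
    qed
    then show "(x_sub r i t * y_sub r i s) $$ (p, q) = (y_sub r i (s / u) * ?M) $$ (p, q)"
      unfolding x_sub_mult_index[OF i cy pq] y_sub_mult_index[OF i cM pq] S_def S'_def .
  qed (use i carrier_matD[OF y_sub_carrier_mat[OF i]] in auto)
  then show "x_sub r i t * y_sub r i s = y_sub r i (s / (1 + t * s)) * (diag_elt r d * x_sub r i (t / (1 + t * s)))"
    by (simp only: u_def)
  show "diag_elt r d \<in> torus r" by (rule h)
qed

text \<open>Pushing x_i(t) to the right through a factor of B_- only reparametrizes it: a scaling at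
  torus elements, no change at y_j with j different from i, and t / (1 + ts) at y_i(s). The last
  exists only near t = 0, hence the neighbourhood filter; \<theta> must tend to 0 so that these
  changes can be composed.\<close>

lemma x_sub_borel_neg:
  assumes i: "i \<in> {1..r}" and A: "A \<in> borel r False"
  shows "\<exists>\<theta>. filterlim \<theta> (nhds 0) (nhds 0) \<and>
     (\<forall>\<^sub>F t in nhds 0. \<exists>A'\<in>borel r False. x_sub r i t * A = A' * x_sub r i (\<theta> t))"
  using A
proof (induction rule: borel_induct)
  case (torus h)
  then obtain d where d: "symplectic_diag r d" "h = diag_elt r d" by (auto simp: torus_eq)
  have "filterlim (\<lambda>t. t * (d i / d (i - 1))) (nhds (0 * (d i / d (i - 1)))) (nhds 0)"
    by (intro tendsto_intros filterlim_ident)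
  moreover have "h \<in> borel r False" using torus torus_subset_borel by blast
  moreover from this have "\<forall>\<^sub>F t in nhds 0. \<exists>A'\<in>borel r False. x_sub r i t * h = A' * x_sub r i (t * (d i / d (i - 1)))"
    using x_sub_torus_commute[OF i d(1)] unfolding d(2) by (intro always_eventually allI bexI)
  ultimately show ?case
    by (intro exI[of _ "\<lambda>t. t * (d i / d (i - 1))"]) simp
next
  case (root j s)
  have yb: "y_sub r j s' \<in> borel r False" for s' using root_sub_in_borel[OF root, of False s'] by (simp add: root_sub_def)
  show ?case
  proof (cases "i = j")
    case False
    have "filterlim (\<lambda>t :: complex. t) (nhds 0) (nhds 0)" by (rule filterlim_ident)
    moreover have "\<forall>\<^sub>F t in nhds 0. \<exists>A'\<in>borel r False. x_sub r i t * root_sub r False j s = A' * x_sub r i t"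
      using x_sub_y_sub_commute[OF i root False] yb
      by (intro always_eventually allI bexI[of _ "y_sub r j s"]) (simp_all add: root_sub_def)
    ultimately show ?thesis by (intro exI[of _ "\<lambda>t. t"]) simp
  next
    case True
    have lim: "((\<lambda>t. 1 + t * s) \<longlongrightarrow> 1 + 0 * s) (nhds (0 :: complex))" by (intro tendsto_intros filterlim_ident)
    then have "\<forall>\<^sub>F t in nhds 0. 1 + t * s \<noteq> 0" by (rule tendsto_imp_eventually_ne) simp
    then have "\<forall>\<^sub>F t in nhds 0. \<exists>A'\<in>borel r False. x_sub r i t * root_sub r False j s = A' * x_sub r i (t / (1 + t * s))"
    proof eventually_elim
      case (elim t)
      obtain h where h: "h \<in> torus r"
        "x_sub r i t * y_sub r i s = y_sub r i (s / (1 + t * s)) * (h * x_sub r i (t / (1 + t * s)))"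
        using x_sub_y_sub_gauss[OF i elim] by blast
      have "h \<in> borel r False" using h(1) torus_subset_borel by blast
      then have "y_sub r i (s / (1 + t * s)) * h \<in> borel r False" using yb True by (intro borel_mult) auto
      moreover have "y_sub r i (s / (1 + t * s)) * (h * x_sub r i (t / (1 + t * s))) =
          y_sub r i (s / (1 + t * s)) * h * x_sub r i (t / (1 + t * s))"
      proof -
        have "h \<in> carrier (Sp r)" using h(1) torus_subset_Sp by blast
        then show ?thesis using Sp_assoc[OF y_sub_in_Sp[OF i] _ x_sub_in_Sp[OF i], of h] by simp
      qed
      ultimately show ?case using h(2) True by (auto simp: root_sub_def)
    qed
    moreover have "((\<lambda>t. t / (1 + t * s)) \<longlongrightarrow> 0 / (1 + 0 * s)) (nhds (0 :: complex))"
      by (intro tendsto_intros filterlim_ident) auto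
    ultimately show ?thesis by (intro exI[of _ "\<lambda>t. t / (1 + t * s)"]) auto
  qed
next
  case (mult A B)
  from mult.IH(1) obtain \<theta> where \<theta>: "filterlim \<theta> (nhds 0) (nhds 0)"
     "\<forall>\<^sub>F t in nhds 0. \<exists>A'\<in>borel r False. x_sub r i t * A = A' * x_sub r i (\<theta> t)" by (elim exE conjE)
  from mult.IH(2) obtain \<eta> where \<eta>: "filterlim \<eta> (nhds 0) (nhds 0)"
     "\<forall>\<^sub>F t in nhds 0. \<exists>A'\<in>borel r False. x_sub r i t * B = A' * x_sub r i (\<eta> t)" by (elim exE conjE)
  have "\<forall>\<^sub>F t in nhds 0. \<exists>A'\<in>borel r False. x_sub r i (\<theta> t) * B = A' * x_sub r i (\<eta> (\<theta> t))"
    by (rule eventually_compose_filterlim[OF \<eta>(2) \<theta>(1)])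
  with \<theta>(2) have "\<forall>\<^sub>F t in nhds 0. \<exists>A'\<in>borel r False. x_sub r i t * (A * B) = A' * x_sub r i (\<eta> (\<theta> t))"
  proof eventually_elim
    case (elim t)
    obtain A' where A': "A' \<in> borel r False" "x_sub r i t * A = A' * x_sub r i (\<theta> t)" using elim(1) by blast
    obtain B' where B': "B' \<in> borel r False" "x_sub r i (\<theta> t) * B = B' * x_sub r i (\<eta> (\<theta> t))" using elim(2) by blast
    note S = mult.hyps[THEN borel_in_Sp] A'(1)[THEN borel_in_Sp] B'(1)[THEN borel_in_Sp] x_sub_in_Sp[OF i]
    have "x_sub r i t * (A * B) = x_sub r i t * A * B" using Sp_assoc[OF S(5) S(1,2)] by simp
    also have "\<dots> = A' * (x_sub r i (\<theta> t) * B)" using Sp_assoc[OF S(3,5,2)] A'(2) by simp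
    also have "\<dots> = A' * B' * x_sub r i (\<eta> (\<theta> t))" using Sp_assoc[OF S(3,4,5)] B'(2) by simp
    finally show ?case using borel_mult[OF A'(1) B'(1)] by blast
  qed
  moreover have "filterlim (\<lambda>t. \<eta> (\<theta> t)) (nhds 0) (nhds 0)"
    by (rule filterlim_compose[OF \<eta>(1) \<theta>(1)])
  ultimately show ?case by blast
qed

lemma poly_fun_sum:
  "finite I \<Longrightarrow> (\<And>i. i \<in> I \<Longrightarrow> f i \<in> poly_fun n) \<Longrightarrow> (\<lambda>A. \<Sum>i\<in>I. f i A) \<in> poly_fun n"
proof (induction I rule: finite_induct)
  case empty
  show ?case using poly_fun.const[of 0 n] by simp
next
  case (insert i I)
  then show ?case using poly_fun.add[of "f i" n "\<lambda>A. \<Sum>i\<in>I. f i A"] by simp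
qed

lemma poly_fun_prod:
  "finite I \<Longrightarrow> (\<And>i. i \<in> I \<Longrightarrow> f i \<in> poly_fun n) \<Longrightarrow> (\<lambda>A. \<Prod>i\<in>I. f i A) \<in> poly_fun n"
proof (induction I rule: finite_induct)
  case empty
  show ?case using poly_fun.const[of 1 n] by simp
next
  case (insert i I)
  then show ?case using poly_fun.mult[of "f i" n "\<lambda>A. \<Prod>i\<in>I. f i A"] by simp
qed

text \<open>Left translation preserves polynomial functions. Agreement is claimed on matrices of the
  right size, where the entry formula for a product is valid.\<close>

lemma poly_fun_mult_left:
  assumes "p \<in> poly_fun n" and B: "B \<in> carrier_mat n n"
  shows "\<exists>q\<in>poly_fun n. \<forall>A\<in>carrier_mat n n. q A = p (B * A)"
  using assms(1)
proof induction
  case (const c)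
  show ?case by (intro bexI[of _ "\<lambda>_. c"]) (auto intro: poly_fun.const)
next
  case (entry i j)
  have "(\<lambda>A. \<Sum>k\<in>{..<n}. B $$ (i, k) * A $$ (k, j)) \<in> poly_fun n"
    using entry by (intro poly_fun_sum poly_fun.mult poly_fun.const poly_fun.entry) auto
  moreover have "\<forall>A\<in>carrier_mat n n. (\<Sum>k\<in>{..<n}. B $$ (i, k) * A $$ (k, j)) = (B * A) $$ (i, j)"
    using mat_mult_index[OF B _ entry] by simp
  ultimately show ?case by (intro bexI)
next
  case (add p q)
  from add.IH(1) obtain p' where p': "p' \<in> poly_fun n" "\<forall>A\<in>carrier_mat n n. p' A = p (B * A)" by (elim bexE)
  from add.IH(2) obtain q' where q': "q' \<in> poly_fun n" "\<forall>A\<in>carrier_mat n n. q' A = q (B * A)" by (elim bexE)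
  show ?case using p' q' by (intro bexI[of _ "\<lambda>A. p' A + q' A"]) (auto intro: poly_fun.add)
next
  case (mult p q)
  from mult.IH(1) obtain p' where p': "p' \<in> poly_fun n" "\<forall>A\<in>carrier_mat n n. p' A = p (B * A)" by (elim bexE)
  from mult.IH(2) obtain q' where q': "q' \<in> poly_fun n" "\<forall>A\<in>carrier_mat n n. q' A = q (B * A)" by (elim bexE)
  show ?case using p' q' by (intro bexI[of _ "\<lambda>A. p' A * q' A"]) (auto intro: poly_fun.mult)
qed

lemma G0_in_Sp: "A \<in> G0 r \<Longrightarrow> A \<in> carrier (Sp r)"
  by (auto simp: G0_eq dest!: borel_in_Sp)

text \<open>For t near 0 the element x_i(t) moves past the lower factor of B and is absorbed by the
  upper one, so x_i(t) B stays in the big cell. The one-variable polynomial t -> p (x_i(t) B) thus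
  vanishes near 0 and so for all t.\<close>

lemma x_sub_G0_vanish:
  assumes i: "i \<in> {1..r}" and p: "p \<in> poly_fun (2 * r)" "\<forall>B\<in>G0 r. p B = 0" and B: "B \<in> G0 r"
  shows "p (x_sub r i t * B) = 0"
proof -
  obtain b c where bc: "b \<in> borel r False" "c \<in> borel r True" "B = b * c" using B by (auto simp: G0_eq)
  have "poly_path (2 * r) (\<lambda>s. root_sub r True i (s * 1))" by (rule root_sub_path[OF i])
  then have "poly_path (2 * r) (\<lambda>s. x_sub r i s * B)"
    by (intro poly_path_mult poly_path_const x_sub_carrier_mat[OF i] Sp_carrier_mat[OF G0_in_Sp[OF B]])
      (simp add: root_sub_def)
  from poly_fun_path[OF p(1) this] obtain P where P: "\<forall>s. p (x_sub r i s * B) = poly P s" by (elim exE)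
  obtain \<theta> where \<theta>: "\<forall>\<^sub>F t in nhds 0. \<exists>A'\<in>borel r False. x_sub r i t * b = A' * x_sub r i (\<theta> t)"
    using x_sub_borel_neg[OF i bc(1)] by blast
  then have "\<forall>\<^sub>F t in nhds 0. poly P t = 0"
  proof eventually_elim
    case (elim t)
    then obtain A' where A': "A' \<in> borel r False" "x_sub r i t * b = A' * x_sub r i (\<theta> t)" by blast
    have "x_sub r i t * B = x_sub r i t * b * c"
      using Sp_assoc[OF x_sub_in_Sp[OF i] bc(1)[THEN borel_in_Sp] bc(2)[THEN borel_in_Sp]] bc(3) by simp
    also have "\<dots> = A' * (x_sub r i (\<theta> t) * c)"
      using Sp_assoc[OF A'(1)[THEN borel_in_Sp] x_sub_in_Sp[OF i] bc(2)[THEN borel_in_Sp]] A'(2) by simp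
    also have "\<dots> \<in> G0 r"
    proof -
      have "x_sub r i (\<theta> t) * c \<in> borel r True"
        using borel_mult[OF root_sub_in_borel[OF i, of True "\<theta> t"] bc(2)] by (simp add: root_sub_def)
      then show ?thesis using A'(1) unfolding G0_eq by blast
    qed
    finally have "p (x_sub r i t * B) = 0" using p(2) by blast
    then show ?case using P by metis
  qed
  then obtain e where e: "e > 0" "\<And>t. dist t 0 < e \<Longrightarrow> poly P t = 0"
    unfolding eventually_nhds_metric by blast
  have "P = 0"
  proof (rule ccontr)
    assume "P \<noteq> 0"
    then have "finite {t. poly P t = 0}" by (rule poly_roots_finite)
    \<comment> \<open>A real interval inside the disc already gives infinitely many roots.\<close>
    moreover have "complex_of_real ` {0<..<e} \<subseteq> {t. poly P t = 0}" using e(2) by auto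
    ultimately have "finite (complex_of_real ` {0<..<e})" using finite_subset by blast
    then have "finite {0<..<e}" by (rule finite_imageD) (simp add: inj_on_def)
    then show False using e(1) infinite_Ioo by blast
  qed
  then show ?thesis using P by simp
qed

lemma G0_dense:
  assumes r: "0 < r" and p: "p \<in> poly_fun (2 * r)" "\<forall>B\<in>G0 r. p B = 0" and A: "A \<in> carrier (Sp r)"
  shows "p A = 0"
proof -
  \<comment> \<open>The Zariski closure of the big cell within the group, described through
    vanishing polynomials.\<close>
  define C where "C = {A \<in> carrier (Sp r). \<forall>p\<in>poly_fun (2 * r). (\<forall>B\<in>G0 r. p B = 0) \<longrightarrow> p A = 0}"
  have stable: "g * A \<in> C" if A: "A \<in> C" and g: "g \<in> carrier (Sp r)"
    and van: "\<And>p B. p \<in> poly_fun (2 * r) \<Longrightarrow> \<forall>B\<in>G0 r. p B = 0 \<Longrightarrow> B \<in> G0 r \<Longrightarrow> p (g * B) = 0" for A g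
  proof -
    have AS: "A \<in> carrier (Sp r)" using A by (simp add: C_def)
    have "p (g * A) = 0" if p: "p \<in> poly_fun (2 * r)" "\<forall>B\<in>G0 r. p B = 0" for p
    proof -
      obtain q where q: "q \<in> poly_fun (2 * r)" "\<forall>A\<in>carrier_mat (2 * r) (2 * r). q A = p (g * A)"
        using poly_fun_mult_left[OF p(1) Sp_carrier_mat[OF g]] by blast
      have "\<forall>B\<in>G0 r. q B = 0" using q(2) van[OF p] Sp_carrier_mat[OF G0_in_Sp] by auto
      then have "q A = 0" using A q(1) by (simp add: C_def)
      then show ?thesis using q(2) Sp_carrier_mat[OF AS] by simp
    qed
    then show ?thesis using Sp_mult_closed[OF g AS] by (simp add: C_def)
  qed
  have root: "root_sub r b i t * A \<in> C" if A: "A \<in> C" and i: "i \<in> {1..r}" for b i t A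
  proof (rule stable[OF A root_sub_in_Sp[OF i]])
    fix p B assume p: "p \<in> poly_fun (2 * r)" "\<forall>B\<in>G0 r. p B = 0" and B: "B \<in> G0 r"
    show "p (root_sub r b i t * B) = 0"
    proof (cases b)
      case True
      then show ?thesis using x_sub_G0_vanish[OF i p B] by (simp add: root_sub_def)
    next
      case False
      obtain y z where yz: "y \<in> borel r False" "z \<in> borel r True" "B = y * z" using B by (auto simp: G0_eq)
      have "root_sub r False i t * B = root_sub r False i t * y * z"
        using Sp_assoc[OF root_sub_in_Sp[OF i] yz(1)[THEN borel_in_Sp] yz(2)[THEN borel_in_Sp]] yz(3) by simp
      moreover have "root_sub r False i t * y \<in> borel r False"
        by (intro borel_mult root_sub_in_borel i yz(1))
      ultimately have "root_sub r False i t * B \<in> G0 r" using yz(2) unfolding G0_eq by blast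
      then show ?thesis using p(2) False by simp
    qed
  qed
  have "\<forall>B\<in>C. g * B \<in> C" if "g \<in> level_group r 0" for g
    using that
  proof (induction rule: level_group_induct)
    case one
    have "1\<^sub>m (2 * r) * B = B" if "B \<in> C" for B
      using that Sp_carrier_mat[of B r] by (simp add: C_def)
    then show ?case by simp
  next
    case (root b i t)
    then have "i \<in> {1..r}" by simp
    then show ?case using \<open>\<And>t i b A. A \<in> C \<Longrightarrow> i \<in> {1..r} \<Longrightarrow> root_sub r b i t * A \<in> C\<close> by blast
  next
    case (mult X Y)
    show ?case
    proof
      fix B assume B: "B \<in> C"
      then have "X * (Y * B) \<in> C" using mult.IH by blast
      moreover have "X * (Y * B) = X * Y * B"
        using B Sp_assoc[OF level_group_in_Sp[OF mult.hyps(1)] level_group_in_Sp[OF mult.hyps(2)], of B] by (simp add: C_def)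
      ultimately show "X * Y * B \<in> C" by simp
    qed
  qed
  moreover have "1\<^sub>m (2 * r) \<in> C"
  proof -
    have "1\<^sub>m (2 * r) \<in> borel r b" for b using subgroup.one_closed[OF subgroup_borel] by simp
    then have "1\<^sub>m (2 * r) * 1\<^sub>m (2 * r) \<in> G0 r" unfolding G0_eq by blast
    then show ?thesis using G0_in_Sp by (auto simp: C_def)
  qed
  ultimately have "A * 1\<^sub>m (2 * r) \<in> C" using Sp_generated[OF r A] by blast
  then show ?thesis using p Sp_carrier_mat[OF A] by (simp add: C_def)
qed

section \<open>Generalized minors as leading principal minors\<close>

definition lead_minor :: "nat \<Rightarrow> complex mat \<Rightarrow> complex" where
  "lead_minor d A = det (mat d d (\<lambda>(i, j). A $$ (i, j)))"

lemma lead_minor_poly: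
  assumes "d \<le> n"
  shows "lead_minor d \<in> poly_fun n"
proof -
  have "lead_minor d = (\<lambda>A. \<Sum>p\<in>{p. p permutes {0..<d}}. signof p * (\<Prod>i\<in>{0..<d}. A $$ (i, p i)))"
    unfolding lead_minor_def
    by (intro ext) (subst det_def'[OF mat_carrier], auto intro!: sum.cong prod.cong simp: permutes_in_image)
  moreover have "(\<lambda>A. \<Sum>p\<in>{p. p permutes {0..<d}}. signof p * (\<Prod>i\<in>{0..<d}. A $$ (i, p i))) \<in> poly_fun n"
  proof (intro poly_fun_sum poly_fun.mult poly_fun.const poly_fun_prod poly_fun.entry)
    fix p i assume "p \<in> {p. p permutes {0..<d}}" "i \<in> {0..<d}"
    then have "i \<in> {0..<d}" "p i \<in> {0..<d}" using permutes_in_image[of p "{0..<d}" i] by blast+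
    then show "i < n" "p i < n" using assms by auto
  qed (auto simp: finite_permutations)
  ultimately show ?thesis by simp
qed

text \<open>If the left factor is lower or the right factor is upper triangular, the summation
  indices from d onwards do not contribute to the d by d corner, so the corner of the product is the
  product of the corners.\<close>

lemma lead_minor_mult:
  assumes A: "A \<in> carrier_mat n n" and B: "B \<in> carrier_mat n n" and d: "d \<le> n"
    and tri: "tri False n A \<or> tri True n B"
  shows "lead_minor d (A * B) = lead_minor d A * lead_minor d B"
proof -
  let ?m = "\<lambda>A. mat d d (\<lambda>(i, j). A $$ (i, j)) :: complex mat"
  have "?m (A * B) = ?m A * ?m B"
  proof (rule eq_matI)
    fix i j assume "i < dim_row (?m A * ?m B)" "j < dim_col (?m A * ?m B)"
    then have ij: "i < d" "j < d" by auto
    then have ij': "i < n" "j < n" using d by auto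
    have "A $$ (i, k) * B $$ (k, j) = 0" if "k < n" "d \<le> k" for k
      using tri ij ij' that unfolding tri_def by auto
    then have "(\<Sum>k<n. A $$ (i, k) * B $$ (k, j)) = (\<Sum>k<d. A $$ (i, k) * B $$ (k, j))"
      using d by (intro sum.mono_neutral_right) auto
    then show "?m (A * B) $$ (i, j) = (?m A * ?m B) $$ (i, j)"
      using mat_mult_index[OF A B ij'] mat_mult_index[OF mat_carrier mat_carrier ij, of "\<lambda>(i, j). A $$ (i, j)" "\<lambda>(i, j). B $$ (i, j)"] ij
      by (simp del: index_mult_mat(1))
  qed auto
  then show ?thesis
    unfolding lead_minor_def using det_mult[OF mat_carrier mat_carrier] by metis
qed

lemma lead_minor_tri:
  assumes "tri b n A" "d \<le> n"
  shows "lead_minor d A = (\<Prod>p<d. A $$ (p, p))"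
proof -
  let ?m = "mat d d (\<lambda>(i, j). A $$ (i, j))"
  have "det ?m = prod_list (diag_mat ?m)"
  proof (cases b)
    case True
    then have "upper_triangular ?m" using assms by (auto simp: tri_def upper_triangular_def)
    then show ?thesis using det_upper_triangular mat_carrier by blast
  next
    case False
    then have "?m $$ (i, j) = 0" if "i < j" "j < d" for i j
      using that assms by (auto simp: tri_def)
    then show ?thesis using det_lower_triangular[OF _ mat_carrier] by blast
  qed
  also have "\<dots> = (\<Prod>p<d. A $$ (p, p))"
    by (auto simp: prod_list_diag_prod atLeast0LessThan intro!: prod.cong)
  finally show ?thesis by (simp add: lead_minor_def)
qed

lemma unip_in_Sp: "A \<in> unip r b \<Longrightarrow> A \<in> carrier (Sp r)"
  by (auto simp: unip_def dest: borel_in_Sp)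

text \<open>The outer factors of the Gauss decomposition are triangular with unit diagonal and
  contribute 1 to each leading minor; what remains is the product of the first i torus entries, the
  value of \<Lambda>_i.\<close>

lemma lead_minor_gauss:
  assumes i: "i \<in> {1..r}" and x: "x \<in> G0 r"
  shows "torus_char r (fund_weight i) (gauss_torus r x) = lead_minor i x"
proof -
  obtain y h z where yhz: "y \<in> unip r False" "h \<in> torus r" "z \<in> unip r True" "x = y * h * z"
    using x by (auto simp: G0_def N_pos_eq N_neg_eq set_mult_def)
  obtain d where d: "symplectic_diag r d" "h = diag_elt r d" using yhz(2) by (auto simp: torus_eq)
  note c = yhz(1)[THEN unip_in_Sp, THEN Sp_carrier_mat] yhz(3)[THEN unip_in_Sp, THEN Sp_carrier_mat]
  have hc: "h \<in> carrier_mat (2 * r) (2 * r)" by (simp add: d)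
  have ir: "i \<le> 2 * r" using i by auto
  have ty: "tri False (2 * r) y" and tz: "tri True (2 * r) z" using yhz by (auto simp: unip_def borel_tri)
  have "lead_minor i x = lead_minor i y * lead_minor i h * lead_minor i z"
    unfolding yhz(4) using c hc ty tz ir
    by (simp add: lead_minor_mult[of _ "2 * r"] mult_carrier_mat[of _ "2 * r" "2 * r"])
  also have "\<dots> = (\<Prod>p<i. d p)"
    using yhz(1,3) ir lead_minor_tri[OF ty ir] lead_minor_tri[OF tz ir] lead_minor_tri[of True "2 * r" h i]
    by (simp add: unip_def d tri_def)
  finally show ?thesis
    using gauss_torus_eq[OF yhz(1,2,3)] torus_char_fund_weight[OF d(1) i] by (simp add: yhz(4) d(2))
qed

lemma gen_minor_eq:
  assumes i: "i \<in> {1..r}" and w: "weyl_rep r w \<in> carrier (Sp r)" and w': "weyl_rep r w' = 1\<^sub>m (2 * r)"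
    and x: "x \<in> carrier (Sp r)"
  shows "gen_minor r w w' i x = lead_minor i (inv\<^bsub>Sp r\<^esub> weyl_rep r w * x)"
proof -
  let ?w = "weyl_rep r w" and ?n = "2 * r"
  let ?i = "inv\<^bsub>Sp r\<^esub> weyl_rep r w"
  have r: "0 < r" and ir: "i \<le> ?n" using i by auto
  have one: "inv\<^bsub>Sp r\<^esub> 1\<^sub>m ?n = 1\<^sub>m ?n" using Sp.inv_one[of r] by simp
  have iw: "?i \<in> carrier (Sp r)" by (rule Sp.inv_closed[OF w])
  have dom: "(?w <#\<^bsub>Sp r\<^esub> G0 r) #>\<^bsub>Sp r\<^esub> inv\<^bsub>Sp r\<^esub> weyl_rep r w' = {?w * g | g. g \<in> G0 r}"
  proof -
    have "?w * g * 1\<^sub>m ?n = ?w * g" if "g \<in> G0 r" for g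
      by (rule right_mult_one_mat[OF Sp_carrier_mat[OF Sp_mult_closed[OF w G0_in_Sp[OF that]]]])
    then show ?thesis unfolding w' one by (auto simp: l_coset_def r_coset_def)
  qed
  have cancel: "?i * (?w * g) = g" "?w * (?i * g) = g" if "g \<in> carrier (Sp r)" for g
    using Sp_assoc[OF iw w that] Sp_assoc[OF w iw that] Sp_inv_mult[OF w] Sp_carrier_mat[OF that] by simp_all
  have val: "torus_char r (fund_weight i) (gauss_torus r (?i \<otimes>\<^bsub>Sp r\<^esub> (?w * g) \<otimes>\<^bsub>Sp r\<^esub> weyl_rep r w')) = lead_minor i (?i * (?w * g))"
    if "g \<in> G0 r" for g
    using that cancel(1)[OF G0_in_Sp[OF that]] Sp_carrier_mat[OF G0_in_Sp[OF that]] lead_minor_gauss[OF i that]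
    by (simp add: w')
  \<comment> \<open>\<open>regular_functions\<close> requires functions to be
    \<open>undefined\<close> off the group, hence the restriction.\<close>
  let ?f = "restrict (\<lambda>x. lead_minor i (?i * x)) (carrier (Sp r))"
  obtain q where q: "q \<in> poly_fun ?n" "\<forall>A\<in>carrier_mat ?n ?n. q A = lead_minor i (?i * A)"
    using poly_fun_mult_left[OF lead_minor_poly[OF ir] Sp_carrier_mat[OF iw]] by blast
  have "gen_minor r w w' i = ?f"
    unfolding gen_minor_def dom
  proof (rule the_equality)
    have "?f \<in> regular_functions r"
      unfolding regular_functions_def
    proof (intro CollectI conjI bexI[OF _ q(1)] ballI restrict_extensional)
      fix x assume "x \<in> carrier (Sp r)"
      then show "?f x = q x" using q(2) Sp_carrier_mat by simp
    qed
    then show "?f \<in> regular_functions r \<and> (\<forall>x\<in>{?w * g | g. g \<in> G0 r}. ?f x =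
        torus_char r (fund_weight i) (gauss_torus r (?i \<otimes>\<^bsub>Sp r\<^esub> x \<otimes>\<^bsub>Sp r\<^esub> weyl_rep r w')))"
    proof (intro conjI ballI)
      fix x assume "x \<in> {?w * g | g. g \<in> G0 r}"
      then obtain g where g: "g \<in> G0 r" "x = ?w * g" by blast
      show "?f x = torus_char r (fund_weight i) (gauss_torus r (?i \<otimes>\<^bsub>Sp r\<^esub> x \<otimes>\<^bsub>Sp r\<^esub> weyl_rep r w'))"
        unfolding g(2) val[OF g(1)] using Sp_mult_closed[OF w G0_in_Sp[OF g(1)]] by simp
    qed
    fix f assume f: "f \<in> regular_functions r \<and> (\<forall>x\<in>{?w * g | g. g \<in> G0 r}. f x =
        torus_char r (fund_weight i) (gauss_torus r (?i \<otimes>\<^bsub>Sp r\<^esub> x \<otimes>\<^bsub>Sp r\<^esub> weyl_rep r w')))"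
    then obtain p where p: "f \<in> extensional (carrier (Sp r))" "p \<in> poly_fun ?n" "\<forall>x\<in>carrier (Sp r). f x = p x"
      unfolding regular_functions_def by blast
    \<comment> \<open>The difference of the two candidates is pulled back along w, so that it
      vanishes on the big cell itself and \<open>G0_dense\<close> applies.\<close>
    have "(\<lambda>A. p A + (- 1) * q A) \<in> poly_fun ?n"
      by (intro poly_fun.add poly_fun.mult poly_fun.const p q)
    then obtain q' where q': "q' \<in> poly_fun ?n" "\<forall>A\<in>carrier_mat ?n ?n. q' A = p (?w * A) + (- 1) * q (?w * A)"
      using poly_fun_mult_left[OF _ Sp_carrier_mat[OF w]] by blast
    have "q' g = 0" if g: "g \<in> G0 r" for g
    proof -
      have "p (?w * g) = f (?w * g)" using p(3) Sp_mult_closed[OF w G0_in_Sp[OF g]] by simp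
      also have "f (?w * g) = torus_char r (fund_weight i) (gauss_torus r (?i \<otimes>\<^bsub>Sp r\<^esub> (?w * g) \<otimes>\<^bsub>Sp r\<^esub> weyl_rep r w'))"
        by (rule bspec[OF conjunct2[OF f]]) (use g in blast)
      also have "\<dots> = lead_minor i (?i * (?w * g))" by (rule val[OF g])
      also have "\<dots> = q (?w * g)" using q(2) Sp_carrier_mat[OF Sp_mult_closed[OF w G0_in_Sp[OF g]]] by simp
      finally show ?thesis using q'(2) Sp_carrier_mat[OF G0_in_Sp[OF g]] by simp
    qed
    then have *: "q' g = 0" if "g \<in> carrier (Sp r)" for g
      using G0_dense[OF r q'(1) _ that] by blast
    show "f = ?f"
    proof (rule extensionalityI[OF p(1)])
      fix x assume x: "x \<in> carrier (Sp r)"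
      have "q' (?i * x) = 0" by (rule *[OF Sp_mult_closed[OF iw x]])
      then have "p x = q x"
        using q'(2) Sp_carrier_mat[OF Sp_mult_closed[OF iw x]] cancel(2)[OF x] by simp
      then show "f x = ?f x" using p(3) q(2) x Sp_carrier_mat[OF x] by simp
    qed simp
  qed
  then show ?thesis using x by simp
qed

section \<open>Representatives of Weyl group elements\<close>

text \<open>Only the positions of possible nonzero entries are recorded: the signs and scalars
  depend on the representative, but they cancel when a diagonal matrix is conjugated.\<close>

definition monomial :: "nat \<Rightarrow> (nat \<Rightarrow> nat) \<Rightarrow> complex mat \<Rightarrow> bool" where
  "monomial r \<pi> x \<longleftrightarrow> x \<in> carrier (Sp r) \<and> (\<forall>p<2*r. \<forall>q<2*r. p \<noteq> \<pi> q \<longrightarrow> x $$ (p, q) = 0)"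

lemma monomial_mult:
  assumes "monomial r \<pi> x" "monomial r \<rho> y"
  shows "monomial r (\<pi> \<circ> \<rho>) (x * y)"
  unfolding monomial_def
proof (intro conjI allI impI)
  show "x * y \<in> carrier (Sp r)" using assms by (auto simp: monomial_def)
  fix p q assume pq: "p < 2 * r" "q < 2 * r" "p \<noteq> (\<pi> \<circ> \<rho>) q"
  have c: "x \<in> carrier_mat (2 * r) (2 * r)" "y \<in> carrier_mat (2 * r) (2 * r)"
    using assms by (auto simp: monomial_def dest: Sp_carrier_mat)
  have "x $$ (p, k) * y $$ (k, q) = 0" if "k < 2 * r" for k
  proof (cases "k = \<rho> q")
    case True
    then have "x $$ (p, k) = 0" using assms(1) pq that by (simp add: monomial_def)
    then show ?thesis by simp
  next
    case False
    then have "y $$ (k, q) = 0" using assms(2) pq that by (simp add: monomial_def)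
    then show ?thesis by simp
  qed
  then show "(x * y) $$ (p, q) = 0"
    unfolding mat_mult_index[OF c pq(1,2)] by (intro sum.neutral) blast
qed

lemma monomial_torus: "h \<in> torus r \<Longrightarrow> monomial r id h"
  unfolding monomial_def using torus_subset_Sp by (auto simp: torus_eq)

text \<open>The simple reflection \<open>s_i\<close> as a permutation of the basis positions.\<close>

definition refl_perm :: "nat \<Rightarrow> nat \<Rightarrow> nat \<Rightarrow> nat" where
  "refl_perm r i q =
     (if q = i - 1 \<or> q = 2 * r - 1 - i then q + 1 else if q = i \<or> q = 2 * r - i then q - 1 else q)"

lemma s_bar_in_Sp: "i \<in> {1..r} \<Longrightarrow> s_bar r i \<in> carrier (Sp r)"
  by (auto simp: s_bar_def intro!: Sp_mult_closed x_sub_in_Sp y_sub_in_Sp)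

text \<open>On each pair of positions joined by the root, x_i(-1) y_i(1) x_i(-1) multiplies out to
  the 2 by 2 matrix with rows (0, -1) and (1, 0).\<close>

lemma monomial_s_bar:
  assumes i: "i \<in> {1..r}"
  shows "monomial r (refl_perm r i) (s_bar r i)"
  unfolding monomial_def
proof (intro conjI allI impI s_bar_in_Sp[OF i])
  fix p q assume pq: "p < 2 * r" "q < 2 * r" and ne: "p \<noteq> refl_perm r i q"
  define S where "S p \<longleftrightarrow> p = i - 1 \<or> p = 2 * r - 1 - i" for p
  define S' where "S' p \<longleftrightarrow> p = i \<or> p = 2 * r - i" for p
  have lt: "p + 1 < 2 * r" if "S p" using that i by (auto simp: S_def)
  have S': "S' (p + 1) \<longleftrightarrow> S p" "\<not> S' 0" for p using i by (auto simp: S_def S'_def)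
  have SS: "\<not> (S p \<and> S' p)" for p
    using i[unfolded atLeastAtMost_iff] unfolding S_def S'_def by presburger
  have ne': "p \<noteq> (if S q then q + 1 else if S' q then q - 1 else q)"
    using ne unfolding refl_perm_def S_def S'_def .
  let ?X = "x_sub r i (- 1)" and ?Y = "y_sub r i 1"
  note cx = x_sub_carrier_mat[OF i, of "- 1"] and cy = y_sub_carrier_mat[OF i, of 1]
  have cN: "?Y * ?X \<in> carrier_mat (2 * r) (2 * r)" by (rule mult_carrier_mat[OF cy cx])
  have X: "?X $$ (a, q) = (if a = q then 1 else if q = a + 1 \<and> S a then - 1 else 0)"
    if "a < 2 * r" for a
    using x_sub_index[OF i that pq(2)] by (simp only: S_def)
  have N: "(?Y * ?X) $$ (a, q) = ?X $$ (a, q) + (if S' a then ?X $$ (a - 1, q) else 0)" if "a < 2 * r" for a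
    using y_sub_mult_index[OF i cx that pq(2), of 1] by (simp add: S'_def del: index_mult_mat(1))
  have "s_bar r i = ?X * (?Y * ?X)"
    using assoc_mult_mat[OF cx cy cx] by (simp add: s_bar_def)
  then have s: "s_bar r i $$ (p, q) = (?Y * ?X) $$ (p, q) - (if S p then (?Y * ?X) $$ (p + 1, q) else 0)"
    using x_sub_mult_index[OF i cN pq, of "- 1"] by (simp add: S_def del: index_mult_mat(1))
  show "s_bar r i $$ (p, q) = 0"
  proof (cases "S p")
    case True
    have nS': "\<not> S' p" "\<not> S (p + 1)" using SS[of p] SS[of "p + 1"] True S'(1)[of p] by auto
    have "q \<noteq> p + 1" using ne' nS'(2) S'(1)[of p] True by auto
    then show ?thesis
      unfolding s N[OF pq(1)] N[OF lt[OF True]] using X[OF pq(1)] X[OF lt[OF True]] S'(1)[of p] nS' True by auto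
  next
    case nS: False
    show ?thesis
    proof (cases "S' p")
      case True
      then obtain p' where p': "p = Suc p'" using S'(2) by (cases p) auto
      then have Sp': "S p'" "p' < 2 * r" using True S'(1)[of p'] pq by auto
      have "q \<noteq> p'" using ne' Sp' p' by auto
      then show ?thesis
        unfolding s N[OF pq(1)] using X[OF pq(1)] X[OF Sp'(2)] Sp' p' nS True by auto
    next
      case False
      then have "q \<noteq> p" using ne' nS by auto
      then show ?thesis unfolding s N[OF pq(1)] using X[OF pq(1)] nS False by auto
    qed
  qed
qed

text \<open>The order of composition follows the matrix product: the last letter acts first.\<close>

definition word_perm :: "nat \<Rightarrow> nat list \<Rightarrow> nat \<Rightarrow> nat" where
  "word_perm r js = foldr (\<lambda>j f. refl_perm r j \<circ> f) js id"

lemma word_perm_simps [simp]: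
  "word_perm r [] = id" "word_perm r (j # js) = refl_perm r j \<circ> word_perm r js"
  by (simp_all add: word_perm_def)

lemma word_perm_append: "word_perm r (xs @ ys) = word_perm r xs \<circ> word_perm r ys"
  by (induction xs) (simp_all add: comp_assoc)

lemma weyl_simps: "X \<otimes>\<^bsub>weyl r\<^esub> Y = {x * y | x y. x \<in> X \<and> y \<in> Y}" "\<one>\<^bsub>weyl r\<^esub> = torus r"
  by (auto simp: weyl_def torus_normalizer_def FactGroup_def set_mult_def)

lemma simple_refl_eq: "simple_refl r i = {h * s_bar r i | h. h \<in> torus r}"
  by (auto simp: simple_refl_def r_coset_def torus_normalizer_def)

lemma word_elt_simps:
  "word_elt r [] = torus r"
  "word_elt r (j # js) = {x * y | x y. x \<in> simple_refl r j \<and> y \<in> word_elt r js}"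
  by (simp_all add: word_elt_def list_mult_def weyl_simps)

lemma word_elt_monomial:
  "set js \<subseteq> {1..r} \<Longrightarrow> x \<in> word_elt r js \<Longrightarrow> monomial r (word_perm r js) x"
proof (induction js arbitrary: x)
  case Nil
  then show ?case by (simp only: word_elt_simps word_perm_simps monomial_torus)
next
  case (Cons j js)
  then obtain h y where h: "h \<in> torus r" and y: "y \<in> word_elt r js" and x: "x = h * s_bar r j * y"
    by (auto simp: word_elt_simps simple_refl_eq)
  have "j \<in> {1..r}" "set js \<subseteq> {1..r}" using Cons.prems(1) by auto
  then have "monomial r (id \<circ> refl_perm r j \<circ> word_perm r js) x"
    unfolding x by (intro monomial_mult monomial_torus h monomial_s_bar Cons.IH y)
  then show ?case by (simp only: word_perm_simps id_comp)
qed

lemma list_mult_s_bar_in_word_elt: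
  "set js \<subseteq> {1..r} \<Longrightarrow> list_mult (Sp r) (map (s_bar r) js) \<in> word_elt r js"
proof (induction js)
  case Nil
  then show ?case
    using subgroup.one_closed[OF subgroup_torus, of r] by (simp add: list_mult_def word_elt_simps)
next
  case (Cons j js)
  have "1\<^sub>m (2 * r) \<in> torus r" using subgroup.one_closed[OF subgroup_torus, of r] by simp
  moreover have "1\<^sub>m (2 * r) * s_bar r j = s_bar r j"
    using Cons.prems by (intro left_mult_one_mat[OF Sp_carrier_mat[OF s_bar_in_Sp]]) simp
  ultimately have "s_bar r j \<in> simple_refl r j" unfolding simple_refl_eq by (intro CollectI exI[of _ "1\<^sub>m (2 * r)"]) simp
  then show ?case using Cons by (auto simp: list_mult_def word_elt_simps)
qed

text \<open>The reduced word picked by \<open>SOME\<close> may differ from \<open>js\<close>, but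
  its product lies in the coset of \<open>js\<close>, and \<open>word_elt_monomial\<close> gives
  every element of that coset the pattern of \<open>js\<close>.\<close>

lemma weyl_rep_monomial:
  assumes "set js \<subseteq> {1..r}"
  shows "monomial r (word_perm r js) (weyl_rep r (word_elt r js))"
proof -
  define ks where "ks = (SOME ks. reduced_word r (word_elt r js) ks)"
  \<comment> \<open>\<open>js\<close> itself represents the coset, so a word of minimal length
    exists.\<close>
  have "\<exists>ks. reduced_word r (word_elt r js) ks"
    unfolding reduced_word_def
    using is_arg_min_arg_min_nat[of "\<lambda>ks. set ks \<subseteq> {1..r} \<and> word_elt r ks = word_elt r js" js length] assms
    by blast
  then have "reduced_word r (word_elt r js) ks"
    unfolding ks_def by (rule someI_ex)
  then have ks: "set ks \<subseteq> {1..r}" "word_elt r ks = word_elt r js"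
    by (auto simp: reduced_word_def is_arg_min_def)
  then have "list_mult (Sp r) (map (s_bar r) ks) \<in> word_elt r js"
    using list_mult_s_bar_in_word_elt by metis
  then show ?thesis
    using word_elt_monomial[OF assms] by (simp add: weyl_rep_def ks_def)
qed

text \<open>The empty word represents the identity coset and is the only word of length 0, which
  forces the choice.\<close>

lemma weyl_rep_one: "weyl_rep r \<one>\<^bsub>weyl r\<^esub> = 1\<^sub>m (2 * r)"
proof -
  have "reduced_word r \<one>\<^bsub>weyl r\<^esub> js \<longleftrightarrow> js = []" for js
    by (auto simp: reduced_word_def is_arg_min_def weyl_simps word_elt_simps dest!: spec[of _ "[]"])
  then have "(SOME js. reduced_word r \<one>\<^bsub>weyl r\<^esub> js) = []" by simp
  then show ?thesis by (simp add: weyl_rep_def list_mult_def)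
qed

text \<open>In column q only the entry in row \<open>\<pi> q\<close> can survive, and both sides
  scale it by d at that row.\<close>

lemma monomial_diag:
  assumes "monomial r \<pi> x"
  shows "diag_elt r d * x = x * diag_elt r (d \<circ> \<pi>)"
proof (rule eq_matI)
  have c: "x \<in> carrier_mat (2 * r) (2 * r)" using assms by (auto simp: monomial_def dest: Sp_carrier_mat)
  fix p q assume "p < dim_row (x * diag_elt r (d \<circ> \<pi>))" "q < dim_col (x * diag_elt r (d \<circ> \<pi>))"
  then have pq: "p < 2 * r" "q < 2 * r" using c by auto
  show "(diag_elt r d * x) $$ (p, q) = (x * diag_elt r (d \<circ> \<pi>)) $$ (p, q)"
    unfolding diag_elt_mult_left[OF c pq] diag_elt_mult_right[OF c pq]
    using assms pq by (cases "p = \<pi> q") (auto simp: monomial_def)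
qed (use assms in \<open>auto simp: monomial_def dest: Sp_carrier_mat\<close>)

lemma gen_minor_diag_mult:
  assumes js: "set js \<subseteq> {1..r}" and i: "i \<in> {1..r}" and d: "symplectic_diag r d" and x: "x \<in> carrier (Sp r)"
  shows "gen_minor r (word_elt r js) \<one>\<^bsub>weyl r\<^esub> i (diag_elt r d * x) =
    (\<Prod>q<i. d (word_perm r js q)) * gen_minor r (word_elt r js) \<one>\<^bsub>weyl r\<^esub> i x"
proof -
  let ?w = "weyl_rep r (word_elt r js)" and ?n = "2 * r"
  let ?i = "inv\<^bsub>Sp r\<^esub> ?w" and ?d = "d \<circ> word_perm r js"
  note mono = weyl_rep_monomial[OF js]
  have w: "?w \<in> carrier (Sp r)" using mono by (simp add: monomial_def)
  have iw: "?i \<in> carrier (Sp r)" by (rule Sp.inv_closed[OF w])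
  note c = Sp_carrier_mat[OF w] Sp_carrier_mat[OF iw] Sp_carrier_mat[OF x]
  have ir: "i \<le> ?n" using i by auto
  have tri: "tri False ?n (diag_elt r ?d)" by (simp add: tri_def)
  \<comment> \<open>Inserting w w^{-1} lets the diagonal matrix pass w, which permutes its entries
    and leaves it as a left factor of w^{-1} x.\<close>
  have "diag_elt r d = diag_elt r d * (?w * ?i)" using Sp_inv_mult(2)[OF w] right_mult_one_mat[OF diag_elt_carrier(1)] by simp
  also have "\<dots> = ?w * diag_elt r ?d * ?i"
    using assoc_mult_mat[OF diag_elt_carrier(1) c(1,2), of d] monomial_diag[OF mono, of d] by simp
  finally have "?i * (diag_elt r d * x) = ?i * (?w * diag_elt r ?d * ?i * x)" by simp
  also have "\<dots> = (?i * ?w) * (diag_elt r ?d * (?i * x))"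
    using c by (simp add: mat_assoc_square[where n = ?n])
  also have "\<dots> = diag_elt r ?d * (?i * x)"
    unfolding Sp_inv_mult(1)[OF w] using c
    by (intro left_mult_one_mat mult_carrier_mat[of _ ?n ?n] diag_elt_carrier) auto
  finally have "?i * (diag_elt r d * x) = diag_elt r ?d * (?i * x)" .
  moreover have "lead_minor i (diag_elt r ?d * (?i * x)) = (\<Prod>q<i. d (word_perm r js q)) * lead_minor i (?i * x)"
    using lead_minor_mult[OF diag_elt_carrier(1) mult_carrier_mat[OF c(2,3)] ir disjI1[OF tri]]
      lead_minor_tri[OF tri ir] ir by simp
  moreover have "diag_elt r d * x \<in> carrier (Sp r)" by (intro Sp_mult_closed diag_elt_in_Sp d x)
  ultimately show ?thesis
    using gen_minor_eq[OF i w weyl_rep_one] x by simp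
qed

section \<open>Weights along the word\<close>

text \<open>s_1 ... s_d is a cycle on the first d + 1 positions, mirrored on the last d + 1. The
  excluded q = d is where the first cycle wraps around to 0.\<close>

lemma word_perm_initial:
  assumes "d < r" "q < 2 * r" "q \<noteq> d"
  shows "word_perm r [1..<Suc d] q =
    (if q < d then q + 1 else if q < 2 * r - 1 - d then q else if q = 2 * r - 1 - d then 2 * r - 1 else q - 1)"
  using assms
proof (induction d arbitrary: q)
  case 0
  then show ?case by auto
next
  case (Suc d)
  have IH: "word_perm r [1..<Suc d] p =
    (if p < d then p + 1 else if p < 2 * r - 1 - d then p else if p = 2 * r - 1 - d then 2 * r - 1 else p - 1)"
    if "p < 2 * r" "p \<noteq> d" for p
    using Suc.IH[OF _ that] Suc.prems(1) by simp
  have step: "word_perm r [1..<Suc (Suc d)] q = word_perm r [1..<Suc d] (refl_perm r (Suc d) q)"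
    by (simp add: word_perm_append)
  \<comment> \<open>The letter d + 1 moves only d, d + 1 and their opposites 2r - 1 - d, 2r - 2 - d;
    the cases follow these breakpoints, with d + 1 excluded by hypothesis.\<close>
  consider "q < d" | "q = d" | "Suc d < q" "q < 2 * r - 2 - d" | "q = 2 * r - 2 - d"
    | "q = 2 * r - 1 - d" | "2 * r - 1 - d < q"
    using Suc.prems(3) by linarith
  then show ?case
  proof cases
    case 1
    then have "refl_perm r (Suc d) q = q" using Suc.prems(1) by (auto simp: refl_perm_def)
    then show ?thesis unfolding step using IH[of q] 1 Suc.prems by simp
  next
    case 2
    then have "refl_perm r (Suc d) q = Suc d" by (simp add: refl_perm_def)
    moreover have "Suc d < 2 * r - 1 - d" using Suc.prems(1) by auto
    ultimately show ?thesis unfolding step using IH[of "Suc d"] 2 Suc.prems by simp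
  next
    case 3
    then have "refl_perm r (Suc d) q = q" by (auto simp: refl_perm_def)
    then show ?thesis unfolding step using IH[of q] 3 Suc.prems by simp
  next
    case 4
    then have "refl_perm r (Suc d) q = 2 * r - 1 - d" using Suc.prems(1) by (auto simp: refl_perm_def)
    then show ?thesis unfolding step using IH[of "2 * r - 1 - d"] 4 Suc.prems by auto
  next
    case 5
    then have "refl_perm r (Suc d) q = 2 * r - 2 - d" using Suc.prems(1) by (auto simp: refl_perm_def)
    then show ?thesis unfolding step using IH[of "2 * r - 2 - d"] 5 Suc.prems by auto
  next
    case 6
    then have "refl_perm r (Suc d) q = q" using Suc.prems(1) by (auto simp: refl_perm_def)
    moreover have "q \<noteq> d" "\<not> q < Suc d" using 6 Suc.prems(1) by auto
    ultimately show ?thesis unfolding step using IH[of q] 6 Suc.prems by (auto simp del: upt_Suc)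
  qed
qed

text \<open>The Coxeter element runs cyclically through v_1, ..., v_r, v_{bar 1}, ..., v_{bar r}.
  The excluded position r carries v_{bar r}, which returns to v_1.\<close>

lemma word_perm_cycle:
  assumes "q < 2 * r" "q \<noteq> r"
  shows "word_perm r [1..<Suc r] q = (if q < r - 1 then q + 1 else if q = r - 1 then 2 * r - 1 else q - 1)"
proof -
  have r: "Suc (r - 1) = r" using assms(1) by simp
  have "word_perm r [1..<Suc r] q = word_perm r ([1..<Suc (r - 1)] @ [r]) q"
    using assms(1) by (simp add: r)
  also have "\<dots> = word_perm r [1..<Suc (r - 1)] (refl_perm r r q)"
    by (simp only: word_perm_append word_perm_simps comp_apply id_apply)
  finally have step: "word_perm r [1..<Suc r] q = word_perm r [1..<Suc (r - 1)] (refl_perm r r q)" .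
  show ?thesis
  proof (cases "q = r - 1")
    case True
    then have "refl_perm r r q = r" using r by (simp add: refl_perm_def)
    then show ?thesis unfolding step using word_perm_initial[of "r - 1" r r] True r assms by auto
  next
    case False
    then have "refl_perm r r q = q" using assms by (auto simp: refl_perm_def)
    then show ?thesis unfolding step using word_perm_initial[of "r - 1" r q] False r assms by auto
  qed
qed

text \<open>The initial piece advances q < d by one step along the cyclic list of the Coxeter
  element, and each full cycle by one more. Entry n of that list, counted from 0, sits at position n
  in the unbarred half and at 3r - 1 - n in the barred half; the bound 2r excludes wrapping
  around.\<close>

lemma word_perm_cycles:
  assumes "q < d" "d \<le> r" "q + k + 1 < 2 * r"
  shows "word_perm r (concat (replicate k [1..<Suc r]) @ [1..<Suc d]) q =
    (if q + k + 1 < r then q + k + 1 else 3 * r - 1 - (q + k + 1))"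
  using assms(3)
proof (induction k)
  case 0
  show ?case
  proof (cases "d = r")
    case True
    then show ?thesis using assms word_perm_cycle[of q r] by (simp del: upt_Suc) linarith
  next
    case False
    then show ?thesis using assms word_perm_initial[of d r q] by (simp del: upt_Suc)
  qed
next
  case (Suc k)
  have "word_perm r (concat (replicate (Suc k) [1..<Suc r]) @ [1..<Suc d]) q =
     word_perm r [1..<Suc r] (word_perm r (concat (replicate k [1..<Suc r]) @ [1..<Suc d]) q)"
    by (simp only: replicate_Suc concat.simps append_assoc word_perm_append comp_apply)
  also have "\<dots> = word_perm r [1..<Suc r] (if q + k + 1 < r then q + k + 1 else 3 * r - 1 - (q + k + 1))"
    using Suc by (simp del: upt_Suc)
  also have "\<dots> = (if q + Suc k + 1 < r then q + Suc k + 1 else 3 * r - 1 - (q + Suc k + 1))"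
    using Suc.prems by (subst word_perm_cycle) auto
  finally show ?case .
qed

lemma prod_weights:
  fixes t :: complex and a :: "nat \<Rightarrow> int"
  assumes t: "t \<noteq> 0" and m: "1 \<le> m" "m \<le> r" and d: "d \<le> r"
  shows "(\<Prod>q<d. \<Prod>j\<in>{1..r}. (t powi a j) powi basis_weight r (if q + m < r then q + m else 3 * r - 1 - (q + m)) j) =
    t powi (if m + d > r then a r - a m - a (m + d - r) else a (m + d) - a m)"
proof -
  \<comment> \<open>Since \<open>\<Lambda>_0 = 0\<close>, the value \<open>a 0\<close> must not contribute to the telescoping product.\<close>
  define b where "b j = (if j = 0 then 0 else a j)" for j
  \<comment> \<open>Up to entry n of the cyclic list the weights sum to \<Lambda>_n, or to
    \<Lambda>_r - \<Lambda>_{n-r} past the middle; \<open>g n\<close> is the corresponding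
    exponent.\<close>
  define g where "g n = (if n \<le> r then b n else b r - b (n - r))" for n
  have sigma: "(if j = 0 then 1 else t powi a j) = t powi b j" for j by (simp add: b_def)
  have nz: "\<forall>j\<in>{1..r}. t powi a j \<noteq> 0" using t by simp
  have factor: "(\<Prod>j\<in>{1..r}. (t powi a j) powi basis_weight r (if n < r then n else 3 * r - 1 - n) j) =
      t powi (g (Suc n) - g n)" if n: "n < 2 * r" for n
  proof (cases "n < r")
    case True
    then show ?thesis
      using prod_powi_basis_weight[OF n nz] t unfolding sigma by (simp add: g_def power_int_diff)
  next
    case False
    define p where "p = 3 * r - 1 - n"
    have p: "p < 2 * r" "\<not> p < r" "2 * r - p = Suc n - r" "2 * r - p - 1 = n - r"
      using False n by (auto simp: p_def)
    have "(\<Prod>j\<in>{1..r}. (t powi a j) powi basis_weight r p j) = t powi b (n - r) / t powi b (Suc n - r)"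
      using prod_powi_basis_weight[OF p(1) nz] p unfolding sigma by simp
    also have "\<dots> = t powi (b (n - r) - b (Suc n - r))" using t by (simp add: power_int_diff)
    also have "b (n - r) - b (Suc n - r) = g (Suc n) - g n"
    \<comment> \<open>At the junction the two branches of g fit together because b vanishes at
      0.\<close>
    proof (cases "n = r")
      case True
      then show ?thesis by (simp add: g_def b_def)
    next
      case nr: False
      then show ?thesis using False by (simp add: g_def)
    qed
    finally show ?thesis using False by (simp add: p_def)
  qed
  have "(\<Prod>q<d. \<Prod>j\<in>{1..r}. (t powi a j) powi basis_weight r (if q + m < r then q + m else 3 * r - 1 - (q + m)) j) =
      t powi (g (m + d) - g m)"
    using d
  proof (induction d)
    case 0
    then show ?case by simp
  next
    case (Suc d)
    have "d + m < 2 * r" using Suc.prems m by simp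
    from factor[OF this] show ?case
      using Suc t by (simp add: power_int_add[symmetric] add.commute)
  qed
  then show ?thesis using m by (auto simp: g_def b_def algebra_simps)
qed

section \<open>Cycles and letters of the word\<close>

lemma cell_index_Suc:
  "1 \<le> m \<Longrightarrow> cell_index r (Suc m) l = cell_index r m r @ map (Pair (Suc m)) [1..<Suc l]"
  by (simp add: cell_index_def del: upt_Suc) (simp add: upt_Suc)

lemma cell_index_length: "1 \<le> m \<Longrightarrow> length (cell_index r m l) = (m - 1) * r + l"
proof (induction m arbitrary: l rule: nat_induct_at_least)
  case base
  then show ?case by (simp add: cell_index_def)
next
  case (Suc m)
  then show ?case by (cases m) (simp_all add: cell_index_Suc del: upt_Suc)
qed

text \<open>A prefix of the word again consists of full cycles followed by an initial piece, so the
  permutation formula for such words applies to every prefix. The induction peels off the last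
  cycle.\<close>

lemma cell_index_take:
  assumes "1 \<le> m" "l \<le> r" "1 \<le> k" "k \<le> (m - 1) * r + l" "cell_index r m l ! (k - 1) = (m', d)"
  shows "1 \<le> m' \<and> m' \<le> m \<and> 1 \<le> d \<and> d \<le> r \<and> take k (cell_index r m l) = cell_index r m' d"
  using assms
proof (induction m arbitrary: l rule: nat_induct_at_least)
  case base
  then have k: "1 \<le> k" "k \<le> l" by auto
  then have "m' = 1" "d = k" using base by (auto simp: cell_index_def simp del: upt_Suc)
  then show ?case
    using k base by (auto simp: cell_index_def take_map simp del: upt_Suc)
next
  case (Suc m)
  let ?c = "cell_index r m r" and ?n = "length (cell_index r m r)"
  have len: "?n = m * r" using Suc.hyps cell_index_length[of m r r] by (cases m) auto
  show ?case
  proof (cases "k \<le> ?n")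
    case True
    then have "?c ! (k - 1) = (m', d)"
    proof -
      have "k - 1 < ?n" using True Suc.prems by auto
      then show ?thesis
        using Suc.prems(4) Suc.hyps by (simp add: cell_index_Suc nth_append del: upt_Suc)
    qed
    moreover have "k \<le> (m - 1) * r + r" using True cell_index_length[OF Suc.hyps, of r r] by simp
    ultimately have "1 \<le> m' \<and> m' \<le> m \<and> 1 \<le> d \<and> d \<le> r \<and> take k ?c = cell_index r m' d"
      using Suc.IH[of r] Suc.prems by simp
    then show ?thesis using True Suc.hyps by (simp add: cell_index_Suc del: upt_Suc)
  next
    case False
    define k' where "k' = k - ?n"
    have k': "1 \<le> k'" "k' \<le> l" "k = ?n + k'" using False Suc.prems len by (auto simp: k'_def)
    have "(m', d) = map (Pair (Suc m)) [1..<Suc l] ! (k' - 1)"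
    proof -
      have k1: "k - 1 = ?n + (k' - 1)" using k' by simp
      show ?thesis
        using Suc.prems(4) unfolding cell_index_Suc[OF Suc.hyps] k1 nth_append_length_plus by simp
    qed
    also have "\<dots> = (Suc m, k')" using k' by (simp del: upt_Suc)
    finally have "m' = Suc m" "d = k'" by auto
    moreover have "take k (cell_index r (Suc m) l) = cell_index r (Suc m) k'"
      using k' Suc.hyps by (simp add: cell_index_Suc take_map del: upt_Suc)
    ultimately show ?thesis using k' Suc.prems by simp
  qed
qed

lemma cell_index_letters: "l \<le> r \<Longrightarrow> (s, j) \<in> set (cell_index r m l) \<Longrightarrow> j \<in> {1..r}"
  by (auto simp: cell_index_def)

lemma cell_word_eq: "cell_word r m l = concat (replicate (m - 1) [1..<Suc r]) @ [1..<Suc l]"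
proof -
  have "map (\<lambda>s. map snd (map (Pair s) xs)) ys = replicate (length ys) xs" for xs :: "nat list" and ys :: "nat list"
    by (induction ys) (simp_all add: comp_def)
  then show ?thesis
    by (simp add: cell_word_def cell_index_def map_concat comp_def del: upt_Suc)
qed

lemma x_neg_in_Sp:
  assumes "i \<in> {1..r}" "t \<noteq> 0"
  shows "x_neg r i t \<in> carrier (Sp r)"
  unfolding x_neg_def using assms by (simp add: Sp_mult_closed y_sub_in_Sp coroot_in_Sp)

lemma xL_in_Sp:
  assumes "l \<le> r" "\<forall>(s, j) \<in> set (cell_index r m l). Y s j \<noteq> 0"
  shows "xL r m l Y \<in> carrier (Sp r)"
proof -
  have "list_mult (Sp r) (map (\<lambda>(s, j). x_neg r j (Y s j)) ps) \<in> carrier (Sp r)"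
    if "set ps \<subseteq> set (cell_index r m l)" for ps
    using that
  proof (induction ps)
    case Nil
    then show ?case using Sp.one_closed[of r] by (simp add: list_mult_def)
  next
    case (Cons p ps)
    obtain s j where p: "p = (s, j)" by (cases p)
    then have "x_neg r j (Y s j) \<in> carrier (Sp r)"
      using Cons.prems assms(2) cell_index_letters[OF assms(1)] by (intro x_neg_in_Sp) auto
    then show ?case using Cons p by (auto simp: list_mult_def)
  qed
  then show ?thesis by (simp add: xL_def)
qed

theorem proposition5p3:
  fixes r m l n k m' d :: nat
    and t :: complex
    and a :: "nat \<Rightarrow> int"
    and Y :: "nat \<Rightarrow> nat \<Rightarrow> complex"
  assumes "1 \<le> m" "m \<le> r"
    and "1 \<le> l" "l \<le> r"
    and "n = (m - 1) * r + l"
    and "k \<in> {1..n}"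
    and "cell_index r m l ! (k - 1) = (m', d)"
    and "t \<noteq> 0"
    and "\<forall>(s, j) \<in> set (cell_index r m l). Y s j \<noteq> 0"
  shows "minor_G r m l k (torus_elt r t a) Y =
    (if m' + d > r
     then t powi (a r - a m' - a (m' + d - r)) * minor_L r m l k Y
     else t powi (a (m' + d) - a m') * minor_L r m l k Y)"
proof -
  have k: "1 \<le> k" "k \<le> (m - 1) * r + l" using assms(5,6) by auto
  have md: "1 \<le> m'" "m' \<le> m" "1 \<le> d" "d \<le> r" and take: "take k (cell_index r m l) = cell_index r m' d"
    using cell_index_take[OF assms(1,4) k assms(7)] by auto
  define js where "js = cell_word r m' d"
  have take_word: "take k (cell_word r m l) = js"
    unfolding js_def cell_word_def take[symmetric] by (simp add: take_map)
  have letter: "cell_word r m l ! (k - 1) = d"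
    using k cell_index_length[OF assms(1), of r l] assms(7) by (simp add: cell_word_def)
  have js: "set js \<subseteq> {1..r}" using md(4) cell_index_letters by (fastforce simp: js_def cell_word_def)
  have d: "d \<in> {1..r}" using md by simp
  define e where "e p = (\<Prod>j\<in>{1..r}. (t powi a j) powi basis_weight r p j)" for p
  have te: "torus_elt r t a = diag_elt r e"
    unfolding e_def by (rule torus_elt_eq[OF assms(8)])
  have e: "symplectic_diag r e"
  proof -
    obtain e' where "symplectic_diag r e'" "torus_elt r t a = diag_elt r e'"
      using torus_elt_in_torus[OF assms(8), of r a] unfolding torus_eq by blast
    then show ?thesis using te by (simp add: diag_elt_eq_iff symplectic_diag_def)
  qed
  \<comment> \<open>The prefix has m' - 1 full cycles, and its initial piece adds one more step, so
    q advances by m' in total.\<close>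
  have "(\<Prod>q<d. e (word_perm r js q)) =
      (\<Prod>q<d. e (if q + m' < r then q + m' else 3 * r - 1 - (q + m')))"
  proof (intro prod.cong refl)
    fix q assume "q \<in> {..<d}"
    then have "q < d" "q + (m' - 1) + 1 < 2 * r" "q + (m' - 1) + 1 = q + m'" using md assms(2) by auto
    then show "e (word_perm r js q) = e (if q + m' < r then q + m' else 3 * r - 1 - (q + m'))"
      using word_perm_cycles[of q d r "m' - 1"] md(4) by (simp only: js_def cell_word_eq)
  qed
  also have "\<dots> = t powi (if m' + d > r then a r - a m' - a (m' + d - r) else a (m' + d) - a m')"
    unfolding e_def using md assms(2,8) by (intro prod_weights) auto
  finally have "minor_G r m l k (torus_elt r t a) Y =
      t powi (if m' + d > r then a r - a m' - a (m' + d - r) else a (m' + d) - a m') * minor_L r m l k Y"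
    using gen_minor_diag_mult[OF js d e xL_in_Sp[OF assms(4,9)]]
    by (simp add: minor_G_def minor_L_def minor_at_def xG_def te take_word letter del: One_nat_def)
  then show ?thesis by simp
qed

end
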